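(* Let $q\in\mathbb{C}[z_1,z_2]$ be an irreducible polynomial that does not vanish on $\Omega_p$, and assume moreover that $q$ has finitely many zeros on $\partial\Omega_p$. Then $q$ is cyclic in $\mathcal{D}_\beta(\Omega_p)$ if and only if $\beta\le2$.
   Context: For $p\ge1$ let $\Omega_p=\{(z_1,z_2)\in\mathbb{C}^2:|z_1|^{2p}+|z_2|^{2p}<1\}$, with boundary $\partial\Omega_p$. For $\beta\in\mathbb{R}$, $\mathcal{D}_\beta(\Omega_p)$ is the Hilbert space of holomorphic functions $f(z)=\sum_{L}a_Lz^L$ on $\Omega_p$ (sum over multi-indices $L=(l_1,l_2)$ of nonnegative integers) with $$\|f\|^2_{\mathcal{D}_\beta(\Omega_p)}=\sum_L|a_L|^2\,2^{-\beta}\,\frac{\Gamma\left(\frac{l_1}{p}+1\right)\Gamma\left(\frac{l_2}{p}+1\right)}{\Gamma\left(\frac{l_1+l_2}{p}+2\right)}\,(l_1+l_2+2)^{\beta}<\infty .$$ (This is the Poletsky–Stessin weighted Bergman space $A^2_{u,\alpha}(\Omega_p)$ with exhaustion function $u(z)=\frac1{2p}\log(|z_1|^{2p}+|z_2|^{2p})$ and $\beta=-(\alpha+1)$.) A function $f\in\mathcal{D}_\beta(\Omega_p)$ is called cyclic if the closure in $\mathcal{D}_\beta(\Omega_p)$ of $\{hf:h\in\mathbb{C}[z_1,z_2]\}$ is all of $\mathcal{D}_\beta(\Omega_p)$.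
   Formalization: The formal theorem also assumes that q has at least one zero on ∂Ω_p; without this the claim fails, e.g. q = z_1 − 5 has no boundary zeros and is cyclic for every β, including β > 2. *)

theory Defs
  imports "HOL-Analysis.Analysis" "HOL-Computational_Algebra.Polynomial"
begin

text \<open>
  A polynomial in \<open>z\<^sub>1, z\<^sub>2\<close> is an element of \<open>complex poly poly\<close>, with inner
  variable \<open>z\<^sub>1\<close> and outer variable \<open>z\<^sub>2\<close>.
\<close>

definition eval2 :: "complex poly poly \<Rightarrow> complex \<times> complex \<Rightarrow> complex" where
  "eval2 q z = poly (poly q [:snd z:]) (fst z)"

definition ellipsoid :: "real \<Rightarrow> (complex \<times> complex) set" where
  "ellipsoid p = {z. cmod (fst z) powr (2 * p) + cmod (snd z) powr (2 * p) < 1}"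

definition holomorphic2_on :: "(complex \<times> complex \<Rightarrow> complex) \<Rightarrow> (complex \<times> complex) set \<Rightarrow> bool" where
  "holomorphic2_on f S \<longleftrightarrow>
     (\<forall>z\<in>S. \<exists>a b. (f has_derivative (\<lambda>h. a * fst h + b * snd h)) (at z))"

definition expands_on ::
    "(complex \<times> complex) set \<Rightarrow> (complex \<times> complex \<Rightarrow> complex) \<Rightarrow> (nat \<times> nat \<Rightarrow> complex) \<Rightarrow> bool" where
  "expands_on S f a \<longleftrightarrow>
     (\<forall>z\<in>S. ((\<lambda>L. a L * fst z ^ fst L * snd z ^ snd L) has_sum f z) UNIV)"

text \<open>The coefficients are unique on \<open>ellipsoid p\<close> for \<open>p \<ge> 1\<close>; see \<open>power_coeffs_eqI\<close> below.\<close>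

definition power_coeffs ::
    "(complex \<times> complex) set \<Rightarrow> (complex \<times> complex \<Rightarrow> complex) \<Rightarrow> nat \<times> nat \<Rightarrow> complex" where
  "power_coeffs S f = (THE a. expands_on S f a)"

definition D_weight :: "real \<Rightarrow> real \<Rightarrow> nat \<times> nat \<Rightarrow> real" where
  "D_weight p \<beta> L =
     2 powr (- \<beta>)
     * (Gamma (real (fst L) / p + 1) * Gamma (real (snd L) / p + 1)
        / Gamma (real (fst L + snd L) / p + 2))
     * real (fst L + snd L + 2) powr \<beta>"

text \<open>
  Elements of the space are represented by total functions, of which only the values on the
  ellipsoid matter. Accordingly \<open>D_norm\<close> is a seminorm on the representatives in
  \<open>D_space\<close>, vanishing exactly when the function vanishes on the ellipsoid.
\<close>

definition D_space :: "real \<Rightarrow> real \<Rightarrow> (complex \<times> complex \<Rightarrow> complex) set" where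
  "D_space p \<beta> =
     {f. holomorphic2_on f (ellipsoid p) \<and>
         (\<exists>a. expands_on (ellipsoid p) f a \<and>
              (\<lambda>L. (cmod (a L))\<^sup>2 * D_weight p \<beta> L) summable_on UNIV)}"

definition D_norm :: "real \<Rightarrow> real \<Rightarrow> (complex \<times> complex \<Rightarrow> complex) \<Rightarrow> real" where
  "D_norm p \<beta> f =
     sqrt (\<Sum>\<^sub>\<infinity>L. (cmod (power_coeffs (ellipsoid p) f L))\<^sup>2 * D_weight p \<beta> L)"

definition D_closure ::
    "real \<Rightarrow> real \<Rightarrow> (complex \<times> complex \<Rightarrow> complex) set \<Rightarrow> (complex \<times> complex \<Rightarrow> complex) set" where
  "D_closure p \<beta> S =
     {g \<in> D_space p \<beta>. \<forall>\<epsilon>>0. \<exists>s \<in> S \<inter> D_space p \<beta>. D_norm p \<beta> (\<lambda>z. g z - s z) < \<epsilon>}"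

definition cyclic :: "real \<Rightarrow> real \<Rightarrow> (complex \<times> complex \<Rightarrow> complex) \<Rightarrow> bool" where
  "cyclic p \<beta> f \<longleftrightarrow>
     f \<in> D_space p \<beta> \<and>
     D_closure p \<beta> (range (\<lambda>h. \<lambda>z. eval2 h z * f z)) = D_space p \<beta>"

lemma powser_zero_near_0:
  fixes c :: "nat \<Rightarrow> complex"
  assumes "r > 0" and sums: "\<And>x. cmod x < r \<Longrightarrow> (\<lambda>n. c n * x ^ n) sums 0"
  shows "c n = 0"
proof -
  have "summable (\<lambda>n. c n * complex_of_real (r / 2) ^ n)"
    using sums[of "complex_of_real (r / 2)"] \<open>r > 0\<close> by (auto simp: sums_iff)
  then have "conv_radius c \<ge> norm (complex_of_real (r / 2))"
    by (rule conv_radius_geI)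
  then have "conv_radius c > 0"
    using \<open>r > 0\<close> by (metis less_le_trans ereal_less(2) half_gt_zero norm_of_real abs_of_pos)
  then have 1: "fps_conv_radius (Abs_fps c) > 0"
    by (simp add: fps_conv_radius_def)
  have "eventually (\<lambda>x. x \<in> ball (0 :: complex) r) (nhds 0)"
    using \<open>r > 0\<close> by (intro eventually_nhds_in_open) auto
  then have 2: "eventually (\<lambda>x. eval_fps (Abs_fps c) x = eval_fps 0 x) (nhds 0)"
  proof eventually_elim
    case (elim x)
    then show ?case using sums[of x] by (simp add: eval_fps_def sums_iff)
  qed
  have "Abs_fps c = 0"
    by (rule eval_fps_eqD[OF 1 _ 2]) simp
  then show ?thesis by (metis fps_nth_Abs_fps fps_zero_nth)
qed

lemma bidisc_subset_ellipsoid: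
  assumes "p \<ge> 1" "cmod x < 1/2" "cmod y < 1/2"
  shows "(x, y) \<in> ellipsoid p"
proof -
  have *: "t powr (2 * p) < 1/2" if "0 \<le> t" "t < 1/2" for t :: real
  proof -
    have "t powr (2 * p) \<le> t powr 1"
      using that assms(1) by (intro powr_mono') auto
    then show ?thesis using that by simp
  qed
  show ?thesis using *[of "cmod x"] *[of "cmod y"] assms by (simp add: ellipsoid_def)
qed

lemma power_coeffs_eqI:
  assumes p: "p \<ge> 1" and a: "expands_on (ellipsoid p) f a"
  shows "power_coeffs (ellipsoid p) f = a"
  unfolding power_coeffs_def
proof (rule the_equality[where P = "expands_on (ellipsoid p) f", OF a])
  fix b assume b: "expands_on (ellipsoid p) f b"
  define c where "c L = b L - a L" for L
  have sum0: "((\<lambda>(k, l). c (k, l) * x ^ k * y ^ l) has_sum 0) UNIV"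
    if "cmod x < 1/2" "cmod y < 1/2" for x y
  proof -
    have "(x, y) \<in> ellipsoid p" using bidisc_subset_ellipsoid p that by blast
    then have "((\<lambda>L. a L * x ^ fst L * y ^ snd L) has_sum f (x, y)) UNIV"
      "((\<lambda>L. b L * x ^ fst L * y ^ snd L) has_sum f (x, y)) UNIV"
      using bspec[OF a[unfolded expands_on_def]] bspec[OF b[unfolded expands_on_def]]
      by fastforce+
    from has_sum_add[OF this(2) has_sum_uminusI[OF this(1)]]
    show ?thesis by (simp add: c_def algebra_simps case_prod_unfold)
  qed
  have inner: "(\<Sum>\<^sub>\<infinity>l. c (k, l) * y ^ l) = 0" and smm: "(\<lambda>l. c (k, l) * y ^ l) summable_on UNIV"
    if y: "cmod y < 1/2" for k y
  proof -
    have S: "((\<lambda>(k, l). c (k, l) * x ^ k * y ^ l) has_sum 0) (UNIV \<times> UNIV)"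
      if "cmod x < 1/2" for x
      using sum0[OF that y] by simp
    have slice: "(\<lambda>l. c (k, l) * x ^ k * y ^ l) summable_on UNIV" if "cmod x < 1/2" for x k
      using summable_on_SigmaD1[OF has_sum_imp_summable[OF S[OF that]], of k]
      by simp
    have four: "cmod (1/4 :: complex) < 1/2" by simp
    have sl: "(\<lambda>l. c (k, l) * y ^ l) summable_on UNIV" for k
    proof -
      have "(\<lambda>l. (4 ^ k) * (c (k, l) * (1/4) ^ k * y ^ l)) summable_on UNIV"
        by (intro summable_on_cmult_right slice[OF four])
      then show ?thesis by (simp add: power_divide mult_ac)
    qed
    then show "(\<lambda>l. c (k, l) * y ^ l) summable_on UNIV" .
    have "(\<lambda>k. (\<Sum>\<^sub>\<infinity>l. c (k, l) * y ^ l) * x ^ k) sums 0" if x: "cmod x < 1/2" for x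
    proof -
      have "((\<lambda>k. \<Sum>\<^sub>\<infinity>l. c (k, l) * x ^ k * y ^ l) has_sum 0) UNIV"
      proof (rule has_sum_SigmaD[OF S[OF x, unfolded case_prod_unfold], simplified])
        show "((\<lambda>l. c (k, l) * x ^ k * y ^ l) has_sum (\<Sum>\<^sub>\<infinity>l. c (k, l) * x ^ k * y ^ l)) UNIV" for k
          using slice[OF x] by simp
      qed
      moreover have "(\<Sum>\<^sub>\<infinity>l. c (k, l) * x ^ k * y ^ l) = (\<Sum>\<^sub>\<infinity>l. c (k, l) * y ^ l) * x ^ k" for k
        by (subst infsum_cmult_left[symmetric]) (use sl in \<open>auto simp: mult_ac\<close>)
      ultimately show ?thesis by (simp add: has_sum_imp_sums)
    qed
    then show "(\<Sum>\<^sub>\<infinity>l. c (k, l) * y ^ l) = 0"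
      by (intro powser_zero_near_0[of "1/2"]) auto
  qed
  have "c (k, l) = 0" for k l
  proof (rule powser_zero_near_0[of "1/2" "\<lambda>l. c (k, l)"])
    show "(\<lambda>l. c (k, l) * y ^ l) sums 0" if "cmod y < 1/2" for y
      using inner[OF that] smm[OF that] has_sum_imp_sums by (metis has_sum_infsum)
  qed simp
  then show "b = a" by (auto simp: c_def)
qed

end

theory Submission
  imports Defs "HOL-Complex_Analysis.Complex_Analysis"
    "HOL-Computational_Algebra.Fundamental_Theorem_Algebra"
    "HOL-Computational_Algebra.Polynomial_Factorial"
    "HOL-Computational_Algebra.Field_as_Ring"
begin

text \<open>
  Write \<open>w\<^sub>L\<close> for the weight \<open>D_weight p \<beta> L\<close> of the monomial \<open>z\<^sup>L\<close>. Evaluation of polynomials at a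
  point \<open>v\<close> is bounded for the norm when \<open>\<Sum>\<^sub>L \<bar>v\<^sup>L\<bar>\<^sup>2 / w\<^sub>L\<close> converges. For \<open>v\<close> on the frontier the
  Beta factors in the weights are reciprocal binomial coefficients up to a linear factor, and
  grouping the indices \<open>L\<close> into blocks turns the series into binomial expansions of powers of
  \<open>\<bar>v\<^sub>1\<bar>\<^bsup>2p\<^esup> + \<bar>v\<^sub>2\<bar>\<^bsup>2p\<^esup> = 1\<close>; what remains is comparable to \<open>\<Sum>\<^sub>s s\<^bsup>1 - \<beta>\<^esup>\<close>. This is why the critical
  exponent is \<open>2\<close>.

  If \<open>\<beta> > 2\<close>, evaluation at a zero of \<open>q\<close> on the frontier is bounded
  (\<open>boundary_point_evaluation_bounded\<close>) and vanishes on all multiples of \<open>q\<close>, so \<open>1\<close> is not a limit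
  of multiples of \<open>q\<close> (\<open>not_cyclic_if_gt_2\<close>).

  If \<open>\<beta> \<le> 2\<close>, then, the weights being increasing in \<open>\<beta>\<close>, it is enough to approximate polynomials
  when \<open>\<beta> = 2\<close>. Should this fail, a sequence minimising the distance to the multiples of \<open>q\<close> produces
  a nonzero double sequence \<open>b\<close> with \<open>\<Sum>\<^sub>L \<bar>b\<^sub>L\<bar>\<^sup>2 / w\<^sub>L < \<infinity>\<close> that is annihilated by \<open>q(S\<^sub>1, S\<^sub>2)\<close>, where
  \<open>S\<^sub>1\<close> and \<open>S\<^sub>2\<close> are the two index shifts (\<open>orthogonal_functional\<close>). It remains to see that \<open>b = 0\<close>
  (\<open>dual_space_trivial\<close>). Suppose that some polynomial \<open>T \<noteq> 0\<close> satisfies \<open>T(S\<^sub>1) b = 0\<close> for all such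
  \<open>b\<close>. Splitting \<open>T\<close> into linear factors yields a nonzero eigensequence of \<open>S\<^sub>1\<close>, on which \<open>q\<close> acts as
  a nonzero polynomial in \<open>S\<^sub>2\<close>; splitting that one yields a joint eigensequence \<open>x\<^sup>i y\<^sup>j\<close> with
  \<open>q(x, y) = 0\<close>. So \<open>(x, y)\<close> is outside the domain, and the divergence of the series above at
  \<open>\<beta> = 2\<close> contradicts the summability (\<open>point_evaluation_unbounded\<close>).

  The polynomial \<open>T\<close> comes from a Liouville argument (\<open>recurrence_in_first_index\<close>). Read \<open>b\<close> as a
  linear functional \<open>\<phi>\<close> on polynomials with \<open>\<phi>(z\<^sup>L) = b\<^sub>L\<close>, and consider its Cauchy transform
  \<open>\<phi>(1 / (z\<^sub>1 - x))\<close>, which is defined for \<open>\<bar>x\<bar> > 1\<close>. Since \<open>\<phi>\<close> lives on the zero set of \<open>q\<close>, the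
  transform can be computed from that zero set: at a zero \<open>v = (x, y)\<close> outside the closed ellipsoid
  take a linear form \<open>c\<close> with \<open>\<langle>c, v\<rangle> = 1\<close> that is small on the ellipsoid, and apply \<open>\<phi>\<close> to
  \<open>1 / (1 - \<langle>c, z\<rangle>)\<close> times a combination of divided differences of \<open>q\<close>. The result does not depend
  on \<open>c\<close> (\<open>branch_val_eqI\<close>), hence is holomorphic in \<open>x\<close> along a branch of the zero set
  (\<open>branch_val_holomorphic\<close>), and its sum over the roots \<open>y\<close> of \<open>q(x, \<cdot>)\<close> with weights \<open>1 / \<partial>\<^sub>y q\<close> is the
  Cauchy transform, by Lagrange interpolation (\<open>resolvent_outside\<close>). As \<open>q\<close> is irreducible and has
  finitely many zeros on the frontier, this continues the Cauchy transform to the complement of the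
  zeros of some polynomial \<open>\<Theta>\<close>.

  For Liouville the continuation must grow at most polynomially at the zeros of \<open>\<Theta>\<close>. The optimal
  \<open>c\<close> bounds the branch values by the inverse cube of the gap \<open>\<bar>x\<bar>\<^bsup>2p\<^esup> + \<bar>y\<bar>\<^bsup>2p\<^esup> - 1\<close>
  (\<open>branch_val_bound\<close>), for which no lower bound is at hand. But along a branch the gap is nonnegative
  and strictly subharmonic. On a small square, suitably rotated, it is strongly convex along each of
  the four sides, so it dominates the squared distance to one point per side; the maximum principle,
  with a multiplier vanishing at these four points, bounds the branch value at the centre
  (\<open>holomorphic_bound_off_level_set\<close>). All radii and constants are polynomial in \<open>1 / \<bar>\<Theta>(x)\<bar>\<close>. So a
  power of \<open>\<Theta>\<close> times the Cauchy transform is, up to a polynomial, an entire function tending to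
  \<open>0\<close> at infinity, and that power of \<open>\<Theta>\<close> is \<open>T\<close>.
\<close>

section \<open>The closed ellipsoid and its monomials\<close>

definition egauge :: "real \<Rightarrow> complex \<times> complex \<Rightarrow> real" where
  "egauge p z = cmod (fst z) powr (2 * p) + cmod (snd z) powr (2 * p)"

definition monom_sup :: "real \<Rightarrow> nat \<Rightarrow> nat \<Rightarrow> real" where
  "monom_sup p i j = (SUP z\<in>{z. egauge p z \<le> 1}. cmod (fst z) ^ i * cmod (snd z) ^ j)"

text \<open>
  A bound for the linear form \<open>\<langle>c, z\<rangle>\<close> on the closed ellipsoid. The ellipsoid is invariant under
  rotation of either coordinate, so the supremum of \<open>\<bar>\<langle>c, z\<rangle>\<bar>\<close> is attained without cancellation.
\<close>

definition dual_le :: "real \<Rightarrow> complex \<times> complex \<Rightarrow> real \<Rightarrow> bool" where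
  "dual_le p c t \<longleftrightarrow>
     (\<forall>z. egauge p z \<le> 1 \<longrightarrow> cmod (fst c) * cmod (fst z) + cmod (snd c) * cmod (snd z) \<le> t)"

lemma egauge_zero [simp]: "egauge p (0, 0) = 0"
  by (simp add: egauge_def)

lemma egauge_le_1_coords:
  assumes "p \<ge> 1" "egauge p z \<le> 1"
  shows "cmod (fst z) \<le> 1" "cmod (snd z) \<le> 1"
proof -
  have *: "t \<le> 1" if "t powr (2 * p) \<le> 1" "t \<ge> 0" for t :: real
  proof (rule ccontr)
    assume "\<not> t \<le> 1"
    then have "t powr (2 * p) > 1"
      using assms(1) by (intro gr_one_powr) auto
    then show False using that by simp
  qed
  have "cmod (fst z) powr (2 * p) \<le> 1" "cmod (snd z) powr (2 * p) \<le> 1"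
    using assms(2) powr_ge_zero[of "cmod (fst z)" "2*p"] powr_ge_zero[of "cmod (snd z)" "2*p"]
    unfolding egauge_def by linarith+
  then show "cmod (fst z) \<le> 1" "cmod (snd z) \<le> 1" using * by auto
qed

lemma monomial_le_1:
  assumes "p \<ge> 1" "egauge p z \<le> 1"
  shows "cmod (fst z) ^ i * cmod (snd z) ^ j \<le> 1"
  using egauge_le_1_coords[OF assms] by (intro mult_le_one power_le_one) auto

lemma monom_sup_upper:
  assumes "p \<ge> 1" "egauge p z \<le> 1"
  shows "cmod (fst z) ^ i * cmod (snd z) ^ j \<le> monom_sup p i j"
  unfolding monom_sup_def
proof (rule cSUP_upper)
  show "bdd_above ((\<lambda>z. cmod (fst z) ^ i * cmod (snd z) ^ j) ` {z. egauge p z \<le> 1})"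
    using monomial_le_1[OF assms(1)] by (intro bdd_aboveI2[of _ _ 1]) blast
qed (use assms in auto)

lemma monom_sup_least:
  assumes "\<And>z. egauge p z \<le> 1 \<Longrightarrow> cmod (fst z) ^ i * cmod (snd z) ^ j \<le> B"
  shows "monom_sup p i j \<le> B"
  unfolding monom_sup_def
proof (rule cSUP_least)
  have "(0, 0) \<in> {z. egauge p z \<le> 1}" by simp
  then show "{z. egauge p z \<le> 1} \<noteq> {}" by blast
qed (use assms in auto)

lemma monom_sup_nonneg: "p \<ge> 1 \<Longrightarrow> 0 \<le> monom_sup p i j"
  using monom_sup_upper[of p "(0, 0)" i j] by (simp add: order_trans[rotated])

lemma monom_sup_mult:
  assumes "p \<ge> 1"
  shows "monom_sup p (i + k) (j + l) \<le> monom_sup p i j * monom_sup p k l"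
proof (rule monom_sup_least)
  fix z assume z: "egauge p z \<le> 1"
  have "cmod (fst z) ^ (i + k) * cmod (snd z) ^ (j + l)
      = (cmod (fst z) ^ i * cmod (snd z) ^ j) * (cmod (fst z) ^ k * cmod (snd z) ^ l)"
    by (simp add: power_add algebra_simps)
  also have "\<dots> \<le> monom_sup p i j * monom_sup p k l"
    by (intro mult_mono monom_sup_upper monom_sup_nonneg assms z) auto
  finally show "cmod (fst z) ^ (i + k) * cmod (snd z) ^ (j + l) \<le> monom_sup p i j * monom_sup p k l" .
qed

lemma monom_sup_le_1:
  assumes "p \<ge> 1" shows "monom_sup p i j \<le> 1"
  by (rule monom_sup_least) (rule monomial_le_1[OF assms])

lemma dual_le_nonneg: "dual_le p c t \<Longrightarrow> 0 \<le> t"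
  unfolding dual_le_def by (drule spec[of _ "(0,0)"]) simp

text \<open>
  The left-hand side is one term in the binomial expansion of
  \<open>(\<bar>c\<^sub>1 z\<^sub>1\<bar> + \<bar>c\<^sub>2 z\<^sub>2\<bar>)\<^bsup>i + j\<^esup>\<close>.
\<close>

lemma binomial_monom_sup_le:
  assumes "p \<ge> 1" "dual_le p c t"
  shows "real ((i + j) choose i) * cmod (fst c) ^ i * cmod (snd c) ^ j * monom_sup p i j \<le> t ^ (i + j)"
proof -
  define a where "a = real ((i + j) choose i) * cmod (fst c) ^ i * cmod (snd c) ^ j"
  have a0: "0 \<le> a" by (simp add: a_def)
  have le: "a * (cmod (fst z) ^ i * cmod (snd z) ^ j) \<le> t ^ (i + j)" if z: "egauge p z \<le> 1" for z
  proof -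
    define x y where "x = cmod (fst c) * cmod (fst z)" and "y = cmod (snd c) * cmod (snd z)"
    have xy: "0 \<le> x" "0 \<le> y" by (simp_all add: x_def y_def)
    have "a * (cmod (fst z) ^ i * cmod (snd z) ^ j) = real ((i + j) choose i) * x ^ i * y ^ (i + j - i)"
      by (simp add: a_def x_def y_def power_mult_distrib)
    also have "\<dots> \<le> (\<Sum>k\<le>i + j. real ((i + j) choose k) * x ^ k * y ^ (i + j - k))"
      by (rule member_le_sum) (auto simp: xy)
    also have "\<dots> = (x + y) ^ (i + j)" by (simp add: binomial_ring)
    also have "\<dots> \<le> t ^ (i + j)"
      using assms(2) z xy by (intro power_mono) (auto simp: dual_le_def x_def y_def)
    finally show ?thesis .
  qed
  show ?thesis
  proof (cases "a = 0")
    case True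
    then show ?thesis using dual_le_nonneg[OF assms(2)] unfolding a_def[symmetric] by simp
  next
    case False
    then have "a > 0" using a0 by simp
    have "monom_sup p i j \<le> t ^ (i + j) / a"
      using le \<open>a > 0\<close> by (intro monom_sup_least) (simp add: field_simps)
    then show ?thesis using \<open>a > 0\<close> unfolding a_def[symmetric] by (simp add: field_simps)
  qed
qed

section \<open>Functionals of controlled growth and their Fantappie transform\<close>

type_synonym double_seq = "nat \<Rightarrow> nat \<Rightarrow> complex"

text \<open>
  The linear factor is what square summability against the weights of exponent \<open>2\<close> leaves for
  single entries.
\<close>

definition growth :: "real \<Rightarrow> real \<Rightarrow> double_seq \<Rightarrow> bool" where
  "growth p C b \<longleftrightarrow> (\<forall>i j. cmod (b i j) \<le> C * (i + j + 2) * monom_sup p i j)"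

text \<open>
  The power \<open>(c\<^sub>1 S\<^sub>1 + c\<^sub>2 S\<^sub>2)\<^sup>n\<close> of a combination of the two index shifts, applied to \<open>b\<close>.
\<close>

definition lin_pow :: "complex \<times> complex \<Rightarrow> nat \<Rightarrow> double_seq \<Rightarrow> double_seq" where
  "lin_pow c n b i j =
     (\<Sum>k\<le>n. of_nat (n choose k) * fst c ^ k * snd c ^ (n - k) * b (i + k) (j + (n - k)))"

text \<open>
  For the functional \<open>\<phi>(z\<^sup>L) = b\<^sub>L\<close> this is \<open>\<phi>(z\<^sub>1\<^sup>i z\<^sub>2\<^sup>j / (1 - \<langle>c, z\<rangle>))\<close>, expanded in a geometric
  series.
\<close>

definition fantappie :: "complex \<times> complex \<Rightarrow> double_seq \<Rightarrow> double_seq" where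
  "fantappie c b i j = (\<Sum>n. lin_pow c n b i j)"

lemma lin_pow_0 [simp]: "lin_pow c 0 b i j = b i j"
  by (simp add: lin_pow_def)

lemma lin_pow_Suc:
  "lin_pow c (Suc n) b i j = fst c * lin_pow c n b (Suc i) j + snd c * lin_pow c n b i (Suc j)"
proof -
  let ?g = "\<lambda>k. fst c ^ k * snd c ^ (Suc n - k) * b (i + k) (j + (Suc n - k))"
  have "lin_pow c (Suc n) b i j = (\<Sum>k\<le>Suc n. of_nat (Suc n choose k) * ?g k)"
    by (simp add: lin_pow_def mult.assoc del: binomial_Suc_Suc sum.atMost_Suc)
  also have "\<dots> = ?g 0 + (\<Sum>k\<le>n. of_nat (Suc n choose Suc k) * ?g (Suc k))"
    by (subst sum.atMost_Suc_shift) simp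
  also have "(\<Sum>k\<le>n. of_nat (Suc n choose Suc k) * ?g (Suc k))
      = (\<Sum>k\<le>n. of_nat (n choose k) * ?g (Suc k)) + (\<Sum>k\<le>n. of_nat (n choose Suc k) * ?g (Suc k))"
    by (simp add: sum.distrib algebra_simps)
  also have "(\<Sum>k\<le>n. of_nat (n choose k) * ?g (Suc k)) = fst c * lin_pow c n b (Suc i) j"
    by (simp add: lin_pow_def sum_distrib_left mult_ac)
  also have "?g 0 + (fst c * lin_pow c n b (Suc i) j + (\<Sum>k\<le>n. of_nat (n choose Suc k) * ?g (Suc k)))
     = fst c * lin_pow c n b (Suc i) j + (\<Sum>k\<le>Suc n. of_nat (n choose k) * ?g k)"
    by (simp add: sum.atMost_Suc_shift[of _ n] del: sum.atMost_Suc)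
  also have "(\<Sum>k\<le>Suc n. of_nat (n choose k) * ?g k) = (\<Sum>k\<le>n. of_nat (n choose k) * ?g k)"
    by simp
  also have "\<dots> = snd c * lin_pow c n b i (Suc j)"
    unfolding lin_pow_def sum_distrib_left
    by (intro sum.cong refl) (auto simp: Suc_diff_le mult_ac)
  finally show ?thesis .
qed

text \<open>
  Submultiplicativity of the monomial norms separates the index \<open>(i, j)\<close> from the expansion, whose
  \<open>n + 1\<close> terms are at most \<open>t\<^sup>n\<close> each; the linear factor in \<open>growth\<close> costs another \<open>n + 1\<close>.
\<close>

lemma lin_pow_bound:
  assumes p: "p \<ge> 1" and c: "dual_le p c t" and b: "growth p C b" and C: "C \<ge> 0"
  shows "cmod (lin_pow c n b i j) \<le> (C * (i + j + 2) * monom_sup p i j) * (real (n + 1)^2 * t ^ n)"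
proof -
  have "cmod (lin_pow c n b i j)
     \<le> (\<Sum>k\<le>n. real (n choose k) * cmod (fst c) ^ k * cmod (snd c) ^ (n - k)
              * (C * (n + i + j + 2) * (monom_sup p i j * monom_sup p k (n - k))))"
    unfolding lin_pow_def
  proof (rule sum_norm_le)
    fix k assume k: "k \<in> {..n}"
    have "cmod (b (i + k) (j + (n - k))) \<le> C * (n + i + j + 2) * monom_sup p (i + k) (j + (n - k))"
      using b[unfolded growth_def, rule_format, of "i + k" "j + (n - k)"] k by (simp add: algebra_simps)
    also have "\<dots> \<le> C * (n + i + j + 2) * (monom_sup p i j * monom_sup p k (n - k))"
      using C by (intro mult_left_mono monom_sup_mult p) auto
    finally show "cmod (of_nat (n choose k) * fst c ^ k * snd c ^ (n - k) * b (i + k) (j + (n - k)))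
       \<le> real (n choose k) * cmod (fst c) ^ k * cmod (snd c) ^ (n - k)
              * (C * (n + i + j + 2) * (monom_sup p i j * monom_sup p k (n - k)))"
      by (simp add: norm_mult norm_power mult_left_mono)
  qed
  also have "\<dots> = (C * (n + i + j + 2) * monom_sup p i j) *
     (\<Sum>k\<le>n. real (n choose k) * cmod (fst c) ^ k * cmod (snd c) ^ (n - k) * monom_sup p k (n - k))"
    by (simp add: sum_distrib_left mult_ac)
  also have "\<dots> \<le> (C * (n + i + j + 2) * monom_sup p i j) * (\<Sum>k\<le>n. t ^ n)"
  proof (intro mult_left_mono sum_mono)
    fix k assume "k \<in> {..n}"
    then show "real (n choose k) * cmod (fst c) ^ k * cmod (snd c) ^ (n - k) * monom_sup p k (n - k) \<le> t ^ n"
      using binomial_monom_sup_le[OF p c, of k "n - k"] by simp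
  qed (use C monom_sup_nonneg[OF p] in auto)
  also have "\<dots> = (C * monom_sup p i j) * ((n + i + j + 2) * (real (n + 1) * t ^ n))"
    by (simp add: mult_ac)
  also have "\<dots> \<le> (C * monom_sup p i j) * ((real (n + 1) * (i + j + 2)) * (real (n + 1) * t ^ n))"
  proof (intro mult_left_mono mult_right_mono)
    have "n + i + j + 2 \<le> (n + 1) * (i + j + 2)" by (simp add: algebra_simps)
    then show "real (n + i + j + 2) \<le> real (n + 1) * real (i + j + 2)"
      by (metis of_nat_le_iff of_nat_mult)
  qed (use C monom_sup_nonneg[OF p] dual_le_nonneg[OF c] in auto)
  finally show ?thesis by (simp add: power2_eq_square mult_ac)
qed

lemma sums_triangular:
  fixes t :: real assumes "0 \<le> t" "t < 1"
  shows "(\<lambda>n. real (n + 1) * real (n + 2) * t ^ n) sums (2 / (1 - t) ^ 3)"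
proof -
  have s1: "(\<lambda>n. real (Suc n) * t ^ n) sums (1 / (1 - t)^2)"
    using geometric_deriv_sums[of t] assms by simp
  have s2: "(\<lambda>n. t ^ n) sums (1 / (1 - t))" using geometric_sums[of t] assms by simp
  \<comment> \<open>The Cauchy product of \<open>1 / (1 - t)\<^sup>2\<close> and \<open>1 / (1 - t)\<close>.\<close>
  have "(\<lambda>k. \<Sum>i\<le>k. (real (Suc i) * t ^ i) * t ^ (k - i)) sums
      ((\<Sum>k. real (Suc k) * t ^ k) * (\<Sum>k. t ^ k))"
    using s1 s2 assms by (intro Cauchy_product_sums) (auto simp: sums_iff)
  moreover have "(\<Sum>i\<le>k. (real (Suc i) * t ^ i) * t ^ (k - i)) = real (k + 1) * real (k + 2) * t ^ k / 2" for k
  proof -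
    have "(\<Sum>i\<le>k. (real (Suc i) * t ^ i) * t ^ (k - i)) = (\<Sum>i\<le>k. real (Suc i) * t ^ k)"
      by (intro sum.cong refl) (simp add: power_add[symmetric])
    also have "\<dots> = (\<Sum>i\<le>k. real (Suc i)) * t ^ k" by (simp add: sum_distrib_right)
    also have "(\<Sum>i\<le>k. real (Suc i)) = real (k + 1) * real (k + 2) / 2"
      by (induction k) (auto simp: field_simps)
    finally show ?thesis by simp
  qed
  ultimately have "(\<lambda>k. real (k + 1) * real (k + 2) * t ^ k / 2) sums (1 / (1 - t)^2 * (1 / (1 - t)))"
    by (simp only: sums_unique[OF s1, symmetric] sums_unique[OF s2, symmetric])
  from sums_mult[OF this, of 2] show ?thesis
    by (simp add: power2_eq_square power3_eq_cube mult_ac)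
qed

lemma summable_sq_geometric:
  fixes t :: real assumes "0 \<le> t" "t < 1"
  shows "summable (\<lambda>n. real (n + 1)^2 * t ^ n)" "(\<Sum>n. real (n + 1)^2 * t ^ n) \<le> 2 / (1 - t) ^ 3"
proof -
  note s = sums_triangular[OF assms]
  have le: "real (n + 1)^2 * t ^ n \<le> real (n + 1) * real (n + 2) * t ^ n" for n
    using assms by (intro mult_right_mono) (auto simp: power2_eq_square intro!: mult_left_mono)
  show sm: "summable (\<lambda>n. real (n + 1)^2 * t ^ n)"
    by (rule summable_comparison_test'[OF sums_summable[OF s], of 0]) (use le assms in auto)
  show "(\<Sum>n. real (n + 1)^2 * t ^ n) \<le> 2 / (1 - t) ^ 3"
    using suminf_le[OF le sm sums_summable[OF s]] s by (simp add: sums_iff)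
qed

context
  fixes p t C :: real and c :: "complex \<times> complex" and b :: double_seq
  assumes p: "p \<ge> 1" and c: "dual_le p c t" and t: "t < 1" and b: "growth p C b" and C: "C \<ge> 0"
begin

lemma lin_pow_summable: "summable (\<lambda>n. lin_pow c n b i j)"
  by (rule summable_comparison_test'[OF
        summable_mult[OF summable_sq_geometric(1)[OF dual_le_nonneg[OF c] t],
          of "C * (i + j + 2) * monom_sup p i j"], of 0])
     (use lin_pow_bound[OF p c b C] in simp)

lemma fantappie_growth: "growth p (2 * C / (1 - t) ^ 3) (fantappie c b)"
  unfolding growth_def
proof (intro allI)
  fix i j
  let ?K = "C * (i + j + 2) * monom_sup p i j"
  note s = summable_sq_geometric[OF dual_le_nonneg[OF c] t]
  have K: "?K \<ge> 0" using C monom_sup_nonneg[OF p] by simp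
  have "cmod (fantappie c b i j) \<le> (\<Sum>n. ?K * (real (n + 1)^2 * t ^ n))"
    unfolding fantappie_def
  proof (rule norm_suminf_le)
    show "cmod (lin_pow c n b i j) \<le> ?K * (real (n + 1)^2 * t ^ n)" for n
      using lin_pow_bound[OF p c b C, of n i j] by (simp only: of_nat_add of_nat_numeral)
  qed (rule summable_mult[OF s(1)])
  also have "\<dots> = ?K * (\<Sum>n. real (n + 1)^2 * t ^ n)" by (rule suminf_mult[OF s(1)])
  also have "\<dots> \<le> ?K * (2 / (1 - t) ^ 3)" by (rule mult_left_mono[OF s(2) K])
  finally show "cmod (fantappie c b i j) \<le> 2 * C / (1 - t) ^ 3 * real (i + j + 2) * monom_sup p i j"
    by (simp add: algebra_simps add_divide_distrib)
qed

lemma fantappie_eq: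
  "fantappie c b i j = b i j + (fst c * fantappie c b (Suc i) j + snd c * fantappie c b i (Suc j))"
proof -
  have "fantappie c b i j = lin_pow c 0 b i j + (\<Sum>n. lin_pow c (Suc n) b i j)"
    unfolding fantappie_def using suminf_split_head[OF lin_pow_summable[of i j]] by simp
  also have "(\<Sum>n. lin_pow c (Suc n) b i j) = fst c * fantappie c b (Suc i) j + snd c * fantappie c b i (Suc j)"
    unfolding lin_pow_Suc fantappie_def
    using lin_pow_summable[of "Suc i" j] lin_pow_summable[of i "Suc j"]
    by (simp add: suminf_add[symmetric] suminf_mult summable_mult)
  finally show ?thesis by simp
qed

lemma fantappie_annihilated:
  assumes "finite I" and "\<And>i j. (\<Sum>L\<in>I. g L * b (i + fst L) (j + snd L)) = 0"
  shows "(\<Sum>L\<in>I. g L * fantappie c b (i + fst L) (j + snd L)) = 0"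
proof -
  have z: "(\<Sum>L\<in>I. g L * lin_pow c n b (i + fst L) (j + snd L)) = 0" for n
  proof -
    have "(\<Sum>L\<in>I. g L * lin_pow c n b (i + fst L) (j + snd L)) =
       (\<Sum>k\<le>n. of_nat (n choose k) * fst c ^ k * snd c ^ (n - k) *
          (\<Sum>L\<in>I. g L * b ((i + k) + fst L) ((j + (n - k)) + snd L)))"
      unfolding lin_pow_def sum_distrib_left
      by (subst sum.swap) (intro sum.cong refl, simp add: algebra_simps)
    also have "\<dots> = 0" unfolding assms(2) by simp
    finally show ?thesis .
  qed
  have "(\<Sum>L\<in>I. g L * fantappie c b (i + fst L) (j + snd L))
      = (\<Sum>n. \<Sum>L\<in>I. g L * lin_pow c n b (i + fst L) (j + snd L))"
    unfolding fantappie_def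
    by (subst suminf_sum) (auto intro!: sum.cong summable_mult suminf_mult[symmetric] lin_pow_summable)
  then show ?thesis by (simp add: z)
qed

end

text \<open>
  On a joint eigensequence \<open>c\<^sub>1 S\<^sub>1 + c\<^sub>2 S\<^sub>2\<close> is multiplication by \<open>c\<^sub>1 x + c\<^sub>2 y = 1\<close>, so its powers
  are constant, while the geometric bound makes them tend to zero.
\<close>

lemma joint_eigensequence_zero:
  assumes p: "p \<ge> 1" and c: "dual_le p c t" and t: "t < 1" and d: "growth p C d" and C: "C \<ge> 0"
    and e1: "\<And>i j. d (Suc i) j = x * d i j" and e2: "\<And>i j. d i (Suc j) = y * d i j"
    and cv: "fst c * x + snd c * y = 1"
  shows "d 0 0 = 0"
proof -
  have eq: "lin_pow c n d i j = d i j" for n i j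
  proof (induction n arbitrary: i j)
    case (Suc n)
    have "lin_pow c (Suc n) d i j = (fst c * x + snd c * y) * d i j"
      unfolding lin_pow_Suc Suc.IH e1 e2 by (simp add: algebra_simps)
    then show ?case using cv by simp
  qed simp
  have "(\<lambda>n. lin_pow c n d 0 0) \<longlonglongrightarrow> 0"
    by (rule summable_LIMSEQ_zero[OF lin_pow_summable[OF p c t d C]])
  then show ?thesis by (simp add: eq LIMSEQ_const_iff)
qed

section \<open>The shift equations at a zero outside the closed ellipsoid\<close>

text \<open>
  The coefficients \<open>g\<close> over \<open>I\<close> encode a polynomial \<open>q\<close>. Here \<open>divdiff1\<close> is the divided difference
  \<open>Q(z) = (q(z) - q(x, z\<^sub>2)) / (z\<^sub>1 - x)\<close> and \<open>divdiff2\<close> is \<open>P(z) = (q(x, z\<^sub>2) - q(x, y)) / (z\<^sub>2 - y)\<close> at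
  \<open>v = (x, y)\<close>, both with the index shifts in place of the variables.
\<close>

definition divdiff1 :: "(nat \<times> nat \<Rightarrow> complex) \<Rightarrow> (nat \<times> nat) set \<Rightarrow> complex \<Rightarrow> double_seq \<Rightarrow> double_seq" where
  "divdiff1 g I x F k l =
     (\<Sum>L\<in>I. g L * (\<Sum>a<fst L. x ^ (fst L - Suc a) * F (k + a) (l + snd L)))"

definition divdiff2 :: "(nat \<times> nat \<Rightarrow> complex) \<Rightarrow> (nat \<times> nat) set \<Rightarrow> complex \<times> complex \<Rightarrow> double_seq \<Rightarrow> double_seq" where
  "divdiff2 g I v F k l =
     (\<Sum>L\<in>I. g L * fst v ^ fst L * (\<Sum>a<snd L. snd v ^ (snd L - Suc a) * F k (l + a)))"

lemma telescope_power:
  fixes f :: "nat \<Rightarrow> complex"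
  shows "(\<Sum>a<n. x ^ (n - Suc a) * f (Suc a)) - x * (\<Sum>a<n. x ^ (n - Suc a) * f a) = f n - x ^ n * f 0"
proof (induction n)
  case (Suc n)
  have 1: "(\<Sum>a<Suc n. x ^ (Suc n - Suc a) * h a) = x * (\<Sum>a<n. x ^ (n - Suc a) * h a) + h n" for h :: "nat \<Rightarrow> complex"
  proof -
    have "(\<Sum>a<n. x ^ (n - a) * h a) = (\<Sum>a<n. x * (x ^ (n - Suc a) * h a))"
      by (intro sum.cong refl) (auto simp: Suc_diff_Suc[symmetric] simp del: Suc_diff_Suc)
    then show ?thesis by (simp add: sum_distrib_left)
  qed
  have "(\<Sum>a<Suc n. x ^ (Suc n - Suc a) * f (Suc a)) - x * (\<Sum>a<Suc n. x ^ (Suc n - Suc a) * f a)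
     = x * ((\<Sum>a<n. x ^ (n - Suc a) * f (Suc a)) - x * (\<Sum>a<n. x ^ (n - Suc a) * f a)) + f (Suc n) - x * f n"
    unfolding 1[of "\<lambda>a. f (Suc a)"] 1[of f] by (simp add: algebra_simps)
  also have "\<dots> = f (Suc n) - x ^ Suc n * f 0" unfolding Suc.IH by (simp add: algebra_simps)
  finally show ?case .
qed simp

lemma divdiff1_eq:
  "divdiff1 g I x F (Suc k) l - x * divdiff1 g I x F k l
     = (\<Sum>L\<in>I. g L * (F (k + fst L) (l + snd L) - x ^ fst L * F k (l + snd L)))"
proof -
  have "divdiff1 g I x F (Suc k) l - x * divdiff1 g I x F k l
     = (\<Sum>L\<in>I. g L * ((\<Sum>a<fst L. x ^ (fst L - Suc a) * F (k + Suc a) (l + snd L))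
          - x * (\<Sum>a<fst L. x ^ (fst L - Suc a) * F (k + a) (l + snd L))))"
    unfolding divdiff1_def sum_distrib_left[of x _ I] sum_subtractf[symmetric]
    by (intro sum.cong refl) (simp add: right_diff_distrib mult.left_commute)
  also have "\<dots> = (\<Sum>L\<in>I. g L * (F (k + fst L) (l + snd L) - x ^ fst L * F k (l + snd L)))"
    by (intro sum.cong refl arg_cong2[where f = "(*)"])
       (rule telescope_power[of x _ "\<lambda>a. F (k + a) (l + snd _)", simplified add_0_right])
  finally show ?thesis .
qed

lemma divdiff2_eq:
  "divdiff2 g I v F k (Suc l) - snd v * divdiff2 g I v F k l
     = (\<Sum>L\<in>I. g L * fst v ^ fst L * (F k (l + snd L) - snd v ^ snd L * F k l))"
proof -
  have "divdiff2 g I v F k (Suc l) - snd v * divdiff2 g I v F k l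
     = (\<Sum>L\<in>I. g L * fst v ^ fst L * ((\<Sum>a<snd L. snd v ^ (snd L - Suc a) * F k (l + Suc a))
          - snd v * (\<Sum>a<snd L. snd v ^ (snd L - Suc a) * F k (l + a))))"
    unfolding divdiff2_def sum_distrib_left[of "snd v" _ I] sum_subtractf[symmetric]
    by (intro sum.cong refl) (simp add: right_diff_distrib mult_ac)
  also have "\<dots> = (\<Sum>L\<in>I. g L * fst v ^ fst L * (F k (l + snd L) - snd v ^ snd L * F k l))"
    by (intro sum.cong refl arg_cong2[where f = "(*)"])
       (rule telescope_power[of "snd v" _ "\<lambda>a. F k (l + a)", simplified add_0_right])
  finally show ?thesis .
qed

text \<open>
  To be used with \<open>F\<close> the Fantappie transform of an annihilated sequence \<open>b\<close> for a form \<open>c\<close> with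
  \<open>\<langle>c, v\<rangle> = 1\<close>.
\<close>

definition branch_sol :: "(nat \<times> nat \<Rightarrow> complex) \<Rightarrow> (nat \<times> nat) set \<Rightarrow> complex \<times> complex \<Rightarrow>
    complex \<times> complex \<Rightarrow> double_seq \<Rightarrow> double_seq" where
  "branch_sol g I c v F k l = snd c * divdiff1 g I (fst v) F k l - fst c * divdiff2 g I v F k l"

lemma divdiff_add:
  assumes "\<And>k l. F k l = G k l + (a * F (Suc k) l + b * F k (Suc l))"
  shows "divdiff1 g I x F k l = divdiff1 g I x G k l + (a * divdiff1 g I x F (Suc k) l + b * divdiff1 g I x F k (Suc l))"
    and "divdiff2 g I v F k l = divdiff2 g I v G k l + (a * divdiff2 g I v F (Suc k) l + b * divdiff2 g I v F k (Suc l))"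
  unfolding divdiff1_def divdiff2_def
  by (subst assms, simp add: sum_distrib_left sum.distrib algebra_simps)+

text \<open>
  At a zero \<open>v = (x, y)\<close> of \<open>q\<close> one has \<open>q = (z\<^sub>1 - x) Q + (z\<^sub>2 - y) P\<close>. Since \<open>q F = 0\<close>, in
  \<open>(z\<^sub>1 - x) (c\<^sub>2 Q - c\<^sub>1 P) F\<close> the term \<open>(z\<^sub>1 - x) Q F\<close> may be replaced by \<open>- (z\<^sub>2 - y) P F\<close>, which leaves
  \<open>(\<langle>c, v\<rangle> - \<langle>c, z\<rangle>) P F = P b\<close>. The second equation is symmetric. The right-hand sides do not involve
  \<open>c\<close>.
\<close>

lemma branch_sol_eqs:
  assumes F: "\<And>k l. F k l = b k l + (fst c * F (Suc k) l + snd c * F k (Suc l))"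
    and ann: "\<And>k l. (\<Sum>L\<in>I. g L * F (k + fst L) (l + snd L)) = 0"
    and v: "(\<Sum>L\<in>I. g L * fst v ^ fst L * snd v ^ snd L) = 0"
    and cv: "fst c * fst v + snd c * snd v = 1"
  shows "branch_sol g I c v F (Suc k) l - fst v * branch_sol g I c v F k l = divdiff2 g I v b k l"
    and "branch_sol g I c v F k (Suc l) - snd v * branch_sol g I c v F k l = - divdiff1 g I (fst v) b k l"
proof -
  have v': "(\<Sum>L\<in>I. g L * fst v ^ fst L * snd v ^ snd L * z) = 0" for z
    using v by (simp add: sum_distrib_right[symmetric])
  \<comment> \<open>This is \<open>q F - q(x, y) F = 0\<close>, written with divided differences.\<close>
  have sum0: "(divdiff1 g I (fst v) F (Suc k) l - fst v * divdiff1 g I (fst v) F k l)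
        + (divdiff2 g I v F k (Suc l) - snd v * divdiff2 g I v F k l) = 0" for k l
  proof -
    have "(divdiff1 g I (fst v) F (Suc k) l - fst v * divdiff1 g I (fst v) F k l)
        + (divdiff2 g I v F k (Suc l) - snd v * divdiff2 g I v F k l)
      = (\<Sum>L\<in>I. g L * F (k + fst L) (l + snd L)) - (\<Sum>L\<in>I. g L * fst v ^ fst L * snd v ^ snd L * F k l)"
      unfolding divdiff1_eq divdiff2_eq sum.distrib[symmetric] sum_subtractf[symmetric]
      by (intro sum.cong refl) (simp add: algebra_simps)
    then show ?thesis using ann v'[of "F k l"] by simp
  qed
  have "branch_sol g I c v F (Suc k) l - fst v * branch_sol g I c v F k l
     = snd c * (divdiff1 g I (fst v) F (Suc k) l - fst v * divdiff1 g I (fst v) F k l)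
       - fst c * divdiff2 g I v F (Suc k) l + fst c * fst v * divdiff2 g I v F k l"
    by (simp add: branch_sol_def algebra_simps)
  also have "divdiff1 g I (fst v) F (Suc k) l - fst v * divdiff1 g I (fst v) F k l
     = - (divdiff2 g I v F k (Suc l) - snd v * divdiff2 g I v F k l)"
    using sum0[of k l] by (simp add: algebra_simps add_eq_0_iff)
  also have "snd c * - (divdiff2 g I v F k (Suc l) - snd v * divdiff2 g I v F k l)
       - fst c * divdiff2 g I v F (Suc k) l + fst c * fst v * divdiff2 g I v F k l
     = (fst c * fst v + snd c * snd v) * divdiff2 g I v F k l
        - (fst c * divdiff2 g I v F (Suc k) l + snd c * divdiff2 g I v F k (Suc l))"
    by (simp add: algebra_simps)
  also have "\<dots> = divdiff2 g I v b k l"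
    using divdiff_add(2)[where F = F and G = b and a = "fst c" and b = "snd c", OF F, of g I v k l] cv by simp
  finally show "branch_sol g I c v F (Suc k) l - fst v * branch_sol g I c v F k l = divdiff2 g I v b k l" .
  have "branch_sol g I c v F k (Suc l) - snd v * branch_sol g I c v F k l
     = snd c * divdiff1 g I (fst v) F k (Suc l) - snd c * snd v * divdiff1 g I (fst v) F k l
       - fst c * (divdiff2 g I v F k (Suc l) - snd v * divdiff2 g I v F k l)"
    by (simp add: branch_sol_def algebra_simps)
  also have "divdiff2 g I v F k (Suc l) - snd v * divdiff2 g I v F k l
     = - (divdiff1 g I (fst v) F (Suc k) l - fst v * divdiff1 g I (fst v) F k l)"
    using sum0[of k l] by (simp add: algebra_simps add_eq_0_iff)
  also have "snd c * divdiff1 g I (fst v) F k (Suc l) - snd c * snd v * divdiff1 g I (fst v) F k l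
       - fst c * - (divdiff1 g I (fst v) F (Suc k) l - fst v * divdiff1 g I (fst v) F k l)
     = (fst c * divdiff1 g I (fst v) F (Suc k) l + snd c * divdiff1 g I (fst v) F k (Suc l))
       - (fst c * fst v + snd c * snd v) * divdiff1 g I (fst v) F k l"
    by (simp add: algebra_simps)
  also have "\<dots> = - divdiff1 g I (fst v) b k l"
    using divdiff_add(1)[where F = F and G = b and a = "fst c" and b = "snd c", OF F, of g I "fst v" k l] cv by simp
  finally show "branch_sol g I c v F k (Suc l) - snd v * branch_sol g I c v F k l = - divdiff1 g I (fst v) b k l" .
qed

definition coeff_size :: "(nat \<times> nat \<Rightarrow> complex) \<Rightarrow> (nat \<times> nat) set \<Rightarrow> real" where
  "coeff_size g I = (\<Sum>L\<in>I. cmod (g L) * real (fst L + snd L + 1)^2)"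

lemma coeff_size_nonneg: "0 \<le> coeff_size g I"
  by (simp add: coeff_size_def sum_nonneg)

text \<open>
  The constants are kept polynomial in the size of \<open>v\<close>, as the final estimate is made near
  exceptional points where the roots \<open>y\<close> may escape to infinity.
\<close>

lemma divdiff_growth:
  assumes p: "p \<ge> 1" and F: "growth p C F" and C: "C \<ge> 0"
    and X: "X \<ge> 1" "cmod (fst v) \<le> X" "cmod (snd v) \<le> X"
    and D: "\<And>L. L \<in> I \<Longrightarrow> fst L + snd L \<le> D"
  shows "growth p (C * coeff_size g I * X ^ D) (divdiff1 g I (fst v) F)"
    and "growth p (C * coeff_size g I * X ^ D) (divdiff2 g I v F)"
proof -
  have key: "cmod (F (k + a) (l + e)) \<le> C * real (i + j + 1) * (k + l + 2) * monom_sup p k l"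
    if "a + e \<le> i + j" for k l a e i j
  proof -
    have "cmod (F (k + a) (l + e)) \<le> C * (k + a + (l + e) + 2) * monom_sup p (k + a) (l + e)"
      using F[unfolded growth_def, rule_format, of "k + a" "l + e"] by simp
    also have "monom_sup p (k + a) (l + e) \<le> monom_sup p k l * 1"
      by (rule order_trans[OF monom_sup_mult[OF p]])
         (intro mult_left_mono monom_sup_le_1 monom_sup_nonneg p)
    also have "C * (k + a + (l + e) + 2) * (monom_sup p k l * 1) \<le>
        C * (real (i + j + 1) * (k + l + 2)) * monom_sup p k l"
    proof -
      have "k + a + (l + e) + 2 \<le> (i + j + 1) * (k + l + 2)" using that by (simp add: algebra_simps)
      then have "real (k + a + (l + e) + 2) \<le> real (i + j + 1) * real (k + l + 2)"
        by (metis of_nat_le_iff of_nat_mult)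
      then show ?thesis using C monom_sup_nonneg[OF p, of k l]
        by (auto intro!: mult_right_mono mult_left_mono)
    qed
    finally show ?thesis using C by (simp add: mult.assoc mult_left_mono)
  qed
  have pw: "cmod x ^ m \<le> X ^ m" if "cmod x \<le> X" for x m
    using that by (intro power_mono) auto
  have XD: "X ^ m \<le> X ^ D" if "m \<le> D" for m using X(1) that by (rule power_increasing[rotated])
  have each: "cmod (y * F (k + a) (l + e)) \<le> X ^ D * (C * real (i + j + 1) * (k + l + 2) * monom_sup p k l)"
    if "cmod y \<le> X ^ D" "a + e \<le> i + j" for y k l a e i j
    unfolding norm_mult using that key[OF that(2)] X by (intro mult_mono) auto
  show "growth p (C * coeff_size g I * X ^ D) (divdiff1 g I (fst v) F)"
    unfolding growth_def
  proof (intro allI)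
    fix k l
    let ?R = "C * (k + l + 2) * monom_sup p k l * X ^ D"
    have R: "0 \<le> ?R" using C monom_sup_nonneg[OF p, of k l] X by simp
    have "cmod (divdiff1 g I (fst v) F k l) \<le> (\<Sum>L\<in>I. cmod (g L) * (\<Sum>a<fst L. ?R * real (fst L + snd L + 1)))"
      unfolding divdiff1_def
    proof (rule sum_norm_le)
      fix L assume L: "L \<in> I"
      have "cmod (\<Sum>a<fst L. fst v ^ (fst L - Suc a) * F (k + a) (l + snd L)) \<le> (\<Sum>a<fst L. ?R * real (fst L + snd L + 1))"
      proof (rule sum_norm_le)
        fix a assume a: "a \<in> {..<fst L}"
        have "cmod (fst v ^ (fst L - Suc a)) \<le> X ^ D"
          unfolding norm_power using D[OF L] a by (intro order_trans[OF pw[OF X(2)] XD]) auto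
        from each[OF this, of a "snd L" "fst L" "snd L" k l] a
        show "cmod (fst v ^ (fst L - Suc a) * F (k + a) (l + snd L)) \<le> ?R * real (fst L + snd L + 1)"
          by (simp add: mult_ac add_ac)
      qed
      then show "cmod (g L * (\<Sum>a<fst L. fst v ^ (fst L - Suc a) * F (k + a) (l + snd L)))
          \<le> cmod (g L) * (\<Sum>a<fst L. ?R * real (fst L + snd L + 1))"
        by (simp add: norm_mult mult_left_mono)
    qed
    also have "\<dots> = ?R * (\<Sum>L\<in>I. cmod (g L) * (real (fst L) * real (fst L + snd L + 1)))"
      by (simp add: sum_distrib_left mult_ac)
    also have "\<dots> \<le> ?R * coeff_size g I"
      unfolding coeff_size_def power2_eq_square
      by (intro mult_left_mono sum_mono mult_right_mono R) auto
    finally show "cmod (divdiff1 g I (fst v) F k l) \<le> C * coeff_size g I * X ^ D * real (k + l + 2) * monom_sup p k l"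
      by (simp add: algebra_simps)
  qed
  show "growth p (C * coeff_size g I * X ^ D) (divdiff2 g I v F)"
    unfolding growth_def
  proof (intro allI)
    fix k l
    let ?R = "C * (k + l + 2) * monom_sup p k l * X ^ D"
    have R: "0 \<le> ?R" using C monom_sup_nonneg[OF p, of k l] X by simp
    have "cmod (divdiff2 g I v F k l) \<le> (\<Sum>L\<in>I. cmod (g L) * (\<Sum>a<snd L. ?R * real (fst L + snd L + 1)))"
      unfolding divdiff2_def
    proof (rule sum_norm_le)
      fix L assume L: "L \<in> I"
      have "cmod (\<Sum>a<snd L. (fst v ^ fst L * snd v ^ (snd L - Suc a)) * F k (l + a)) \<le> (\<Sum>a<snd L. ?R * real (fst L + snd L + 1))"
      proof (rule sum_norm_le)
        fix a assume a: "a \<in> {..<snd L}"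
        have "cmod (fst v ^ fst L * snd v ^ (snd L - Suc a)) \<le> X ^ fst L * X ^ (snd L - Suc a)"
          unfolding norm_power norm_mult using X by (intro mult_mono pw) auto
        also have "\<dots> \<le> X ^ D" unfolding power_add[symmetric] using D[OF L] by (intro XD) auto
        finally have "cmod (fst v ^ fst L * snd v ^ (snd L - Suc a)) \<le> X ^ D" .
        from each[OF this, of 0 a "fst L" "snd L" k l] a
        show "cmod (fst v ^ fst L * snd v ^ (snd L - Suc a) * F k (l + a)) \<le> ?R * real (fst L + snd L + 1)"
          by (simp add: mult_ac add_ac)
      qed
      then show "cmod (g L * fst v ^ fst L * (\<Sum>a<snd L. snd v ^ (snd L - Suc a) * F k (l + a)))
          \<le> cmod (g L) * (\<Sum>a<snd L. ?R * real (fst L + snd L + 1))"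
        by (simp add: mult.assoc sum_distrib_left[symmetric] norm_mult mult_left_mono)
    qed
    also have "\<dots> = ?R * (\<Sum>L\<in>I. cmod (g L) * (real (snd L) * real (fst L + snd L + 1)))"
      by (simp add: sum_distrib_left mult_ac)
    also have "\<dots> \<le> ?R * coeff_size g I"
      unfolding coeff_size_def power2_eq_square
      by (intro mult_left_mono sum_mono mult_right_mono R) auto
    finally show "cmod (divdiff2 g I v F k l) \<le> C * coeff_size g I * X ^ D * real (k + l + 2) * monom_sup p k l"
      by (simp add: algebra_simps)
  qed
qed

text \<open>
  The linear form that supports the level set of \<open>egauge p\<close> through \<open>v\<close>, normalised to take the
  value \<open>1\<close> at \<open>v\<close>: the equality case of the inequality of Hoelder.
\<close>

definition support_dual :: "real \<Rightarrow> complex \<times> complex \<Rightarrow> complex \<times> complex" where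
  "support_dual p v =
    (of_real (cmod (fst v) powr (2 * p) / egauge p v) / fst v,
     of_real (cmod (snd v) powr (2 * p) / egauge p v) / snd v)"

lemma young_powr:
  fixes a b r :: real
  assumes "r > 1" "a \<ge> 0" "b \<ge> 0"
  shows "a powr (r - 1) * b \<le> (r - 1) / r * a powr r + b powr r / r"
proof -
  have "(a powr (r - 1)) * b \<le> (a powr (r - 1)) powr (r / (r - 1)) / (r / (r - 1)) + b powr r / r"
    using assms by (intro Youngs_inequality) (auto simp: field_simps)
  also have "(a powr (r - 1)) powr (r / (r - 1)) = a powr r" using assms by (simp add: powr_powr)
  finally show ?thesis by (simp add: mult_ac)
qed

lemma support_dual_pairing:
  assumes "egauge p v > 0"
  shows "fst (support_dual p v) * fst v + snd (support_dual p v) * snd v = 1"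
proof -
  have *: "of_real (cmod x powr (2 * p) / e) / x * x = (of_real (cmod x powr (2 * p) / e) :: complex)" for x e
    by (cases "x = 0") auto
  show ?thesis
    unfolding support_dual_def fst_conv snd_conv * of_real_add[symmetric] add_divide_distrib[symmetric]
    using assms by (simp add: egauge_def)
qed

lemma support_dual_le:
  assumes p: "p \<ge> 1" and v: "egauge p v > 0"
  shows "dual_le p (support_dual p v) (egauge p v powr (- (1 / (2 * p))))"
  unfolding dual_le_def
proof (intro allI impI)
  fix z assume z: "egauge p z \<le> 1"
  define r where "r = 2 * p"
  define e where "e = egauge p v powr (1 / r)"
  have r: "r > 1" using p by (simp add: r_def)
  have e: "e > 0" using v by (simp add: e_def)
  have er: "e powr r = egauge p v" using r v by (simp add: e_def powr_powr)
  \<comment> \<open>Young's inequality after scaling by \<open>e\<close>, so that the two summands for \<open>v\<close> add up to \<open>1\<close>.\<close>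
  have each: "cmod (of_real (cmod x powr r / egauge p v) / x) * y
      \<le> ((r - 1) / r * (cmod x powr r / egauge p v) + y powr r / r) / e" if "y \<ge> 0" for x y
  proof -
    have "cmod (of_real (cmod x powr r / egauge p v) / x) = (cmod x / e) powr (r - 1) / e"
    proof (cases "x = 0")
      case False
      then have "(cmod x / e) powr (r - 1) / e = (cmod x powr r / cmod x) / (e powr r / e * e)"
        using e by (simp add: powr_divide powr_diff)
      then show ?thesis using e v False by (simp add: norm_divide er norm_mult)
    qed (use r in simp)
    then have "cmod (of_real (cmod x powr r / egauge p v) / x) * y = ((cmod x / e) powr (r - 1) * y) / e"
      by simp
    also have "\<dots> \<le> ((r - 1) / r * (cmod x / e) powr r + y powr r / r) / e"
      using e that r by (intro divide_right_mono young_powr) auto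
    also have "(cmod x / e) powr r = cmod x powr r / egauge p v"
      using e er by (simp add: powr_divide)
    finally show ?thesis .
  qed
  have "cmod (fst (support_dual p v)) * cmod (fst z) + cmod (snd (support_dual p v)) * cmod (snd z)
     \<le> ((r - 1) / r * (cmod (fst v) powr r / egauge p v) + cmod (fst z) powr r / r) / e
      + ((r - 1) / r * (cmod (snd v) powr r / egauge p v) + cmod (snd z) powr r / r) / e"
    unfolding support_dual_def fst_conv snd_conv r_def[symmetric] by (intro add_mono each) auto
  also have "\<dots> = ((r - 1) / r * ((cmod (fst v) powr r + cmod (snd v) powr r) / egauge p v)
        + (cmod (fst z) powr r + cmod (snd z) powr r) / r) / e"
    by (simp add: algebra_simps add_divide_distrib)
  also have "\<dots> = ((r - 1) / r * 1 + egauge p z / r) / e"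
    using v by (simp add: egauge_def r_def)
  also have "\<dots> \<le> ((r - 1) / r * 1 + 1 / r) / e"
    using z r e by (intro divide_right_mono add_left_mono) auto
  also have "\<dots> = 1 / e" using r by (simp add: field_simps)
  also have "\<dots> = egauge p v powr (- (1 / (2 * p)))" by (simp add: e_def r_def powr_minus_divide)
  finally show "cmod (fst (support_dual p v)) * cmod (fst z) + cmod (snd (support_dual p v)) * cmod (snd z)
     \<le> egauge p v powr (- (1 / (2 * p)))" .
qed

text \<open>
  Convexity of the exponential makes the distance of the dual bound from \<open>1\<close> comparable to
  \<open>egauge p v - 1\<close>.
\<close>

lemma support_dual_gap:
  assumes p: "p \<ge> 1" and v: "egauge p v > 1"
  shows "egauge p v powr (- (1 / (2 * p))) < 1"
    and "1 / (1 - egauge p v powr (- (1 / (2 * p)))) \<le> 2 * p * egauge p v / (egauge p v - 1)"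
proof -
  define N where "N = egauge p v"
  have N: "N > 1" using v by (simp add: N_def)
  define a where "a = 1 / (2 * p)"
  have a: "0 < a" "a \<le> 1" "1 / a = 2 * p" using p by (auto simp: a_def)
  have "N powr (- a) \<le> 1 - a * (1 - 1 / N)"
  proof -
    have "N powr (- a) = (1 / N) powr a" using N by (simp add: powr_minus_divide powr_divide)
    also have "\<dots> = exp (a * ln (1 / N))" using N by (simp add: powr_def)
    also have "\<dots> = exp ((1 - a) *\<^sub>R 0 + a *\<^sub>R ln (1 / N))" by simp
    also have "\<dots> \<le> (1 - a) * exp 0 + a * exp (ln (1 / N))"
      using a by (intro convex_onD[OF exp_convex]) auto
    also have "\<dots> = 1 - a * (1 - 1 / N)" using N by (simp add: algebra_simps)
    finally show ?thesis .
  qed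
  moreover have pos: "a * (1 - 1 / N) > 0" using a N by simp
  ultimately show "egauge p v powr (- (1 / (2 * p))) < 1"
    unfolding N_def[symmetric] a_def[symmetric] by linarith
  have "1 / (1 - N powr (- a)) \<le> 1 / (a * (1 - 1 / N))"
    using \<open>N powr (- a) \<le> 1 - a * (1 - 1 / N)\<close> pos by (intro divide_left_mono mult_pos_pos[OF pos]) auto
  also have "\<dots> = (1 / a) * N / (N - 1)" using N a(1) by (simp add: field_simps)
  finally show "1 / (1 - egauge p v powr (- (1 / (2 * p)))) \<le> 2 * p * egauge p v / (egauge p v - 1)"
    unfolding N_def[symmetric] a_def[symmetric] a(3) .
qed

lemma dual_le_norm:
  assumes "p \<ge> 1" "dual_le p c t"
  shows "cmod (fst c) \<le> t" "cmod (snd c) \<le> t"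
proof -
  have "egauge p (1, 0) \<le> 1" "egauge p (0, 1) \<le> 1" using assms(1) by (auto simp: egauge_def)
  then show "cmod (fst c) \<le> t" "cmod (snd c) \<le> t"
    using assms(2)[unfolded dual_le_def, rule_format, of "(1, 0)"]
      assms(2)[unfolded dual_le_def, rule_format, of "(0, 1)"] by auto
qed

lemma branch_sol_growth:
  assumes p: "p \<ge> 1" and F: "growth p C F" and C: "C \<ge> 0"
    and X: "X \<ge> 1" "cmod (fst v) \<le> X" "cmod (snd v) \<le> X"
    and D: "\<And>L. L \<in> I \<Longrightarrow> fst L + snd L \<le> D"
    and c: "cmod (fst c) \<le> 1" "cmod (snd c) \<le> 1"
  shows "growth p (2 * (C * coeff_size g I * X ^ D)) (branch_sol g I c v F)"
  unfolding growth_def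
proof (intro allI)
  fix k l
  let ?R = "C * coeff_size g I * X ^ D * (k + l + 2) * monom_sup p k l"
  have d: "cmod (divdiff1 g I (fst v) F k l) \<le> ?R" "cmod (divdiff2 g I v F k l) \<le> ?R"
    using divdiff_growth[OF p F C X D, of I g] unfolding growth_def by (simp_all add: add_ac)
  have "cmod (branch_sol g I c v F k l) \<le> cmod (snd c) * cmod (divdiff1 g I (fst v) F k l)
       + cmod (fst c) * cmod (divdiff2 g I v F k l)"
    unfolding branch_sol_def by (rule order_trans[OF norm_triangle_ineq4]) (simp add: norm_mult)
  also have "\<dots> \<le> 1 * ?R + 1 * ?R" using c d by (intro add_mono mult_mono) auto
  finally show "cmod (branch_sol g I c v F k l) \<le>
      2 * (C * coeff_size g I * X ^ D) * real (k + l + 2) * monom_sup p k l"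
    by (simp add: algebra_simps)
qed

definition branch_val :: "real \<Rightarrow> (nat \<times> nat \<Rightarrow> complex) \<Rightarrow> (nat \<times> nat) set \<Rightarrow> double_seq \<Rightarrow> complex \<times> complex \<Rightarrow> complex" where
  "branch_val p g I b v = branch_sol g I (support_dual p v) v (fantappie (support_dual p v) b) 0 0"

lemma growth_diff:
  assumes "growth p C F" "growth p C' G"
  shows "growth p (C + C') (\<lambda>i j. F i j - G i j)"
  unfolding growth_def
proof (intro allI)
  fix i j
  show "cmod (F i j - G i j) \<le> (C + C') * real (i + j + 2) * monom_sup p i j"
    using assms[unfolded growth_def, rule_format, of i j] norm_triangle_ineq4[of "F i j" "G i j"]
    by (simp add: algebra_simps)
qed

text \<open>
  By \<open>branch_sol_eqs\<close> two admissible forms \<open>c\<close> give solutions of the same two shift equations. Their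
  difference is a joint eigensequence of controlled growth, hence zero at the origin.
\<close>

lemma branch_val_eqI:
  assumes p: "p \<ge> 1" and b: "growth p C b" and C: "C \<ge> 0" and I: "finite I"
    and ann: "\<And>k l. (\<Sum>L\<in>I. g L * b (k + fst L) (l + snd L)) = 0"
    and v: "(\<Sum>L\<in>I. g L * fst v ^ fst L * snd v ^ snd L) = 0" and N: "egauge p v > 1"
    and c: "dual_le p c t" "t < 1" and cv: "fst c * fst v + snd c * snd v = 1"
  shows "branch_sol g I c v (fantappie c b) 0 0 = branch_val p g I b v"
proof -
  let ?c' = "support_dual p v"
  have c': "dual_le p ?c' (egauge p v powr (- (1 / (2 * p))))" "egauge p v powr (- (1 / (2 * p))) < 1"
    "fst ?c' * fst v + snd ?c' * snd v = 1"
    using N support_dual_le[OF p] support_dual_gap[OF p] support_dual_pairing by auto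
  define X where "X = max 1 (max (cmod (fst v)) (cmod (snd v)))"
  have X: "X \<ge> 1" "cmod (fst v) \<le> X" "cmod (snd v) \<le> X" by (auto simp: X_def)
  define D where "D = Max (insert 0 ((\<lambda>L. fst L + snd L) ` I))"
  have D: "fst L + snd L \<le> D" if "L \<in> I" for L using that I unfolding D_def by (intro Max_ge) auto
  have gr: "\<exists>K\<ge>0. growth p K (branch_sol g I d v (fantappie d b))" if "dual_le p d s" "s < 1" for d s
  proof -
    have "cmod (fst d) \<le> 1" "cmod (snd d) \<le> 1" using dual_le_norm[OF p that(1)] that(2) by auto
    from branch_sol_growth[OF p fantappie_growth[OF p that b C] _ X D this, of I g]
    have "growth p (2 * (2 * C / (1 - s) ^ 3 * coeff_size g I * X ^ D)) (branch_sol g I d v (fantappie d b))"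
      using C that(2) by simp
    moreover have "0 \<le> 2 * (2 * C / (1 - s) ^ 3 * coeff_size g I * X ^ D)"
      using C that(2) X(1) by (intro mult_nonneg_nonneg coeff_size_nonneg) auto
    ultimately show ?thesis by blast
  qed
  obtain K K' where K: "K \<ge> 0" "growth p K (branch_sol g I c v (fantappie c b))"
    "K' \<ge> 0" "growth p K' (branch_sol g I ?c' v (fantappie ?c' b))"
    using gr[OF c] gr[OF c'(1,2)] by blast
  define d where "d i j = branch_sol g I c v (fantappie c b) i j - branch_sol g I ?c' v (fantappie ?c' b) i j" for i j
  have rel: "x - x' = s * (y - y')" if "x - s * y = w" "x' - s * y' = w" for x x' y y' s w :: complex
  proof -
    have "x = w + s * y" "x' = w + s * y'" using that by (auto simp: algebra_simps)
    then show ?thesis by (simp add: algebra_simps)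
  qed
  have "d 0 0 = 0"
  proof (rule joint_eigensequence_zero[where d = d, OF p c])
    show "growth p (K + K') d" unfolding d_def[abs_def] by (rule growth_diff[OF K(2,4)])
    show "K + K' \<ge> 0" using K by simp
    note e = branch_sol_eqs[OF fantappie_eq[OF p c b C] fantappie_annihilated[OF p c b C I ann] v cv]
    note e' = branch_sol_eqs[OF fantappie_eq[OF p c'(1,2) b C] fantappie_annihilated[OF p c'(1,2) b C I ann] v c'(3)]
    show "d (Suc i) j = fst v * d i j" for i j
      unfolding d_def by (rule rel[OF e(1) e'(1)])
    show "d i (Suc j) = snd v * d i j" for i j
      unfolding d_def by (rule rel[OF e(2) e'(2)])
  qed (rule cv)
  then show ?thesis by (simp add: d_def branch_val_def)
qed

text \<open>
  The exponent \<open>3\<close> is that of \<open>\<Sum>\<^sub>n (n + 1)\<^sup>2 t\<^sup>n\<close>, with \<open>t\<close> the dual bound of the supporting form.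
\<close>

lemma branch_val_bound:
  assumes p: "p \<ge> 1" and b: "growth p C b" and C: "C \<ge> 0" and N: "egauge p v > 1"
    and X: "X \<ge> 1" "cmod (fst v) \<le> X" "cmod (snd v) \<le> X"
    and D: "\<And>L. L \<in> I \<Longrightarrow> fst L + snd L \<le> D"
  shows "cmod (branch_val p g I b v) \<le> 8 * C * coeff_size g I * X ^ D * (2 * p * egauge p v / (egauge p v - 1)) ^ 3"
proof -
  let ?c' = "support_dual p v"
  let ?t = "egauge p v powr (- (1 / (2 * p)))"
  have c': "dual_le p ?c' ?t" "?t < 1"
    using N support_dual_le[OF p] support_dual_gap[OF p] by auto
  have n: "cmod (fst ?c') \<le> 1" "cmod (snd ?c') \<le> 1" using dual_le_norm[OF p c'(1)] c'(2) by auto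
  have C': "0 \<le> 2 * C / (1 - ?t) ^ 3" using C c'(2) by simp
  from branch_sol_growth[OF p fantappie_growth[OF p c' b C] C' X D n, of I g, unfolded growth_def, rule_format, of 0 0]
  have "cmod (branch_val p g I b v) \<le> 2 * (2 * C / (1 - ?t) ^ 3 * coeff_size g I * X ^ D) * 2 * monom_sup p 0 0"
    by (simp add: branch_val_def)
  also have "\<dots> \<le> 2 * (2 * C / (1 - ?t) ^ 3 * coeff_size g I * X ^ D) * 2 * 1"
    using C' X coeff_size_nonneg[of g I]
    by (intro mult_left_mono[OF monom_sup_le_1[OF p]] mult_nonneg_nonneg) auto
  also have "\<dots> = 8 * C * coeff_size g I * X ^ D * (1 / (1 - ?t)) ^ 3"
    by (simp add: power_divide)
  also have "\<dots> \<le> 8 * C * coeff_size g I * X ^ D * (2 * p * egauge p v / (egauge p v - 1)) ^ 3"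
    using C X coeff_size_nonneg[of g I] support_dual_gap[OF p N]
    by (intro mult_left_mono power_mono) auto
  finally show ?thesis .
qed

section \<open>Holomorphic functions bounded by a power of a subharmonic gap\<close>

text \<open>
  Subtracting \<open>k x\<^sup>2 / 2\<close> leaves a convex function, and \<open>y\<close> is a point where the function is smallest.
  No critical point is involved: the minimum may sit at an end of the interval.
\<close>

lemma strongly_convex_lower_bound:
  fixes f :: "real \<Rightarrow> real"
  assumes "a \<le> b"
    and d1: "\<And>x. x \<in> {a..b} \<Longrightarrow> (f has_real_derivative f' x) (at x)"
    and d2: "\<And>x. x \<in> {a..b} \<Longrightarrow> (f' has_real_derivative f'' x) (at x)"
    and k: "\<And>x. x \<in> {a..b} \<Longrightarrow> f'' x \<ge> k"
    and pos: "\<And>x. x \<in> {a..b} \<Longrightarrow> f x \<ge> 0"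
  shows "\<exists>y\<in>{a..b}. \<forall>x\<in>{a..b}. f x \<ge> k / 2 * (x - y)^2"
proof -
  define g where "g x = f x - k / 2 * x^2" for x
  have conv: "convex_on {a..b} g"
  proof (rule f''_ge0_imp_convex)
    show "(g has_real_derivative (f' x - k * x)) (at x)" if "x \<in> {a..b}" for x
      unfolding g_def[abs_def] by (rule derivative_eq_intros d1 that refl | simp)+
    show "((\<lambda>x. f' x - k * x) has_real_derivative (f'' x - k)) (at x)" if "x \<in> {a..b}" for x
      by (rule derivative_eq_intros d2 that refl | simp)+
    show "f'' x - k \<ge> 0" if "x \<in> {a..b}" for x using k[OF that] by simp
  qed simp
  have "continuous_on {a..b} f"
    using d1 by (meson DERIV_isCont continuous_at_imp_continuous_on)
  then obtain y where y: "y \<in> {a..b}" "\<And>x. x \<in> {a..b} \<Longrightarrow> f y \<le> f x"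
    using continuous_attains_inf[of "{a..b}" f] \<open>a \<le> b\<close> by auto
  have "f x \<ge> k / 2 * (x - y)^2" if x: "x \<in> {a..b}" for x
  proof -
    have *: "s * (k / 2 * (x - y)^2) \<le> f x - f y" if s: "0 < s" "s < 1" for s
    proof -
      define t where "t = 1 - s"
      have t: "0 < t" "t < 1" using s by (auto simp: t_def)
      let ?w = "(1 - t) *\<^sub>R y + t *\<^sub>R x"
      have w: "?w \<in> {a..b}"
        using x y t convexD_alt[of "{a..b}" y x t] by (auto simp: convex_real_interval)
      have "f y \<le> f ?w" using y w by blast
      moreover have "g ?w \<le> (1 - t) * g y + t * g x"
        using convex_onD[OF conv, of t y x] x y t by auto
      moreover have "((1 - t) * g y + t * g x) - g ?w
          = ((1 - t) * f y + t * f x) - f ?w - k / 2 * ((1 - t) * y^2 + t * x^2 - ((1 - t) * y + t * x)^2)"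
        by (simp only: g_def real_scaleR_def ring_distribs mult_ac diff_add_eq diff_diff_eq)
      moreover have "t * (f x - f y) = ((1 - t) * f y + t * f x) - f y" by (simp add: algebra_simps)
      ultimately have "t * (f x - f y) \<ge> k / 2 * ((1 - t) * y^2 + t * x^2 - ((1 - t) * y + t * x)^2)"
        by linarith
      also have "(1 - t) * y^2 + t * x^2 - ((1 - t) * y + t * x)^2 = t * (1 - t) * (x - y)^2"
        by (simp add: power2_eq_square algebra_simps)
      finally have "t * (s * (k / 2 * (x - y)^2)) \<le> t * (f x - f y)"
        by (simp add: t_def mult_ac)
      then show ?thesis using t by simp
    qed
    \<comment> \<open>Let \<open>s\<close> tend to \<open>1\<close>, that is, move along the segment towards the minimum.\<close>
    have "k / 2 * (x - y)^2 \<le> f x - f y" by (rule field_le_mult_one_interval) (use * in auto)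
    then show ?thesis using pos[OF y(1)] by simp
  qed
  with y(1) show ?thesis by blast
qed

text \<open>
  On each side of the square \<open>\<rho>\<close> dominates the squared distance to one point, so \<open>\<bar>h\<bar> \<le> C / \<rho>\<^sup>3\<close> grows
  there at most like the inverse sixth power of that distance. Multiplying \<open>h\<close> by sixth powers of the
  distances to the four points gives a function bounded on the whole frontier.
\<close>

lemma square_frontier_bound:
  fixes h :: "complex \<Rightarrow> complex" and \<rho> :: "complex \<Rightarrow> real"
  assumes \<eta>: "\<eta> > 0" and k: "k > 0"
    and hol: "h holomorphic_on cbox (Complex (-\<eta>) (-\<eta>)) (Complex \<eta> \<eta>)"
    and side: "\<And>m. m < 4 \<Longrightarrow> \<exists>y\<in>{-\<eta>..\<eta>}. \<forall>x\<in>{-\<eta>..\<eta>}. \<rho> (\<i> ^ m * Complex \<eta> x) \<ge> k / 2 * (x - y)^2"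
    and bd: "\<And>z. z \<in> cbox (Complex (-\<eta>) (-\<eta>)) (Complex \<eta> \<eta>) \<Longrightarrow> cmod (h z) * \<rho> z ^ 3 \<le> C"
  shows "cmod (h 0) \<le> 8 * 3 ^ 18 * C / (k ^ 3 * \<eta> ^ 6)"
proof -
  let ?Q = "cbox (Complex (-\<eta>) (-\<eta>)) (Complex \<eta> \<eta>)"
  have memQ: "z \<in> ?Q \<longleftrightarrow> \<bar>Re z\<bar> \<le> \<eta> \<and> \<bar>Im z\<bar> \<le> \<eta>" for z
    by (auto simp: in_cbox_complex_iff)
  obtain y where y: "\<And>m. m < 4 \<Longrightarrow> y m \<in> {-\<eta>..\<eta>}"
      "\<And>m x. m < 4 \<Longrightarrow> x \<in> {-\<eta>..\<eta>} \<Longrightarrow> \<rho> (\<i> ^ m * Complex \<eta> x) \<ge> k / 2 * (x - y m)^2"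
    using side by metis
  \<comment> \<open>The side with number \<open>m\<close> is the right-hand side of the square turned by \<open>m\<close> right angles.\<close>
  define b where "b m = \<i> ^ m * Complex \<eta> (y m)" for m
  define g where "g z = h z * (\<Prod>m<4. (z - b m) ^ 6)" for z
  have m4: "{..<4::nat} = {0, 1, 2, 3}" by auto
  have i3: "\<i> ^ 3 = - \<i>" by (simp add: power3_eq_cube)
  have bQ: "b m \<in> ?Q" if "m < 4" for m
  proof -
    have "m \<in> {0, 1, 2, 3}" using that by auto
    then show ?thesis using y(1)[OF that] \<eta> by (auto simp: memQ b_def i3)
  qed
  have dist: "cmod (z - b m) \<le> 3 * \<eta>" if "z \<in> ?Q" "m < 4" for z m
  proof -
    have "\<bar>Re (z - b m)\<bar> \<le> 2 * \<eta>" "\<bar>Im (z - b m)\<bar> \<le> 2 * \<eta>"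
      using that bQ[OF that(2)] by (auto simp: memQ)
    then have "(cmod (z - b m))^2 \<le> (2 * \<eta>)^2 + (2 * \<eta>)^2"
      unfolding cmod_power2 using \<eta> by (intro add_mono) (metis abs_le_square_iff abs_of_pos mult_pos_pos zero_less_numeral)+
    also have "\<dots> \<le> (3 * \<eta>)^2" using \<eta> by (simp add: power2_eq_square)
    finally show ?thesis by (rule power2_le_imp_le) (use \<eta> in simp)
  qed
  have onside: "cmod (g (\<i> ^ m * Complex \<eta> x)) \<le> C * (2 / k)^3 * (3 * \<eta>) ^ 18"
    if m: "m < 4" and x: "x \<in> {-\<eta>..\<eta>}" for m x
  proof -
    let ?z = "\<i> ^ m * Complex \<eta> x"
    have "m \<in> {0, 1, 2, 3}" using m by auto
    then have z: "?z \<in> ?Q" using x \<eta> by (auto simp: memQ i3)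
    have zb: "cmod (?z - b m) = \<bar>x - y m\<bar>"
    proof -
      have "?z - b m = \<i> ^ m * Complex 0 (x - y m)" by (simp add: b_def algebra_simps complex_eq_iff)
      then have "cmod (?z - b m) = cmod (Complex 0 (x - y m))" by (simp only: norm_mult norm_power) simp
      then show ?thesis by (simp add: cmod_def)
    qed
    have "cmod (h ?z) * ((k / 2) * (x - y m)^2)^3 \<le> cmod (h ?z) * \<rho> ?z ^ 3"
      using y(2)[OF m x] k by (intro mult_left_mono power_mono) auto
    also have "\<dots> \<le> C" by (rule bd[OF z])
    finally have 1: "cmod (h ?z) * (cmod (?z - b m)) ^ 6 \<le> C * (2 / k)^3"
      using k unfolding zb by (simp add: field_simps power_mult_distrib flip: power_mult)
    have 2: "(\<Prod>j\<in>{..<4} - {m}. cmod (?z - b j) ^ 6) \<le> (\<Prod>j\<in>{..<4::nat} - {m}. (3 * \<eta>) ^ 6)"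
      using dist[OF z] by (intro prod_mono conjI power_mono) auto
    have "cmod (g ?z) = cmod (h ?z) * (\<Prod>j<4. cmod (?z - b j) ^ 6)"
      by (simp add: g_def norm_mult norm_power flip: prod_norm)
    also have "(\<Prod>j<4. cmod (?z - b j) ^ 6) = cmod (?z - b m) ^ 6 * (\<Prod>j\<in>{..<4} - {m}. cmod (?z - b j) ^ 6)"
      using m by (intro prod.remove) auto
    also have "cmod (h ?z) * (cmod (?z - b m) ^ 6 * (\<Prod>j\<in>{..<4} - {m}. cmod (?z - b j) ^ 6))
        \<le> (C * (2 / k)^3) * (\<Prod>j\<in>{..<4::nat} - {m}. (3 * \<eta>) ^ 6)"
      unfolding mult.assoc[symmetric]
      using order_trans[OF _ 1, of 0] by (intro mult_mono 1 2 prod_nonneg) auto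
    also have "(\<Prod>j\<in>{..<4::nat} - {m}. (3 * \<eta>) ^ 6) = (3 * \<eta>) ^ 18"
      using m by (simp add: card_Diff_singleton flip: power_mult)
    finally show ?thesis .
  qed
  have "cmod (g 0) \<le> C * (2 / k)^3 * (3 * \<eta>) ^ 18"
  proof (rule maximum_modulus_frontier[where S = ?Q and f = g])
    show "g holomorphic_on interior ?Q"
      unfolding g_def using holomorphic_on_subset[OF hol interior_subset]
      by (intro holomorphic_intros) auto
    have "continuous_on ?Q g"
      unfolding g_def using holomorphic_on_imp_continuous_on[OF hol] by (intro continuous_intros) auto
    then show "continuous_on (closure ?Q) g" by simp
    show "0 \<in> ?Q" using \<eta> by (simp add: memQ)
    show "cmod (g z) \<le> C * (2 / k)^3 * (3 * \<eta>) ^ 18" if z: "z \<in> frontier ?Q" for z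
    proof -
      have "z \<in> ?Q" "z \<notin> box (Complex (-\<eta>) (-\<eta>)) (Complex \<eta> \<eta>)"
        using z by (auto simp: frontier_def interior_cbox)
      then have zz: "\<bar>Re z\<bar> \<le> \<eta>" "\<bar>Im z\<bar> \<le> \<eta>" "\<bar>Re z\<bar> = \<eta> \<or> \<bar>Im z\<bar> = \<eta>"
        by (auto simp: memQ in_box_complex_iff abs_if split: if_splits)
      then consider "Re z = \<eta>" | "Re z = -\<eta>" | "Im z = \<eta>" | "Im z = -\<eta>" by (auto simp: abs_if split: if_splits)
      then obtain m x where "m < 4" "x \<in> {-\<eta>..\<eta>}" "z = \<i> ^ m * Complex \<eta> x"
      proof cases
        case 1 then show ?thesis using zz that[of 0 "Im z"] by (auto simp: complex_eq_iff abs_le_iff)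
      next
        case 2 then show ?thesis using zz that[of 2 "- Im z"] by (auto simp: complex_eq_iff abs_le_iff)
      next
        case 3 then show ?thesis using zz that[of 1 "- Re z"] by (auto simp: complex_eq_iff abs_le_iff)
      next
        case 4 then show ?thesis using zz that[of 3 "Re z"] by (auto simp: complex_eq_iff i3 abs_le_iff)
      qed
      then show ?thesis using onside by blast
    qed
  qed auto
  moreover have "cmod (h 0) * \<eta> ^ 24 \<le> cmod (g 0)"
  proof -
    have "\<eta> \<le> cmod (0 - b m)" if "m < 4" for m
      using \<eta> complex_Re_le_cmod[of "Complex \<eta> (y m)"] by (simp add: b_def norm_mult norm_power)
    then have "(\<Prod>m<4::nat. \<eta> ^ 6) \<le> (\<Prod>m<4. cmod (0 - b m) ^ 6)"
      using \<eta> by (intro prod_mono) (auto intro!: power_mono)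
    then have "\<eta> ^ 24 \<le> (\<Prod>m<4. cmod (0 - b m) ^ 6)" by (simp flip: power_mult)
    then show ?thesis
      unfolding g_def norm_mult norm_power prod_norm[symmetric] by (intro mult_left_mono) auto
  qed
  ultimately have "cmod (h 0) * \<eta> ^ 24 \<le> C * (2 / k)^3 * (3 * \<eta>) ^ 18" by linarith
  also have "\<dots> = (8 * 3 ^ 18 * C / (k ^ 3 * \<eta> ^ 6)) * \<eta> ^ 24"
    using \<eta> k by (simp add: power_divide power_mult_distrib field_simps flip: power_add)
  finally show ?thesis by (rule mult_right_le_imp_le) (use \<eta> in simp)
qed

lemma Re_square: "(Re u)^2 = (cmod u)^2 / 2 + Re (u^2) / 2"
  unfolding cmod_power2 by (simp add: power2_eq_square field_simps)

text \<open>
  The second derivative of \<open>exp (Re G)\<close> in a direction \<open>d\<close> has one part independent of \<open>d\<close>, positive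
  where \<open>G' \<noteq> 0\<close>, and one part \<open>Re (H d\<^sup>2)\<close> that changes sign when \<open>d\<close> is turned by a right angle. The
  second part can therefore be made to vanish along two perpendicular directions at once.
\<close>

lemma exp_Re_line_derivs:
  fixes G :: "complex \<Rightarrow> complex"
  assumes G: "G holomorphic_on S" "open S" and x: "w + of_real x * d \<in> S" and d: "cmod d = 1"
  defines "E \<equiv> \<lambda>x. exp (Re (G (w + of_real x * d)))"
  shows "(E has_real_derivative Re (deriv G (w + of_real x * d) * d) * E x) (at x)"
    and "((\<lambda>x. Re (deriv G (w + of_real x * d) * d) * E x) has_real_derivative
       (cmod (deriv G (w + of_real x * d)) ^ 2 / 2
        + Re (((deriv G (w + of_real x * d))^2 / 2 + deriv (deriv G) (w + of_real x * d)) * d^2)) * E x) (at x)"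
proof -
  let ?z = "w + of_real x * d"
  have line: "((\<lambda>x. w + of_real x * d) has_vector_derivative d) (at x)"
    by (auto intro!: derivative_eq_intros simp: has_vector_derivative_def scaleR_conv_of_real)
  have hd: "((\<lambda>x. Re (H (w + of_real x * d))) has_real_derivative Re (deriv H ?z * d)) (at x)"
    if "H holomorphic_on S" for H
  proof -
    have "(H has_field_derivative deriv H ?z) (at ?z)"
      using holomorphic_derivI[OF that G(2) x] .
    from field_vector_diff_chain_at[OF line this]
    have "((\<lambda>x. H (w + of_real x * d)) has_vector_derivative d * deriv H ?z) (at x)"
      by (simp add: o_def)
    then show ?thesis
      by (simp add: has_vector_derivative_complex_iff has_real_derivative_iff_has_vector_derivative mult.commute)
  qed
  have 1: "(E has_real_derivative Re (deriv G ?z * d) * E x) (at x)"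
    unfolding E_def by (rule derivative_eq_intros hd[OF G(1)] refl | simp)+
  show "(E has_real_derivative Re (deriv G ?z * d) * E x) (at x)" by (rule 1)
  have hol2: "(\<lambda>z. deriv G z * d) holomorphic_on S"
    by (intro holomorphic_intros holomorphic_deriv G)
  have "deriv (\<lambda>z. deriv G z * d) ?z = deriv (deriv G) ?z * d"
    by (rule DERIV_imp_deriv)
       (rule derivative_eq_intros holomorphic_derivI[OF holomorphic_deriv[OF G] G(2) x] refl | simp)+
  then have 2: "((\<lambda>x. Re (deriv G (w + of_real x * d) * d)) has_real_derivative Re (deriv (deriv G) ?z * d * d)) (at x)"
    using hd[OF hol2] by simp
  have "((\<lambda>x. Re (deriv G (w + of_real x * d) * d) * E x) has_real_derivative
       Re (deriv (deriv G) ?z * d * d) * E x + (Re (deriv G ?z * d) * E x) * Re (deriv G ?z * d)) (at x)"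
    by (rule DERIV_mult[OF 2 1])
  also have "Re (deriv (deriv G) ?z * d * d) * E x + (Re (deriv G ?z * d) * E x) * Re (deriv G ?z * d)
     = ((Re (deriv G ?z * d))^2 + Re (deriv (deriv G) ?z * d^2)) * E x"
    by (simp add: algebra_simps power2_eq_square)
  also have "(Re (deriv G ?z * d))^2 = cmod (deriv G ?z)^2 / 2 + Re ((deriv G ?z)^2 / 2 * d^2)"
    unfolding Re_square by (simp add: norm_mult d power_mult_distrib)
  also have "(cmod (deriv G ?z)^2 / 2 + Re ((deriv G ?z)^2 / 2 * d^2) + Re (deriv (deriv G) ?z * d^2)) * E x
     = (cmod (deriv G ?z) ^ 2 / 2 + Re (((deriv G ?z)^2 / 2 + deriv (deriv G) ?z) * d^2)) * E x"
    by (simp add: algebra_simps)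
  finally show "((\<lambda>x. Re (deriv G (w + of_real x * d) * d) * E x) has_real_derivative
       (cmod (deriv G ?z) ^ 2 / 2 + Re (((deriv G ?z)^2 / 2 + deriv (deriv G) ?z) * d^2)) * E x) (at x)" .
qed

text \<open>
  The factor \<open>H\<close> in the direction-dependent part \<open>Re (H d\<^sup>2)\<close> of the second derivative of
  \<open>exp (Re G)\<close>.
\<close>

definition hess :: "(complex \<Rightarrow> complex) \<Rightarrow> complex \<Rightarrow> complex" where
  "hess G z = ((deriv G z)^2 / 2 + deriv (deriv G) z) * of_real (exp (Re (G z)))"

text \<open>
  Cauchy's inequalities on the concentric ball of twice the radius bound the derivatives of \<open>G\<close> up to
  order three.
\<close>

lemma hess_lipschitz:
  assumes r: "r > 0" and G: "G holomorphic_on ball a (2 * r)"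
    and B: "B \<ge> 2" "\<And>z. z \<in> ball a (2 * r) \<Longrightarrow> cmod (G z) \<le> B"
    and z: "z \<in> ball a r"
  shows "cmod (hess G z - hess G a) \<le> 4 * B ^ 3 * exp B / r ^ 3 * cmod (z - a)"
proof -
  let ?D = "\<lambda>w. (deriv G w)^2 / 2 + deriv (deriv G) w"
  have hol: "(deriv ^^ n) G holomorphic_on ball a (2 * r)" for n
    by (intro holomorphic_higher_deriv G) auto
  have cauchy: "cmod ((deriv ^^ n) G w) \<le> fact n * B / r ^ n" if w: "w \<in> ball a r" for w n
  proof (rule Cauchy_inequality)
    have sub: "cball w r \<subseteq> ball a (2 * r)"
    proof
      fix x assume "x \<in> cball w r"
      then have "dist a x < 2 * r" using w dist_triangle[of a x w] by simp
      then show "x \<in> ball a (2 * r)" by simp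
    qed
    show "G holomorphic_on ball w r" using sub by (intro holomorphic_on_subset[OF G]) auto
    show "continuous_on (cball w r) G"
      using sub by (intro holomorphic_on_imp_continuous_on holomorphic_on_subset[OF G])
    show "cmod (G x) \<le> B" if "cmod (w - x) = r" for x
      using sub that by (intro B(2)) (auto simp: dist_norm)
  qed (rule r)
  have a: "a \<in> ball a r" using r by simp
  have c1: "cmod (deriv G w) \<le> B / r" and c2: "cmod (deriv (deriv G) w) \<le> 2 * B / r ^ 2"
    and c3: "cmod (deriv (deriv (deriv G)) w) \<le> 6 * B / r ^ 3" if "w \<in> ball a r" for w
    using cauchy[OF that, of 1] cauchy[OF that, of 2] cauchy[OF that, of 3]
    by (simp_all add: numeral_2_eq_2 numeral_3_eq_3)
  have sub1: "ball a r \<subseteq> ball a (2 * r)" using r by auto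
  have hd: "((deriv ^^ n) G has_field_derivative (deriv ^^ Suc n) G w) (at w within ball a r)" if "w \<in> ball a r" for w n
    using holomorphic_derivI[OF hol[of n], of w] sub1 that by (auto intro: has_field_derivative_at_within)
  have BB: "6 * B \<le> 3 * B ^ 2" "2 * B \<le> B ^ 2" "5 * B ^ 2 \<le> 5 / 2 * B ^ 3" using B(1)
    by (auto simp: power2_eq_square power3_eq_cube)
  have D1: "cmod (?D z - ?D a) \<le> 5 * B ^ 2 / r ^ 3 * cmod (z - a)"
  proof (rule field_differentiable_bound[OF convex_ball _ _ z a])
    show "(?D has_field_derivative (deriv G w * deriv (deriv G) w + deriv (deriv (deriv G)) w)) (at w within ball a r)"
      if "w \<in> ball a r" for w
      using hd[OF that, of 0] hd[OF that, of 1] hd[OF that, of 2]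
      by (auto intro!: derivative_eq_intros simp: numeral_2_eq_2)
    show "cmod (deriv G w * deriv (deriv G) w + deriv (deriv (deriv G)) w) \<le> 5 * B ^ 2 / r ^ 3"
      if w: "w \<in> ball a r" for w
    proof -
      have "cmod (deriv G w * deriv (deriv G) w + deriv (deriv (deriv G)) w) \<le> (B / r) * (2 * B / r ^ 2) + 6 * B / r ^ 3"
      proof (intro order_trans[OF norm_triangle_ineq] add_mono c3[OF w])
        show "cmod (deriv G w * deriv (deriv G) w) \<le> (B / r) * (2 * B / r ^ 2)"
          unfolding norm_mult using B(1) r by (intro mult_mono c1[OF w] c2[OF w]) auto
      qed
      also have "\<dots> = (2 * B ^ 2 + 6 * B) / r ^ 3"
        by (simp add: power2_eq_square power3_eq_cube add_divide_distrib mult_ac)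
      also have "\<dots> \<le> 5 * B ^ 2 / r ^ 3"
        using BB r by (intro divide_right_mono) auto
      finally show ?thesis .
    qed
  qed
  have D2: "cmod (?D a) \<le> 3 / 2 * B ^ 2 / r ^ 2"
  proof -
    have "cmod (?D a) \<le> (B / r)^2 / 2 + 2 * B / r ^ 2"
      using r B(1)
      by (intro order_trans[OF norm_triangle_ineq] add_mono c2[OF a])
         (auto simp: norm_divide norm_power intro!: divide_right_mono power_mono c1[OF a])
    also have "\<dots> = (B ^ 2 / 2 + 2 * B) / r ^ 2" by (simp add: power_divide add_divide_distrib)
    also have "\<dots> \<le> 3 / 2 * B ^ 2 / r ^ 2" using BB r by (intro divide_right_mono) auto
    finally show ?thesis .
  qed
  have ReB: "\<bar>Re (G w)\<bar> \<le> B" if "w \<in> ball a r" for w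
    using B(2)[of w] that sub1 abs_Re_le_cmod[of "G w"] by auto
  have e1: "exp (Re (G w)) \<le> exp B" if "w \<in> ball a r" for w using ReB[OF that] by simp
  have e2: "\<bar>exp (Re (G z)) - exp (Re (G a))\<bar> \<le> exp B * (B / r * cmod (z - a))"
  proof -
    have "\<bar>exp x - exp y\<bar> \<le> exp B * \<bar>x - y\<bar>" if "\<bar>x\<bar> \<le> B" "\<bar>y\<bar> \<le> B" for x y :: real
    proof -
      have "norm (exp x - exp y) \<le> exp B * norm (x - y)"
        using that
        by (intro field_differentiable_bound[where S = "{-B..B}" and f' = exp])
           (auto intro!: derivative_eq_intros)
      then show ?thesis by simp
    qed
    from this[OF ReB[OF z] ReB[OF a]]
    have "\<bar>exp (Re (G z)) - exp (Re (G a))\<bar> \<le> exp B * \<bar>Re (G z - G a)\<bar>" by simp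
    also have "\<bar>Re (G z - G a)\<bar> \<le> cmod (G z - G a)" by (rule abs_Re_le_cmod)
    also have "\<dots> \<le> B / r * cmod (z - a)"
      using hd[of _ 0] c1 by (intro field_differentiable_bound[OF convex_ball _ _ z a]) auto
    finally show ?thesis by simp
  qed
  have split: "x * u - y * v = (x - y) * u + y * (u - v)" for x y u v :: complex
    by (simp add: algebra_simps)
  have "hess G z - hess G a = (?D z - ?D a) * of_real (exp (Re (G z)))
      + ?D a * of_real (exp (Re (G z)) - exp (Re (G a)))"
    unfolding hess_def of_real_diff by (rule split)
  also have "cmod \<dots> \<le> (5 * B ^ 2 / r ^ 3 * cmod (z - a)) * exp B
      + (3 / 2 * B ^ 2 / r ^ 2) * (exp B * (B / r * cmod (z - a)))"
  proof (intro order_trans[OF norm_triangle_ineq] add_mono)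
    show "cmod ((?D z - ?D a) * of_real (exp (Re (G z)))) \<le> (5 * B ^ 2 / r ^ 3 * cmod (z - a)) * exp B"
      unfolding norm_mult norm_of_real abs_exp_cancel
      using r B(1) by (intro mult_mono D1 e1[OF z] mult_nonneg_nonneg divide_nonneg_nonneg) auto
    show "cmod (?D a * of_real (exp (Re (G z)) - exp (Re (G a)))) \<le> (3 / 2 * B ^ 2 / r ^ 2) * (exp B * (B / r * cmod (z - a)))"
      unfolding norm_mult norm_of_real
      using r B(1) by (intro mult_mono D2 e2 divide_nonneg_nonneg) auto
  qed
  also have "\<dots> = (5 * B ^ 2 + 3 / 2 * B ^ 3) * (exp B / r ^ 3 * cmod (z - a))"
    using r by (simp add: power2_eq_square power3_eq_cube field_simps)
  also have "\<dots> \<le> (4 * B ^ 3) * (exp B / r ^ 3 * cmod (z - a))"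
    using BB r by (intro mult_right_mono) auto
  finally show ?thesis by (simp add: mult_ac)
qed

lemma unit_square_root_direction:
  obtains f where "cmod f = 1" "Re (E * f^2) = 0"
proof (cases "E = 0")
  case True
  then show ?thesis using that[of 1] by simp
next
  case False
  define u where "u = \<i> * cnj E / of_real (cmod E)"
  have "cmod u = 1" using False by (simp add: u_def norm_mult norm_divide)
  then have "cmod (csqrt u) = 1" by simp
  moreover have "E * (csqrt u)^2 = \<i> * of_real (cmod E)"
  proof -
    have "E * (csqrt u)^2 = \<i> * (E * cnj E) / of_real (cmod E)" by (simp add: u_def mult_ac)
    also have "E * cnj E = of_real (cmod E) ^ 2" by (simp add: complex_norm_square[symmetric])
    finally show ?thesis using False by (simp add: power2_eq_square)
  qed
  ultimately show ?thesis using that[of "csqrt u"] by simp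
qed

text \<open>
  The square is centred at \<open>a\<close> and turned so that at \<open>a\<close> the direction-dependent part of the second
  derivative of \<open>\<rho>\<close> vanishes along its sides. Its size \<open>\<eta>\<close> is so small that on the square this part
  stays above \<open>- \<kappa>\<close>, while the other part is at least \<open>2 \<kappa>\<close>. Hence \<open>\<rho>\<close> is strongly convex along the
  sides, and no lower bound for \<open>\<rho>\<close> itself is required.
\<close>

lemma holomorphic_bound_off_level_set:
  fixes G1 G2 h :: "complex \<Rightarrow> complex" and K1 K2 r \<kappa> B C :: real
  defines "\<rho> \<equiv> \<lambda>z. K1 * exp (Re (G1 z)) + K2 * exp (Re (G2 z)) - 1"
    and "\<eta> \<equiv> min (r / 2) (\<kappa> * r ^ 3 / (8 * (K1 + K2) * B ^ 3 * exp B))"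
  assumes r: "r > 0" and K: "K1 > 0" "K2 > 0" and B: "B \<ge> 2" and \<kappa>: "\<kappa> > 0"
    and hol: "G1 holomorphic_on ball a (2 * r)" "G2 holomorphic_on ball a (2 * r)" "h holomorphic_on ball a (2 * r)"
    and bds: "\<And>z. z \<in> ball a (2 * r) \<Longrightarrow> cmod (G1 z) \<le> B" "\<And>z. z \<in> ball a (2 * r) \<Longrightarrow> cmod (G2 z) \<le> B"
    and levi: "\<And>z. z \<in> ball a (2 * r) \<Longrightarrow> K1 * (cmod (deriv G1 z)^2 / 2 * exp (Re (G1 z))) \<ge> 2 * \<kappa>"
    and pos: "\<And>z. z \<in> ball a (2 * r) \<Longrightarrow> \<rho> z \<ge> 0"
    and h: "\<And>z. z \<in> ball a (2 * r) \<Longrightarrow> cmod (h z) * \<rho> z ^ 3 \<le> C"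
  shows "cmod (h a) \<le> 8 * 3 ^ 18 * C / (\<kappa> ^ 3 * \<eta> ^ 6)"
proof -
  define E where "E z = of_real K1 * hess G1 z + of_real K2 * hess G2 z" for z
  obtain f where f: "cmod f = 1" "Re (E a * f^2) = 0" by (rule unit_square_root_direction)
  have \<eta>: "\<eta> > 0" "\<eta> \<le> r / 2" "\<eta> \<le> \<kappa> * r ^ 3 / (8 * (K1 + K2) * B ^ 3 * exp B)"
    unfolding \<eta>_def using r K B \<kappa>
    by (simp_all only: min.cobounded1 min.cobounded2 min_less_iff_conj) auto
  let ?Q = "cbox (Complex (-\<eta>) (-\<eta>)) (Complex \<eta> \<eta>)"
  have Q: "cmod z < 2 * \<eta>" if "z \<in> ?Q" for z
  proof -
    have "\<bar>Re z\<bar> \<le> \<eta>" "\<bar>Im z\<bar> \<le> \<eta>" using that by (auto simp: in_cbox_complex_iff)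
    then have "(cmod z)^2 \<le> \<eta>^2 + \<eta>^2"
      unfolding cmod_power2 using \<eta>(1) by (intro add_mono) (metis abs_le_square_iff abs_of_pos)+
    also have "\<dots> < (2 * \<eta>)^2" using \<eta>(1) by (simp add: power2_eq_square)
    finally show ?thesis by (rule power2_less_imp_less) (use \<eta> in simp)
  qed
  have Qr: "a + f * z \<in> ball a r" "cmod (a + f * z - a) \<le> 2 * \<eta>" if "z \<in> ?Q" for z
    using Q[OF that] \<eta> f(1) by (auto simp: dist_norm norm_mult)
  have sub: "ball a r \<subseteq> ball a (2 * r)" using r by auto
  have "cmod ((\<lambda>z. h (a + f * z)) 0) \<le> 8 * 3 ^ 18 * C / (\<kappa> ^ 3 * \<eta> ^ 6)"
  proof (rule square_frontier_bound[where \<rho> = "\<lambda>z. \<rho> (a + f * z)", OF \<eta>(1) \<kappa>])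
    have "h \<circ> (\<lambda>z. a + f * z) holomorphic_on ?Q"
      using Qr(1) sub by (intro holomorphic_on_compose_gen[OF _ hol(3)] holomorphic_intros) auto
    then show "(\<lambda>z. h (a + f * z)) holomorphic_on ?Q" by (simp add: o_def)
    show "cmod (h (a + f * z)) * \<rho> (a + f * z) ^ 3 \<le> C" if "z \<in> ?Q" for z
      using Qr(1)[OF that] sub by (intro h) auto
    fix m :: nat assume m: "m < 4"
    define w where "w = a + f * (\<i> ^ m * of_real \<eta>)"
    define d where "d = f * \<i> ^ Suc m"
    have d: "cmod d = 1" using f by (simp add: d_def norm_mult norm_power)
    have line: "a + f * (\<i> ^ m * Complex \<eta> x) = w + of_real x * d" for x
      by (simp add: w_def d_def Complex_eq algebra_simps)
    have m': "m \<in> {0, 1, 2, 3}" using m by auto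
    \<comment> \<open>Consecutive sides are perpendicular, so the square of the direction only changes sign.\<close>
    have d2: "d^2 = f^2 \<or> d^2 = - (f^2)"
    proof -
      have "(\<i> ^ Suc m)^2 = (\<i> ^ 2) ^ Suc m" by (metis power_mult mult.commute)
      then have "d^2 = f^2 * (-1) ^ Suc m" unfolding d_def power_mult_distrib by simp
      then show ?thesis by (cases "even m") auto
    qed
    have Ed: "Re (E a * d^2) = 0" using d2 f(2) by auto
    have inQ: "\<i> ^ m * Complex \<eta> x \<in> ?Q" if "x \<in> {-\<eta>..\<eta>}" for x
      using m' that \<eta>(1) by (auto simp: in_cbox_complex_iff numeral_3_eq_3)
    have inb: "w + of_real x * d \<in> ball a (2 * r)" if "x \<in> {-\<eta>..\<eta>}" for x
      using Qr(1)[OF inQ[OF that]] sub unfolding line by blast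
    note D1 = exp_Re_line_derivs[OF hol(1) open_ball inb d]
    note D2 = exp_Re_line_derivs[OF hol(2) open_ball inb d]
    show "\<exists>y\<in>{-\<eta>..\<eta>}. \<forall>x\<in>{-\<eta>..\<eta>}. \<kappa> / 2 * (x - y)\<^sup>2 \<le> \<rho> (a + f * (\<i> ^ m * Complex \<eta> x))"
      unfolding line
    proof (rule strongly_convex_lower_bound)
      fix x assume x: "x \<in> {-\<eta>..\<eta>}"
      let ?z = "w + of_real x * d"
      let ?e1 = "exp (Re (G1 ?z))" and ?e2 = "exp (Re (G2 ?z))"
      show "((\<lambda>x. \<rho> (w + of_real x * d)) has_real_derivative
          (K1 * (Re (deriv G1 ?z * d) * ?e1) + K2 * (Re (deriv G2 ?z * d) * ?e2))) (at x)"
        using DERIV_diff[OF DERIV_add[OF DERIV_cmult[OF D1(1)[OF x], of K1] DERIV_cmult[OF D2(1)[OF x], of K2]]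
            DERIV_const[of 1]]
        unfolding \<rho>_def by (simp only: diff_0_right)
      let ?s1 = "(cmod (deriv G1 ?z) ^ 2 / 2 + Re (((deriv G1 ?z)^2 / 2 + deriv (deriv G1) ?z) * d^2)) * ?e1"
      let ?s2 = "(cmod (deriv G2 ?z) ^ 2 / 2 + Re (((deriv G2 ?z)^2 / 2 + deriv (deriv G2) ?z) * d^2)) * ?e2"
      show "((\<lambda>x. K1 * (Re (deriv G1 (w + of_real x * d) * d) * exp (Re (G1 (w + of_real x * d))))
            + K2 * (Re (deriv G2 (w + of_real x * d) * d) * exp (Re (G2 (w + of_real x * d)))))
            has_real_derivative (K1 * ?s1 + K2 * ?s2)) (at x)"
        by (intro DERIV_add DERIV_cmult D1(2)[OF x] D2(2)[OF x])
      have zb: "?z \<in> ball a r" "cmod (?z - a) \<le> 2 * \<eta>" using Qr[OF inQ[OF x]] unfolding line by auto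
      have split: "K1 * ?s1 + K2 * ?s2 = K1 * (cmod (deriv G1 ?z)^2 / 2 * ?e1)
          + K2 * (cmod (deriv G2 ?z)^2 / 2 * ?e2) + Re (E ?z * d^2)"
        by (simp add: E_def hess_def algebra_simps)
      have "cmod (E ?z - E a) \<le> cmod (of_real K1 * (hess G1 ?z - hess G1 a)) + cmod (of_real K2 * (hess G2 ?z - hess G2 a))"
        by (rule order_trans[OF _ norm_triangle_ineq]) (simp add: E_def algebra_simps)
      also have "\<dots> \<le> K1 * (4 * B ^ 3 * exp B / r ^ 3 * (2 * \<eta>)) + K2 * (4 * B ^ 3 * exp B / r ^ 3 * (2 * \<eta>))"
        unfolding norm_mult norm_of_real using K r B zb(2)
        by (intro add_mono mult_mono order_trans[OF hess_lipschitz[OF r hol(1) B bds(1) zb(1)]]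
            order_trans[OF hess_lipschitz[OF r hol(2) B bds(2) zb(1)]] mult_left_mono) auto
      also have "\<dots> = \<eta> * ((8 * (K1 + K2) * B ^ 3 * exp B) / r ^ 3)" by (simp add: algebra_simps add_divide_distrib)
      also have "\<dots> \<le> (\<kappa> * r ^ 3 / (8 * (K1 + K2) * B ^ 3 * exp B)) * ((8 * (K1 + K2) * B ^ 3 * exp B) / r ^ 3)"
        using K B r by (intro mult_right_mono \<eta>(3)) auto
      also have "\<dots> = \<kappa>" using K B r by simp
      finally have "cmod (E ?z - E a) \<le> \<kappa>" .
      moreover have "\<bar>Re ((E ?z - E a) * d^2)\<bar> \<le> cmod (E ?z - E a)"
        using abs_Re_le_cmod[of "(E ?z - E a) * d^2"] d by (simp add: norm_mult norm_power)
      moreover have "Re ((E ?z - E a) * d^2) = Re (E ?z * d^2)" using Ed by (simp add: algebra_simps)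
      ultimately have "Re (E ?z * d^2) \<ge> - \<kappa>" by linarith
      moreover have "K1 * (cmod (deriv G1 ?z)^2 / 2 * ?e1) \<ge> 2 * \<kappa>" by (rule levi[OF inb[OF x]])
      moreover have "K2 * (cmod (deriv G2 ?z)^2 / 2 * ?e2) \<ge> 0" using K by simp
      ultimately show "K1 * ?s1 + K2 * ?s2 \<ge> \<kappa>" unfolding split by linarith
      show "\<rho> ?z \<ge> 0" by (rule pos[OF inb[OF x]])
    qed (use \<eta> in simp)
  qed
  then show ?thesis by simp
qed

section \<open>Branches of the zero set\<close>

definition bipoly :: "(nat \<times> nat \<Rightarrow> complex) \<Rightarrow> (nat \<times> nat) set \<Rightarrow> complex \<Rightarrow> complex \<Rightarrow> complex" where
  "bipoly g I x y = (\<Sum>L\<in>I. g L * x ^ fst L * y ^ snd L)"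

definition bipoly_dy :: "(nat \<times> nat \<Rightarrow> complex) \<Rightarrow> (nat \<times> nat) set \<Rightarrow> complex \<Rightarrow> complex \<Rightarrow> complex" where
  "bipoly_dy g I x y = (\<Sum>L\<in>I. g L * x ^ fst L * (of_nat (snd L) * y ^ (snd L - 1)))"

lemma bipoly_has_derivative:
  "((\<lambda>y. bipoly g I x y) has_field_derivative bipoly_dy g I x y) (at y within S)"
  unfolding bipoly_def bipoly_dy_def
  by (rule derivative_eq_intros refl | simp)+ (simp add: mult_ac)

lemma norm_power_diff_le:
  fixes x y :: complex
  assumes "X \<ge> 1" "cmod x \<le> X" "cmod y \<le> X"
  shows "cmod (x ^ n - y ^ n) \<le> real n * X ^ n * cmod (x - y)"
proof -
  have "cmod (\<Sum>i<n. y^(n - Suc i) * x^i) \<le> (\<Sum>i<n. X ^ n)"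
  proof (rule sum_norm_le)
    fix i assume "i \<in> {..<n}"
    have "cmod (y^(n - Suc i) * x^i) \<le> X ^ (n - Suc i) * X ^ i"
      unfolding norm_mult norm_power using assms by (intro mult_mono power_mono) auto
    also have "\<dots> \<le> X ^ n" unfolding power_add[symmetric]
      using assms \<open>i \<in> {..<n}\<close> by (intro power_increasing) auto
    finally show "cmod (y^(n - Suc i) * x^i) \<le> X ^ n" .
  qed
  then show ?thesis unfolding power_diff_sumr2 norm_mult
    by (simp add: mult.commute mult_left_mono)
qed

lemma norm_monomial_diff_le:
  fixes x y x' y' :: complex
  assumes X: "X \<ge> 1" "cmod x \<le> X" "cmod y \<le> X" "cmod x' \<le> X" "cmod y' \<le> X" and D: "i + j \<le> D"
  shows "cmod (x ^ i * y ^ j - x' ^ i * y' ^ j) \<le> real (i + j) * X ^ D * (cmod (x - x') + cmod (y - y'))"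
proof -
  have "x ^ i * y ^ j - x' ^ i * y' ^ j = (x ^ i - x' ^ i) * y ^ j + x' ^ i * (y ^ j - y' ^ j)"
    by (simp add: algebra_simps)
  also have "cmod \<dots> \<le> (real i * X ^ i * cmod (x - x')) * X ^ j + X ^ i * (real j * X ^ j * cmod (y - y'))"
    using X by (intro order_trans[OF norm_triangle_ineq] add_mono)
      (auto simp: norm_mult norm_power intro!: mult_mono power_mono norm_power_diff_le)
  also have "\<dots> = X ^ (i + j) * (real i * cmod (x - x') + real j * cmod (y - y'))"
    by (simp add: power_add algebra_simps)
  also have "\<dots> \<le> X ^ D * (real (i + j) * (cmod (x - x') + cmod (y - y')))"
    using X(1) D by (intro mult_mono power_increasing) (auto simp: algebra_simps)
  finally show ?thesis by (simp add: mult_ac)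
qed

context
  fixes g :: "nat \<times> nat \<Rightarrow> complex" and I and D :: nat and X :: real
  assumes X: "X \<ge> 1" and D: "\<And>L. L \<in> I \<Longrightarrow> fst L + snd L \<le> D"
begin

lemma bipoly_lipschitz:
  assumes "cmod x \<le> X" "cmod y \<le> X" "cmod x' \<le> X" "cmod y' \<le> X"
  shows "cmod (bipoly g I x y - bipoly g I x' y') \<le> coeff_size g I * X ^ D * (cmod (x - x') + cmod (y - y'))"
proof -
  have "cmod (bipoly g I x y - bipoly g I x' y')
     \<le> (\<Sum>L\<in>I. (cmod (g L) * real (fst L + snd L + 1)^2) * (X ^ D * (cmod (x - x') + cmod (y - y'))))"
    unfolding bipoly_def sum_subtractf[symmetric]
  proof (rule sum_norm_le)
    fix L assume L: "L \<in> I"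
    have "cmod (g L * x ^ fst L * y ^ snd L - g L * x' ^ fst L * y' ^ snd L)
        = cmod (g L) * cmod (x ^ fst L * y ^ snd L - x' ^ fst L * y' ^ snd L)"
      by (simp add: norm_mult[symmetric] algebra_simps)
    also have "\<dots> \<le> cmod (g L) * (real (fst L + snd L) * X ^ D * (cmod (x - x') + cmod (y - y')))"
      by (intro mult_left_mono norm_monomial_diff_le X assms D[OF L]) auto
    also have "\<dots> \<le> cmod (g L) * (real (fst L + snd L + 1)^2 * X ^ D * (cmod (x - x') + cmod (y - y')))"
      using X by (intro mult_left_mono mult_right_mono) (auto simp: power2_eq_square algebra_simps)
    finally show "cmod (g L * x ^ fst L * y ^ snd L - g L * x' ^ fst L * y' ^ snd L)
       \<le> (cmod (g L) * real (fst L + snd L + 1)^2) * (X ^ D * (cmod (x - x') + cmod (y - y')))"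
      by (simp add: mult_ac)
  qed
  then show ?thesis unfolding sum_distrib_right[symmetric] coeff_size_def[symmetric] by (simp add: mult_ac)
qed

lemma bipoly_dy_lipschitz:
  assumes "cmod x \<le> X" "cmod y \<le> X" "cmod x' \<le> X" "cmod y' \<le> X"
  shows "cmod (bipoly_dy g I x y - bipoly_dy g I x' y') \<le> coeff_size g I * X ^ D * (cmod (x - x') + cmod (y - y'))"
proof -
  have "cmod (bipoly_dy g I x y - bipoly_dy g I x' y')
     \<le> (\<Sum>L\<in>I. (cmod (g L) * real (fst L + snd L + 1)^2) * (X ^ D * (cmod (x - x') + cmod (y - y'))))"
    unfolding bipoly_dy_def sum_subtractf[symmetric]
  proof (rule sum_norm_le)
    fix L assume L: "L \<in> I"
    have "cmod (g L * x ^ fst L * (of_nat (snd L) * y ^ (snd L - 1)) - g L * x' ^ fst L * (of_nat (snd L) * y' ^ (snd L - 1)))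
        = cmod (g L * of_nat (snd L) * (x ^ fst L * y ^ (snd L - 1) - x' ^ fst L * y' ^ (snd L - 1)))"
      by (simp add: algebra_simps)
    also have "\<dots> = cmod (g L) * (snd L * cmod (x ^ fst L * y ^ (snd L - 1) - x' ^ fst L * y' ^ (snd L - 1)))"
      by (simp add: norm_mult)
    also have "\<dots> \<le> cmod (g L) * (snd L * (real (fst L + (snd L - 1)) * X ^ D * (cmod (x - x') + cmod (y - y'))))"
      using D[OF L] by (intro mult_left_mono norm_monomial_diff_le X assms) auto
    also have "\<dots> = cmod (g L) * (real (snd L * (fst L + (snd L - 1))) * X ^ D * (cmod (x - x') + cmod (y - y')))"
      by simp
    also have "\<dots> \<le> cmod (g L) * (real ((fst L + snd L + 1) * (fst L + snd L + 1)) * X ^ D * (cmod (x - x') + cmod (y - y')))"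
      using X by (intro mult_left_mono mult_right_mono of_nat_mono mult_le_mono) auto
    finally show "cmod (g L * x ^ fst L * (of_nat (snd L) * y ^ (snd L - 1)) - g L * x' ^ fst L * (of_nat (snd L) * y' ^ (snd L - 1)))
       \<le> (cmod (g L) * real (fst L + snd L + 1)^2) * (X ^ D * (cmod (x - x') + cmod (y - y')))"
      by (simp only: mult_ac power2_eq_square of_nat_mult)
  qed
  then show ?thesis unfolding sum_distrib_right[symmetric] coeff_size_def[symmetric] by (simp add: mult_ac)
qed

end

text \<open>
  The Newton iteration for \<open>y\<close>, with the derivative frozen at \<open>(x1, y1)\<close>, is a contraction of a disc
  around \<open>y1\<close> uniformly for \<open>x\<close> near \<open>x1\<close>, and its iterates are rational in \<open>x\<close>. The explicit radius,
  polynomial in \<open>1 / X\<close>, matters for the growth estimate.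
\<close>

lemma newton_branch:
  assumes X: "X \<ge> 1" and D: "\<And>L. L \<in> I \<Longrightarrow> fst L + snd L \<le> D"
    and \<Lambda>: "\<Lambda> \<ge> 1" "coeff_size g I * (2 * X) ^ D \<le> \<Lambda>"
    and x1: "cmod x1 \<le> X" and y1: "cmod y1 \<le> X" and root: "bipoly g I x1 y1 = 0"
    and simple: "1 / X \<le> cmod (bipoly_dy g I x1 y1)"
  obtains s where "s holomorphic_on ball x1 (1 / (8 * \<Lambda>^2 * X^2))" "s x1 = y1"
    "\<And>x. x \<in> ball x1 (1 / (8 * \<Lambda>^2 * X^2)) \<Longrightarrow> bipoly g I x (s x) = 0"
    "\<And>x. x \<in> ball x1 (1 / (8 * \<Lambda>^2 * X^2)) \<Longrightarrow> cmod (s x - y1) \<le> 1 / (4 * \<Lambda> * X)"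
proof -
  define e where "e = 1 / (4 * \<Lambda> * X)"
  define d where "d = 1 / (8 * \<Lambda>^2 * X^2)"
  define A where "A = bipoly_dy g I x1 y1"
  have LX: "\<Lambda> * X \<ge> 1" using \<Lambda>(1) X by (metis mult_mono mult_1 zero_le_one order_trans)
  \<comment> \<open>\<open>e\<close> is the radius of the disc for \<open>y\<close> and \<open>d\<close> that of the disc for \<open>x\<close>.\<close>
  have e: "e > 0" "e \<le> 1" using \<Lambda> X LX by (auto simp: e_def field_simps)
  have d: "d > 0" "d \<le> e" "\<Lambda> * d * X = e / 2"
  proof -
    show "d > 0" using \<Lambda> X by (simp add: d_def)
    show eq: "\<Lambda> * d * X = e / 2" using \<Lambda> X by (simp add: d_def e_def power2_eq_square)
    have "1 * d \<le> (\<Lambda> * X) * d" using LX \<open>d > 0\<close> by (intro mult_right_mono) auto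
    then show "d \<le> e" using eq e by (simp add: mult_ac)
  qed
  have A: "cmod A \<ge> 1 / X" "A \<noteq> 0" using simple X by (auto simp: A_def)
  have iA: "1 / cmod A \<le> X" using A X by (simp add: field_simps)
  define T where "T x y = y - bipoly g I x y / A" for x y
  have X2: "2 * X \<ge> 1" using X by simp
  have bx: "cmod x \<le> 2 * X" if "x \<in> ball x1 d" for x
  proof -
    have "cmod x \<le> cmod x1 + cmod (x - x1)" by (metis norm_triangle_sub add.commute)
    then show ?thesis using that x1 d e X by (simp add: dist_norm norm_minus_commute)
  qed
  have by1: "cmod y \<le> 2 * X" if "y \<in> cball y1 e" for y
  proof -
    have "cmod y \<le> cmod y1 + cmod (y - y1)" by (metis norm_triangle_sub add.commute)
    then show ?thesis using that y1 e X by (simp add: dist_norm norm_minus_commute)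
  qed
  have y1c: "y1 \<in> cball y1 e" using e by simp
  have x1b: "x1 \<in> ball x1 d" using d by simp
  have contr: "cmod (T x y - T x y') \<le> 1 / 2 * cmod (y - y')"
    if x: "x \<in> ball x1 d" and y: "y \<in> cball y1 e" "y' \<in> cball y1 e" for x y y'
  proof (rule field_differentiable_bound[OF convex_cball _ _ y])
    fix w assume w: "w \<in> cball y1 e"
    show "(T x has_field_derivative (1 - bipoly_dy g I x w / A)) (at w within cball y1 e)"
      unfolding T_def[abs_def] by (intro DERIV_diff DERIV_ident DERIV_cdivide bipoly_has_derivative)
    have "cmod (bipoly_dy g I x1 y1 - bipoly_dy g I x w) \<le> coeff_size g I * (2 * X) ^ D * (cmod (x1 - x) + cmod (y1 - w))"
      by (rule bipoly_dy_lipschitz[OF X2 D]) (use bx[OF x] by1[OF w] bx[OF x1b] by1[OF y1c] in auto)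
    also have "\<dots> \<le> \<Lambda> * (e + e)"
      using \<Lambda> x w d by (intro mult_mono add_mono) (auto simp: dist_norm)
    also have "\<dots> = 1 / (2 * X)" using \<Lambda> X by (simp add: e_def)
    finally have "cmod (A - bipoly_dy g I x w) \<le> 1 / (2 * X)" by (simp add: A_def)
    then have "cmod (A - bipoly_dy g I x w) * (1 / cmod A) \<le> 1 / (2 * X) * X"
      using iA X by (intro mult_mono) auto
    then show "cmod (1 - bipoly_dy g I x w / A) \<le> 1 / 2"
      using A(2) X by (simp add: diff_divide_distrib[symmetric] norm_divide divide_simps flip: diff_divide_eq_iff)
  qed
  have start: "cmod (T x y1 - y1) \<le> e / 2" if x: "x \<in> ball x1 d" for x
  proof -
    have "cmod (bipoly g I x y1 - bipoly g I x1 y1) \<le> coeff_size g I * (2 * X) ^ D * (cmod (x - x1) + cmod (y1 - y1))"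
      by (rule bipoly_lipschitz[OF X2 D]) (use bx[OF x] bx[OF x1b] by1[OF y1c] in auto)
    also have "\<dots> \<le> \<Lambda> * d"
      using \<Lambda> x by (intro mult_mono) (auto simp: dist_norm norm_minus_commute)
    finally have "cmod (bipoly g I x y1) * (1 / cmod A) \<le> (\<Lambda> * d) * X"
      unfolding root using iA \<Lambda> d by (intro mult_mono) auto
    then show ?thesis using d(3) by (simp add: T_def norm_divide)
  qed
  have maps: "T x y \<in> cball y1 e" if x: "x \<in> ball x1 d" and y: "y \<in> cball y1 e" for x y
  proof -
    have "cmod (T x y - y1) \<le> cmod (T x y - T x y1) + cmod (T x y1 - y1)"
      using norm_triangle_ineq[of "T x y - T x y1" "T x y1 - y1"] by simp
    also have "\<dots> \<le> 1 / 2 * cmod (y - y1) + e / 2" by (intro add_mono contr[OF x y y1c] start[OF x])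
    also have "\<dots> \<le> e" using y by (simp add: dist_norm norm_minus_commute)
    finally show ?thesis by (simp add: dist_norm norm_minus_commute)
  qed
  define w where "w n x = (T x ^^ n) y1" for n x
  have w_Suc: "w (Suc n) x = T x (w n x)" for n x by (simp add: w_def)
  have w0: "w 0 x = y1" for x by (simp add: w_def)
  have w_in: "w n x \<in> cball y1 e" if "x \<in> ball x1 d" for n x
    by (induction n) (use y1c maps[OF that] in \<open>auto simp only: w0 w_Suc\<close>)
  have w_hol: "w n holomorphic_on ball x1 d" for n
  proof (induction n)
    case 0
    then show ?case unfolding w0[abs_def] by simp
  next
    case (Suc n)
    then show ?case unfolding w_Suc[abs_def] T_def bipoly_def using A(2) by (intro holomorphic_intros) auto
  qed
  have w_step: "cmod (w (Suc n) x - w n x) \<le> (1 / 2) ^ n * (e / 2)" if x: "x \<in> ball x1 d" for n x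
  proof (induction n)
    case 0
    then show ?case using start[OF x] by (simp add: w_Suc w0)
  next
    case (Suc n)
    have "cmod (w (Suc (Suc n)) x - w (Suc n) x) \<le> 1 / 2 * cmod (w (Suc n) x - w n x)"
      unfolding w_Suc[of "Suc n"] w_Suc[of n x] using contr[OF x maps[OF x w_in[OF x]] w_in[OF x]] by simp
    also have "\<dots> \<le> 1 / 2 * ((1 / 2) ^ n * (e / 2))" using Suc by (intro mult_left_mono) auto
    finally show ?case by simp
  qed
  define s where "s x = y1 + (\<Sum>n. w (Suc n) x - w n x)" for x
  have tele: "(\<Sum>i<n. w (Suc i) x - w i x) = w n x - y1" for n x
    using sum_lessThan_telescope[of "\<lambda>i. w i x" n] by (simp add: w0)
  have "uniform_limit (ball x1 d) (\<lambda>n x. \<Sum>i<n. w (Suc i) x - w i x) (\<lambda>x. \<Sum>n. w (Suc n) x - w n x) sequentially"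
    by (rule Weierstrass_m_test[where M = "\<lambda>n. (1 / 2) ^ n * (e / 2)", OF w_step])
       (auto intro!: summable_mult2 summable_geometric)
  then have "uniform_limit (ball x1 d) (\<lambda>n x. y1 + (\<Sum>i<n. w (Suc i) x - w i x))
      (\<lambda>x. y1 + (\<Sum>n. w (Suc n) x - w n x)) sequentially"
    by (intro uniform_limit_intros)
  then have ul: "uniform_limit (ball x1 d) w s sequentially" by (simp add: tele s_def[abs_def])
  have lim: "(\<lambda>n. w n x) \<longlonglongrightarrow> s x" if "x \<in> ball x1 d" for x
    using tendsto_uniform_limitI[OF ul that] .
  have s_in: "s x \<in> cball y1 e" if x: "x \<in> ball x1 d" for x
    using closed_sequentially[OF closed_cball _ lim[OF x]] w_in[OF x] by blast
  have s_root: "bipoly g I x (s x) = 0" if x: "x \<in> ball x1 d" for x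
  proof -
    have "(\<lambda>n. T x (w n x)) \<longlonglongrightarrow> T x (s x)"
      unfolding T_def bipoly_def using A(2) by (intro tendsto_intros lim[OF x]) auto
    then have "(\<lambda>n. w (Suc n) x) \<longlonglongrightarrow> T x (s x)" by (simp add: w_Suc)
    then have "T x (s x) = s x" using LIMSEQ_unique LIMSEQ_Suc[OF lim[OF x]] by blast
    then show ?thesis using A(2) by (simp add: T_def)
  qed
  have "s holomorphic_on ball x1 d"
  proof (rule holomorphic_uniform_sequence[OF open_ball w_hol])
    fix x assume "x \<in> ball x1 d"
    then obtain r where "r > 0" "cball x r \<subseteq> ball x1 d" using open_contains_cball open_ball by metis
    then show "\<exists>r. 0 < r \<and> cball x r \<subseteq> ball x1 d \<and> uniform_limit (cball x r) w s sequentially"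
      using uniform_limit_on_subset[OF ul] by blast
  qed
  moreover have "s x1 = y1"
  proof -
    have "w n x1 = y1" for n by (induction n) (simp_all add: w0 w_Suc T_def root)
    then show ?thesis using lim[OF x1b] by (simp add: LIMSEQ_const_iff)
  qed
  ultimately show ?thesis
    using that[of s] s_root s_in unfolding d_def e_def by (simp add: dist_norm norm_minus_commute)
qed

lemma lin_pow_scale: "lin_pow (\<sigma> * fst c, \<sigma> * snd c) n b i j = \<sigma> ^ n * lin_pow c n b i j"
proof -
  have "(\<sigma> * fst c) ^ k * (\<sigma> * snd c) ^ (n - k) = \<sigma> ^ n * (fst c ^ k * snd c ^ (n - k))" if "k \<le> n" for k
    using that by (simp add: power_mult_distrib mult_ac flip: power_add)
  then show ?thesis
    unfolding lin_pow_def sum_distrib_left by (intro sum.cong refl) (simp add: mult.assoc)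
qed

lemma dual_le_scale:
  assumes "dual_le p c t" shows "dual_le p (\<sigma> * fst c, \<sigma> * snd c) (cmod \<sigma> * t)"
  unfolding dual_le_def
proof (intro allI impI)
  fix z assume "egauge p z \<le> 1"
  then have "cmod \<sigma> * (cmod (fst c) * cmod (fst z) + cmod (snd c) * cmod (snd z)) \<le> cmod \<sigma> * t"
    using assms by (intro mult_left_mono) (auto simp: dual_le_def)
  then show "cmod (fst (\<sigma> * fst c, \<sigma> * snd c)) * cmod (fst z) + cmod (snd (\<sigma> * fst c, \<sigma> * snd c)) * cmod (snd z) \<le> cmod \<sigma> * t"
    by (simp add: norm_mult algebra_simps)
qed

text \<open>
  Along the ray through \<open>c\<close> the transform is a power series in the scaling factor.
\<close>

lemma fantappie_ray_holomorphic:
  assumes p: "p \<ge> 1" and c: "dual_le p c t" and t: "t > 0" and b: "growth p C b" and C: "C \<ge> 0"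
  shows "(\<lambda>\<sigma>. fantappie (\<sigma> * fst c, \<sigma> * snd c) b i j) holomorphic_on ball 0 (1 / t)"
proof (rule power_series_holomorphic[where a = "\<lambda>n. lin_pow c n b i j"])
  fix \<sigma> :: complex assume "\<sigma> \<in> ball 0 (1 / t)"
  then have "cmod \<sigma> * t < 1" using t by (simp add: field_simps)
  from summable_sums[OF lin_pow_summable[OF p dual_le_scale[OF c] this b C, of i j]]
  show "(\<lambda>n. lin_pow c n b i j * (\<sigma> - 0) ^ n) sums fantappie (\<sigma> * fst c, \<sigma> * snd c) b i j"
    unfolding fantappie_def by (simp add: lin_pow_scale mult.commute)
qed

text \<open>
  Near \<open>x0\<close> one can keep the form that supports at \<open>(x0, s x0)\<close>, rescaled so as to take the value \<open>1\<close>
  at \<open>(x, s x)\<close>. Since the value is independent of the form, this computes \<open>branch_val\<close>, and it depends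
  holomorphically on \<open>x\<close>, which the supporting form does not.
\<close>

lemma branch_val_holomorphic:
  assumes p: "p \<ge> 1" and b: "growth p C b" and C: "C \<ge> 0" and I: "finite I"
    and ann: "\<And>k l. (\<Sum>L\<in>I. g L * b (k + fst L) (l + snd L)) = 0"
    and U: "open U" and s: "s holomorphic_on U"
    and root: "\<And>x. x \<in> U \<Longrightarrow> bipoly g I x (s x) = 0"
    and N: "\<And>x. x \<in> U \<Longrightarrow> egauge p (x, s x) > 1"
  shows "(\<lambda>x. branch_val p g I b (x, s x)) holomorphic_on U"
  unfolding holomorphic_on_def
proof
  fix x0 assume x0: "x0 \<in> U"
  define c t where "c = support_dual p (x0, s x0)" and "t = egauge p (x0, s x0) powr (- (1 / (2 * p)))"
  have c: "dual_le p c t" "fst c * x0 + snd c * s x0 = 1"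
    using support_dual_le[OF p, of "(x0, s x0)"] support_dual_pairing[of p "(x0, s x0)"] N[OF x0]
    by (auto simp: c_def t_def)
  have t: "0 < t" "t < 1" using N[OF x0] support_dual_gap(1)[OF p N[OF x0]] by (auto simp: t_def)
  \<comment> \<open>The value at \<open>(x, s x)\<close> of the form supporting at \<open>(x0, s x0)\<close>; division by it restores the normalisation.\<close>
  define pr where "pr x = fst c * x + snd c * s x" for x
  have prh: "pr holomorphic_on U" unfolding pr_def by (intro holomorphic_intros s)
  have "open (U \<inter> (\<lambda>x. cmod (pr x)) -` {t<..})"
    using holomorphic_on_imp_continuous_on[OF prh] by (intro continuous_open_preimage continuous_on_norm U) auto
  define V where "V = U \<inter> (\<lambda>x. cmod (pr x)) -` {t<..}"
  have V: "open V" "x0 \<in> V" "V \<subseteq> U"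
    using \<open>open (U \<inter> (\<lambda>x. cmod (pr x)) -` {t<..})\<close> c(2) t x0 by (auto simp: V_def pr_def)
  have prV: "cmod (pr x) > t" "pr x \<noteq> 0" if "x \<in> V" for x using that t by (auto simp: V_def)
  define F where "F x = (\<lambda>i j. fantappie (1 / pr x * fst c, 1 / pr x * snd c) b i j)" for x
  have inv: "(\<lambda>x. 1 / pr x) holomorphic_on V"
    by (intro holomorphic_intros holomorphic_on_subset[OF prh V(3)]) (use prV in auto)
  have Fh: "(\<lambda>x. F x i j) holomorphic_on V" for i j
  proof -
    have "(\<lambda>\<sigma>. fantappie (\<sigma> * fst c, \<sigma> * snd c) b i j) \<circ> (\<lambda>x. 1 / pr x) holomorphic_on V"
    proof (rule holomorphic_on_compose_gen[OF inv fantappie_ray_holomorphic[OF p c(1) t(1) b C]])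
      show "(\<lambda>x. 1 / pr x) ` V \<subseteq> ball 0 (1 / t)"
        using prV t by (auto simp: norm_divide divide_simps)
    qed
    then show ?thesis by (simp add: F_def o_def)
  qed
  have eq: "branch_val p g I b (x, s x)
      = 1 / pr x * snd c * divdiff1 g I x (F x) 0 0 - 1 / pr x * fst c * divdiff2 g I (x, s x) (F x) 0 0"
    if x: "x \<in> V" for x
  proof -
    have "cmod (1 / pr x) * t < 1" using prV[OF x] t by (simp add: norm_divide divide_simps)
    moreover have "1 / pr x * fst c * x + 1 / pr x * snd c * s x = 1 / pr x * pr x"
      unfolding pr_def by (simp only: distrib_left mult.assoc)
    ultimately have "branch_sol g I (1 / pr x * fst c, 1 / pr x * snd c) (x, s x)
         (fantappie (1 / pr x * fst c, 1 / pr x * snd c) b) 0 0 = branch_val p g I b (x, s x)"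
      using prV[OF x] root[of x] N[of x] x V(3)
      by (intro branch_val_eqI[OF p b C I ann _ _ dual_le_scale[OF c(1)]]) (auto simp: bipoly_def)
    then show ?thesis by (simp add: branch_sol_def F_def)
  qed
  have "(\<lambda>x. 1 / pr x * snd c * divdiff1 g I x (F x) 0 0 - 1 / pr x * fst c * divdiff2 g I (x, s x) (F x) 0 0) holomorphic_on V"
    unfolding divdiff1_def divdiff2_def fst_conv snd_conv
    by (intro holomorphic_on_diff holomorphic_on_mult inv holomorphic_on_const holomorphic_on_sum
        holomorphic_on_power holomorphic_on_ident Fh holomorphic_on_subset[OF s V(3)])
  then have "(\<lambda>x. branch_val p g I b (x, s x)) holomorphic_on V"
    by (rule holomorphic_transform) (use eq in auto)
  then show "(\<lambda>x. branch_val p g I b (x, s x)) field_differentiable (at x0 within U)"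
    using V by (meson field_differentiable_at_within holomorphic_on_imp_differentiable_at)
qed

text \<open>
  A quantitative form of: \<open>(x, y)\<close> is a simple zero off the coordinate axes, and all zeros nearby are
  outside the closed ellipsoid. A single number \<open>X\<close> controls everything, so that estimates only have to
  be polynomial in \<open>X\<close>.
\<close>

definition tame_point :: "real \<Rightarrow> (nat \<times> nat \<Rightarrow> complex) \<Rightarrow> (nat \<times> nat) set \<Rightarrow> real \<Rightarrow> complex \<Rightarrow> complex \<Rightarrow> bool" where
  "tame_point p g I X x y \<longleftrightarrow>
     X \<ge> 1 \<and> cmod x \<le> X \<and> 1 / X \<le> cmod x \<and> cmod y \<le> X \<and> 1 / X \<le> cmod y
     \<and> bipoly g I x y = 0 \<and> 1 / X \<le> cmod (bipoly_dy g I x y)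
     \<and> (\<forall>x'\<in>ball x (1 / X). \<forall>y'. bipoly g I x' y' = 0 \<longrightarrow> egauge p (x', y') > 1)"

text \<open>
  On a disc of radius polynomial in \<open>1 / X\<close> the zero \<open>(x, y)\<close> extends to a branch, along which
  \<open>egauge p\<close> is a sum of two functions \<open>K exp (Re G)\<close>. The branch values are bounded by the inverse
  cube of the gap, and \<open>holomorphic_bound_off_level_set\<close> turns this into a bound at the centre that does
  not see the gap.
\<close>

lemma branch_val_poly_bound:
  assumes p: "p \<ge> 1" and I: "finite I" and D: "\<And>L. L \<in> I \<Longrightarrow> fst L + snd L \<le> D"
  shows "\<exists>A k. A \<ge> 0 \<and> (\<forall>X x y b C. tame_point p g I X x y \<longrightarrow> growth p C b \<longrightarrow> C \<ge> 0 \<longrightarrow>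
       (\<forall>k l. (\<Sum>L\<in>I. g L * b (k + fst L) (l + snd L)) = 0) \<longrightarrow>
       cmod (branch_val p g I b (x, y)) \<le> A * C * X ^ k)"
proof -
  define P where "P = nat \<lceil>2 * p\<rceil>"
  have P: "2 * p \<le> real P" unfolding P_def by (rule real_nat_ceiling_ge)
  define a0 where "a0 = coeff_size g I + 1"
  have a0: "a0 \<ge> 1" by (simp add: a0_def coeff_size_nonneg)
  define B where "B = 2 * p"
  have B: "B \<ge> 2" using p by (simp add: B_def)
  define c1 where "c1 = 8 * a0^2 + 1024 * (B ^ 3 * exp B) * a0 ^ 6"
  define m where "m = 2 * P + 6 * D + 6"
  define A where "A = 8 * 3 ^ 18 * (8 * a0 * (4 * p) ^ 3) * c1 ^ 6 * 2 ^ (D + 6 * P + 6 * m)"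
  have c1: "c1 \<ge> 0" using B a0 by (simp add: c1_def)
  have A: "A \<ge> 0" using p a0 c1 by (simp add: A_def)
  have "cmod (branch_val p g I b (x1, y1)) \<le> A * C * X ^ (D + 6 * P + 6 * m)"
    if tame: "tame_point p g I X x1 y1" and b: "growth p C b" and C: "C \<ge> 0"
      and ann: "\<And>k l. (\<Sum>L\<in>I. g L * b (k + fst L) (l + snd L)) = 0"
    for X x1 y1 b C
  proof -
    have X: "X \<ge> 1" and x1: "cmod x1 \<le> X" "1 / X \<le> cmod x1" and y1: "cmod y1 \<le> X" "1 / X \<le> cmod y1"
      and root: "bipoly g I x1 y1 = 0" and simple: "1 / X \<le> cmod (bipoly_dy g I x1 y1)"
      and N: "\<And>x y. x \<in> ball x1 (1 / X) \<Longrightarrow> bipoly g I x y = 0 \<Longrightarrow> egauge p (x, y) > 1"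
      using tame unfolding tame_point_def by blast+
    define Z where "Z = 2 * X"
    have Z: "Z \<ge> 2" using X by (simp add: Z_def)
    define \<Lambda> where "\<Lambda> = a0 * Z ^ D"
    have ZD: "Z ^ n \<ge> 1" for n using Z by (intro one_le_power) auto
    have \<Lambda>: "\<Lambda> \<ge> 1" "coeff_size g I * (2 * X) ^ D \<le> \<Lambda>"
      using a0 X ZD[of D] mult_mono[of 1 a0 1 "Z ^ D"] by (auto simp: \<Lambda>_def a0_def Z_def intro!: mult_right_mono)
    obtain s where s: "s holomorphic_on ball x1 (1 / (8 * \<Lambda>^2 * X^2))" "s x1 = y1"
      "\<And>x. x \<in> ball x1 (1 / (8 * \<Lambda>^2 * X^2)) \<Longrightarrow> bipoly g I x (s x) = 0"
      "\<And>x. x \<in> ball x1 (1 / (8 * \<Lambda>^2 * X^2)) \<Longrightarrow> cmod (s x - y1) \<le> 1 / (4 * \<Lambda> * X)"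
      using newton_branch[OF X D \<Lambda> x1(1) y1(1) root simple] by blast
    define r where "r = 1 / (16 * \<Lambda>^2 * X^2)"
    have r2: "1 / (8 * \<Lambda>^2 * X^2) = 2 * r" by (simp add: r_def)
    have r: "r > 0" using \<Lambda> X by (simp add: r_def)
    have LX: "1 \<le> \<Lambda>^2 * X" "1 \<le> \<Lambda> * 1" using \<Lambda>(1) X mult_mono[of 1 "\<Lambda>^2" 1 X] by auto
    have rX: "2 * r \<le> 1 / (4 * X)"
    proof -
      have "2 * r = (1 / (4 * X)) * (1 / (2 * (\<Lambda>^2 * X)))" by (simp add: r_def power2_eq_square)
      also have "\<dots> \<le> (1 / (4 * X)) * 1" using LX X by (intro mult_left_mono) auto
      finally show ?thesis by simp
    qed
    have eX: "1 / (4 * \<Lambda> * X) \<le> 1 / (4 * X)"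
      using \<Lambda> X by (intro divide_left_mono) auto
    note s' = s[unfolded r2]
    have X4: "1 / (4 * X) < 1 / 2 * (1 / X)" "1 / (4 * X) \<le> X" "1 / (4 * X) \<le> 1 / X" "1 / X > 0"
    proof -
      have "1 / (4 * X) \<le> 1" using X by simp
      then show "1 / (4 * X) \<le> X" using X by linarith
    qed (use X in \<open>simp_all add: field_simps\<close>)
    have x0: "x1 \<noteq> 0" "y1 \<noteq> 0" using x1(2) y1(2) X4(4) by auto
    have near: "cmod (x - x1) < 1 / 2 * cmod x1" "cmod (s x - y1) < 1 / 2 * cmod y1" "cmod x \<le> Z" "cmod (s x) \<le> Z"
        "x \<in> ball x1 (1 / X)"
      if x: "x \<in> ball x1 (2 * r)" for x
    proof -
      have 1: "cmod (x - x1) \<le> 1 / (4 * X)" using x rX by (simp add: dist_norm norm_minus_commute)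
      have 2: "cmod (s x - y1) \<le> 1 / (4 * X)" using s'(4)[OF x] eX by linarith
      show "cmod (x - x1) < 1 / 2 * cmod x1" "cmod (s x - y1) < 1 / 2 * cmod y1"
        using 1 2 X4(1) x1(2) y1(2) by linarith+
      show "cmod x \<le> Z" "cmod (s x) \<le> Z"
        using norm_triangle_ineq[of x1 "x - x1"] norm_triangle_ineq[of y1 "s x - y1"] 1 2 x1 y1 X4(2)
        by (auto simp: Z_def)
      show "x \<in> ball x1 (1 / X)" using 1 X4 by (simp add: dist_norm norm_minus_commute field_simps)
    qed
    have gg: "egauge p (x, s x) > 1" if "x \<in> ball x1 (2 * r)" for x
      using N[OF near(5)[OF that] s'(3)[OF that]] .
    \<comment> \<open>A logarithm of \<open>(u / w)\<^bsup>2p\<^esup>\<close>, so that \<open>\<bar>u\<bar>\<^bsup>2p\<^esup> = \<bar>w\<bar>\<^bsup>2p\<^esup> exp (Re G)\<close>.\<close>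
    define G where "G u w z = of_real (2 * p) * Ln (u z / w)" for u :: "complex \<Rightarrow> complex" and w z
    have ratio: "cmod (u / w - 1) < 1 / 2" if "cmod (u - w) < 1 / 2 * cmod w" "w \<noteq> 0" for u w :: complex
    proof -
      have "u / w - 1 = (u - w) / w" using that by (simp add: field_simps)
      then show ?thesis using that by (simp add: norm_divide divide_simps)
    qed
    have half: "z \<notin> \<real>\<^sub>\<le>\<^sub>0" "z \<noteq> 0" if "cmod (z - 1) < 1 / 2" for z :: complex
    proof -
      have "\<bar>Re z - 1\<bar> < 1 / 2" using that abs_Re_le_cmod[of "z - 1"] by simp
      then show "z \<notin> \<real>\<^sub>\<le>\<^sub>0" "z \<noteq> 0" by (auto simp: complex_nonpos_Reals_iff)
    qed
    have G_hol: "G u w holomorphic_on ball x1 (2 * r)"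
      if "u holomorphic_on ball x1 (2 * r)" "w \<noteq> 0" "\<And>x. x \<in> ball x1 (2 * r) \<Longrightarrow> cmod (u x - w) < 1 / 2 * cmod w" for u w
      unfolding G_def[abs_def]
      by (intro holomorphic_intros that half(1)[OF ratio]) (use that in auto)
    have G_bd: "cmod (G u w x) \<le> B" if "cmod (u x - w) < 1 / 2 * cmod w" "w \<noteq> 0" for u w x
    proof -
      have "cmod (Ln (1 + (u x / w - 1))) \<le> 2 * cmod (u x / w - 1)" by (rule norm_Ln_le[OF ratio[OF that]])
      also have "\<dots> \<le> 1" using ratio[OF that] by simp
      finally show ?thesis using p by (simp add: G_def B_def norm_mult)
    qed
    have G_exp: "cmod w powr (2 * p) * exp (Re (G u w x)) = cmod (u x) powr (2 * p)"
      if "cmod (u x - w) < 1 / 2 * cmod w" "w \<noteq> 0" for u w x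
    proof -
      have nz: "u x / w \<noteq> 0" by (rule half(2)[OF ratio[OF that]])
      then have "exp (Re (G u w x)) = (cmod (u x) / cmod w) powr (2 * p)"
        by (simp add: G_def powr_def norm_divide)
      then show ?thesis using that by (simp add: powr_divide)
    qed
    define K1 K2 where "K1 = cmod x1 powr (2 * p)" and "K2 = cmod y1 powr (2 * p)"
    have K: "K1 > 0" "K2 > 0" using x0 by (auto simp: K1_def K2_def)
    have powP: "u powr (2 * p) \<le> Z ^ P" if "0 \<le> u" "u \<le> Z" for u
    proof -
      have "u powr (2 * p) \<le> Z powr (2 * p)" using that p by (intro powr_mono2) auto
      also have "\<dots> \<le> Z powr (real P)" using Z P by (intro powr_mono) auto
      finally show ?thesis using Z by (simp add: powr_realpow)
    qed
    have K12: "K1 + K2 \<le> 2 * Z ^ P"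
      using powP[of "cmod x1"] powP[of "cmod y1"] x1 y1 X unfolding K1_def K2_def Z_def by simp
    \<comment> \<open>Half a lower bound for the direction-independent part of the second derivative of \<open>\<bar>x\<bar>\<^bsup>2p\<^esup>\<close>, as \<open>\<bar>x\<bar> \<ge> 1 / Z\<close> on the disc.\<close>
    define \<kappa> where "\<kappa> = 1 / Z ^ P"
    have \<kappa>: "\<kappa> > 0" using Z by (simp add: \<kappa>_def)
    define C' where "C' = 8 * C * coeff_size g I * Z ^ D * (2 * p * (2 * Z ^ P)) ^ 3"
    define h where "h x = branch_val p g I b (x, s x)" for x
    have eqg: "K1 * exp (Re (G (\<lambda>x. x) x1 x)) + K2 * exp (Re (G s y1 x)) = egauge p (x, s x)"
      if "x \<in> ball x1 (2 * r)" for x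
      using G_exp[of "\<lambda>x. x" x x1] G_exp[of s x y1] near(1,2)[OF that] x0
      by (simp add: K1_def K2_def egauge_def)
    have bound: "cmod (h x1) \<le> 8 * 3 ^ 18 * C' / (\<kappa> ^ 3 *
         (min (r / 2) (\<kappa> * r ^ 3 / (8 * (K1 + K2) * B ^ 3 * exp B))) ^ 6)"
    proof (rule holomorphic_bound_off_level_set[OF r K B \<kappa>, where ?G1.0 = "G (\<lambda>x. x) x1" and ?G2.0 = "G s y1" and a = x1 and h = h and C = C'])
      show "G (\<lambda>x. x) x1 holomorphic_on ball x1 (2 * r)"
        by (rule G_hol) (use x0 near in auto)
      show "G s y1 holomorphic_on ball x1 (2 * r)"
        by (rule G_hol[OF s'(1)]) (use x0 near in auto)
      show "h holomorphic_on ball x1 (2 * r)"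
        unfolding h_def using s'(1,3) gg by (intro branch_val_holomorphic[OF p b C I ann open_ball]) auto
      fix z assume z: "z \<in> ball x1 (2 * r)"
      show "cmod (G (\<lambda>x. x) x1 z) \<le> B" "cmod (G s y1 z) \<le> B"
        using G_bd[of "\<lambda>x. x" z x1] G_bd[of s z y1] near[OF z] x0 by auto
      have z0: "z \<noteq> 0" using near(1)[OF z] x0 by (auto simp: norm_minus_commute)
      have dG: "deriv (G (\<lambda>x. x) x1) z = of_real (2 * p) / z"
      proof (rule DERIV_imp_deriv)
        show "(G (\<lambda>x. x) x1 has_field_derivative of_real (2 * p) / z) (at z)"
          unfolding G_def[abs_def] using half(1)[OF ratio[OF near(1)[OF z] x0(1)]] x0 z0
          by (auto intro!: derivative_eq_intros simp: field_simps)
      qed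
      have "K1 * (cmod (deriv (G (\<lambda>x. x) x1) z)^2 / 2 * exp (Re (G (\<lambda>x. x) x1 z)))
         = (2 * p / cmod z)^2 / 2 * cmod z powr (2 * p)"
        using G_exp[of "\<lambda>x. x" z x1, symmetric] near(1)[OF z] x0 p
        by (simp add: dG K1_def norm_divide mult_ac)
      also have "\<dots> = 2 * (p^2 * (cmod z powr (2 * p) / (cmod z)^2))" by (simp add: power2_eq_square)
      also have "cmod z powr (2 * p) / (cmod z)^2 = cmod z powr (2 * p - 2)"
        using z0 by (simp add: powr_diff powr_numeral)
      also have "2 * \<kappa> \<le> 2 * (p^2 * (cmod z powr (2 * p - 2)))"
      proof -
        have "1 / Z \<le> cmod z"
        proof -
          have "cmod x1 \<le> cmod z + cmod (z - x1)" using norm_triangle_ineq[of z "x1 - z"] by (simp add: norm_minus_commute)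
          then have "1 / 2 * (1 / X) \<le> cmod z" using near(1)[OF z] x1(2) by linarith
          then show ?thesis by (simp add: Z_def)
        qed
        then have "(1 / Z) powr (2 * p - 2) \<le> cmod z powr (2 * p - 2)"
          using Z p by (intro powr_mono2) auto
        moreover have "(1 / Z) powr (real P) \<le> (1 / Z) powr (2 * p - 2)"
          using Z P by (intro powr_mono') auto
        ultimately have "\<kappa> \<le> cmod z powr (2 * p - 2)"
          using Z by (simp add: \<kappa>_def powr_realpow power_divide)
        moreover have "1 \<le> p^2" using p by simp
        ultimately show ?thesis using \<kappa> mult_mono[of 1 "p^2" \<kappa> "cmod z powr (2 * p - 2)"] by simp
      qed
      finally show "2 * \<kappa> \<le> K1 * (cmod (deriv (G (\<lambda>x. x) x1) z)^2 / 2 * exp (Re (G (\<lambda>x. x) x1 z)))" .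
      show "0 \<le> K1 * exp (Re (G (\<lambda>x. x) x1 z)) + K2 * exp (Re (G s y1 z)) - 1"
        unfolding eqg[OF z] using gg[OF z] by simp
      let ?N = "egauge p (z, s z)"
      have N1: "?N > 1" by (rule gg[OF z])
      have NZ: "?N \<le> 2 * Z ^ P"
        using powP[of "cmod z"] powP[of "cmod (s z)"] near[OF z] by (simp add: egauge_def)
      have hz: "cmod (h z) \<le> 8 * C * coeff_size g I * Z ^ D * (2 * p * ?N / (?N - 1)) ^ 3"
        unfolding h_def by (rule branch_val_bound[OF p b C N1 _ _ _ D]) (use Z near[OF z] in auto)
      have "cmod (h z) * (?N - 1) ^ 3 \<le> (8 * C * coeff_size g I * Z ^ D * (2 * p * ?N / (?N - 1)) ^ 3) * (?N - 1) ^ 3"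
        using N1 by (intro mult_right_mono hz) auto
      also have "\<dots> = 8 * C * coeff_size g I * Z ^ D * (2 * p * ?N) ^ 3"
        using N1 by (simp add: power_divide)
      also have "\<dots> \<le> C'"
        unfolding C'_def using C coeff_size_nonneg[of g I] Z N1 NZ p
        by (intro mult_left_mono power_mono) auto
      finally show "cmod (h z) * (K1 * exp (Re (G (\<lambda>x. x) x1 z)) + K2 * exp (Re (G s y1 z)) - 1) ^ 3 \<le> C'"
        unfolding eqg[OF z] .
    qed
    define \<eta> where "\<eta> = min (r / 2) (\<kappa> * r ^ 3 / (8 * (K1 + K2) * B ^ 3 * exp B))"
    have \<eta>0: "\<eta> > 0" using r \<kappa> K B by (simp add: \<eta>_def)
    have rZ: "1 / r = 4 * a0^2 * Z ^ (2 * D + 2)"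
    proof -
      have "1 / r = 16 * \<Lambda>^2 * X^2" by (simp add: r_def)
      moreover have "\<Lambda>^2 = a0^2 * Z ^ (2 * D)"
        unfolding \<Lambda>_def power_mult_distrib power_mult[symmetric] by (simp add: mult.commute)
      moreover have "X^2 = Z^2 / 4" by (simp add: Z_def power_mult_distrib)
      ultimately show ?thesis by (simp add: power_add power2_eq_square)
    qed
    have "1 / \<eta> \<le> 2 * (1 / r) + (8 * (K1 + K2) * B ^ 3 * exp B) * (1 / \<kappa>) * (1 / r) ^ 3"
    proof -
      have "1 / \<eta> = 1 / (r / 2) \<or> 1 / \<eta> = 1 / (\<kappa> * r ^ 3 / (8 * (K1 + K2) * B ^ 3 * exp B))"
        by (auto simp: \<eta>_def min_def)
      moreover have "0 \<le> 2 * (1 / r)" "0 \<le> (8 * (K1 + K2) * B ^ 3 * exp B) * (1 / \<kappa>) * (1 / r) ^ 3"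
        using r K B \<kappa> by auto
      moreover have "1 / (r / 2) = 2 * (1 / r)"
        "1 / (\<kappa> * r ^ 3 / (8 * (K1 + K2) * B ^ 3 * exp B)) = (8 * (K1 + K2) * B ^ 3 * exp B) * (1 / \<kappa>) * (1 / r) ^ 3"
        by (simp_all add: power_divide)
      ultimately show ?thesis by (metis le_add_same_cancel1 le_add_same_cancel2)
    qed
    also have "\<dots> \<le> 2 * (1 / r) + (8 * (2 * Z ^ P) * B ^ 3 * exp B) * (1 / \<kappa>) * (1 / r) ^ 3"
      using r B \<kappa> K12 by (intro add_left_mono mult_right_mono mult_left_mono) auto
    also have "\<dots> = 8 * a0^2 * Z ^ (2 * D + 2) + 1024 * (B ^ 3 * exp B) * a0 ^ 6 * Z ^ m"
    proof -
      have "(Z ^ P) * (1 / \<kappa>) * (Z ^ (2 * D + 2)) ^ 3 = Z ^ m"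
      proof -
        have "1 / \<kappa> = Z ^ P" by (simp add: \<kappa>_def)
        moreover have "Z ^ (P + P + (2 * D + 2) * 3) = Z ^ P * Z ^ P * (Z ^ (2 * D + 2)) ^ 3"
          by (simp only: power_add power_mult)
        moreover have "P + P + (2 * D + 2) * 3 = m" by (simp add: m_def)
        ultimately show ?thesis by simp
      qed
      moreover have "(8 * (2 * Z ^ P) * B ^ 3 * exp B) * (1 / \<kappa>) * (4 * a0^2 * Z ^ (2 * D + 2)) ^ 3
         = 1024 * (B ^ 3 * exp B) * a0 ^ 6 * ((Z ^ P) * (1 / \<kappa>) * (Z ^ (2 * D + 2)) ^ 3)"
        unfolding power_mult_distrib by (simp flip: power_mult)
      ultimately show ?thesis unfolding rZ by simp
    qed
    also have "\<dots> \<le> 8 * a0^2 * Z ^ m + 1024 * (B ^ 3 * exp B) * a0 ^ 6 * Z ^ m"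
      using Z by (intro add_right_mono mult_left_mono power_increasing) (auto simp: m_def)
    also have "\<dots> = c1 * Z ^ m" by (simp add: c1_def algebra_simps)
    finally have \<eta>: "1 / \<eta> \<le> c1 * Z ^ m" .
    have C'0: "C' \<ge> 0" using C coeff_size_nonneg[of g I] Z p by (simp add: C'_def)
    have "cmod (h x1) \<le> 8 * 3 ^ 18 * C' * (1 / \<kappa>) ^ 3 * (1 / \<eta>) ^ 6"
      using bound by (simp add: \<eta>_def power_divide)
    also have "\<dots> \<le> 8 * 3 ^ 18 * C' * (1 / \<kappa>) ^ 3 * (c1 * Z ^ m) ^ 6"
      using \<eta> \<eta>0 C'0 \<kappa> by (intro mult_left_mono power_mono) auto
    also have "\<dots> \<le> 8 * 3 ^ 18 * (8 * C * a0 * Z ^ D * (2 * p * (2 * Z ^ P)) ^ 3) * (1 / \<kappa>) ^ 3 * (c1 * Z ^ m) ^ 6"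
      unfolding C'_def using C Z p c1 \<kappa> coeff_size_nonneg[of g I]
      by (intro mult_right_mono mult_left_mono) (auto simp: a0_def)
    also have "\<dots> = 8 * 3 ^ 18 * (8 * a0 * (4 * p) ^ 3) * c1 ^ 6 * C * (Z ^ D * (Z ^ P) ^ 3 * (Z ^ P) ^ 3 * (Z ^ m) ^ 6)"
      unfolding power_mult_distrib by (simp add: \<kappa>_def)
    also have "Z ^ D * (Z ^ P) ^ 3 * (Z ^ P) ^ 3 * (Z ^ m) ^ 6 = Z ^ (D + 6 * P + 6 * m)"
    proof -
      have "Z ^ (D + P * 3 + P * 3 + m * 6) = Z ^ D * (Z ^ P) ^ 3 * (Z ^ P) ^ 3 * (Z ^ m) ^ 6"
        by (simp only: power_add power_mult)
      moreover have "D + P * 3 + P * 3 + m * 6 = D + 6 * P + 6 * m" by simp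
      ultimately show ?thesis by metis
    qed
    also have "Z ^ (D + 6 * P + 6 * m) = 2 ^ (D + 6 * P + 6 * m) * X ^ (D + 6 * P + 6 * m)"
      unfolding Z_def power_mult_distrib ..
    finally show ?thesis by (simp add: A_def h_def s(2) mult_ac)
  qed
  then show ?thesis by (intro exI[of _ A] exI[of _ "D + 6 * P + 6 * m"] conjI A allI impI) simp_all
qed

section \<open>The resolvent as a sum over the roots\<close>

definition yslice :: "(nat \<times> nat \<Rightarrow> complex) \<Rightarrow> (nat \<times> nat) set \<Rightarrow> complex \<Rightarrow> complex poly" where
  "yslice g I x = (\<Sum>L\<in>I. monom (g L * x ^ fst L) (snd L))"

lemma poly_yslice: "poly (yslice g I x) y = bipoly g I x y"
  by (simp add: yslice_def bipoly_def poly_sum poly_monom)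

lemma poly_pderiv_yslice: "poly (pderiv (yslice g I x)) y = bipoly_dy g I x y"
proof -
  have "((\<lambda>y. poly (yslice g I x) y) has_field_derivative poly (pderiv (yslice g I x)) y) (at y)"
    by (rule poly_DERIV)
  moreover have "((\<lambda>y. poly (yslice g I x) y) has_field_derivative bipoly_dy g I x y) (at y)"
    unfolding poly_yslice by (rule bipoly_has_derivative)
  ultimately show ?thesis by (rule DERIV_unique)
qed

lemma card_simple_roots:
  fixes h :: "complex poly"
  assumes "h \<noteq> 0" "\<And>y. poly h y = 0 \<Longrightarrow> poly (pderiv h) y \<noteq> 0"
  shows "card {y. poly h y = 0} = degree h"
  using assms
proof (induction "degree h" arbitrary: h)
  case 0
  then obtain c where "h = [:c:]" by (metis degree_eq_zeroE)
  then show ?case using 0 by simp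
next
  case (Suc n)
  have "\<not> constant (poly h)" using Suc.hyps(2) by (simp add: constant_degree)
  then obtain a where a: "poly h a = 0" using fundamental_theorem_of_algebra by blast
  then obtain r where r: "h = [:-a, 1:] * r" by (metis dvdE poly_eq_0_iff_dvd)
  have r0: "r \<noteq> 0" using Suc.prems r by auto
  have d: "degree r = n" using Suc.hyps(2) r0 unfolding r by (subst (asm) degree_mult_eq) auto
  have pd: "poly (pderiv h) y = poly r y + (y - a) * poly (pderiv r) y" for y
    unfolding r pderiv_mult poly_add poly_mult by (simp add: pderiv_pCons algebra_simps)
  have ra: "poly r a \<noteq> 0" using Suc.prems(2)[OF a] pd[of a] by simp
  have "card {y. poly r y = 0} = degree r"
  proof (rule Suc.hyps(1)[OF d[symmetric] r0])
    fix y assume y: "poly r y = 0"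
    then have "poly h y = 0" by (simp add: r)
    from Suc.prems(2)[OF this] show "poly (pderiv r) y \<noteq> 0" using pd[of y] y by auto
  qed
  moreover have "{y. poly h y = 0} = insert a {y. poly r y = 0}" by (auto simp: r)
  moreover have "finite {y. poly r y = 0}" by (rule poly_roots_finite[OF r0])
  ultimately show ?case using ra d Suc.hyps(2) by simp
qed

text \<open>
  The quotient \<open>(q(x, z) - q(x, y)) / (z - y)\<close> as a polynomial in \<open>z\<close>.
\<close>

definition quot_poly :: "(nat \<times> nat \<Rightarrow> complex) \<Rightarrow> (nat \<times> nat) set \<Rightarrow> complex \<Rightarrow> complex \<Rightarrow> complex poly" where
  "quot_poly g I x y = (\<Sum>L\<in>I. smult (g L * x ^ fst L) (\<Sum>a<snd L. monom (y ^ (snd L - Suc a)) a))"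

lemma poly_quot_poly: "(z - y) * poly (quot_poly g I x y) z = bipoly g I x z - bipoly g I x y"
proof -
  have "(z - y) * poly (quot_poly g I x y) z
     = (\<Sum>L\<in>I. g L * x ^ fst L * ((z - y) * (\<Sum>a<snd L. y ^ (snd L - Suc a) * z ^ a)))"
    by (simp add: quot_poly_def poly_sum poly_monom sum_distrib_left mult_ac)
  also have "\<dots> = (\<Sum>L\<in>I. g L * x ^ fst L * (z ^ snd L - y ^ snd L))"
    by (simp only: power_diff_sumr2)
  finally show ?thesis by (simp add: bipoly_def sum_subtractf right_diff_distrib)
qed

lemma poly_quot_poly_diag: "poly (quot_poly g I x y) y = bipoly_dy g I x y"
proof -
  have "(\<Sum>a<n. y ^ (n - Suc a) * y ^ a) = of_nat n * y ^ (n - 1)" for n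
  proof -
    have "(\<Sum>a<n. y ^ (n - Suc a) * y ^ a) = (\<Sum>a<n. y ^ (n - 1))"
      by (intro sum.cong refl) (simp flip: power_add)
    then show ?thesis by simp
  qed
  then show ?thesis by (simp add: quot_poly_def bipoly_dy_def poly_sum poly_monom)
qed

lemma degree_quot_poly:
  assumes I: "finite I" and m: "\<And>L. L \<in> I \<Longrightarrow> snd L \<le> m" "m > 0"
  shows "degree (quot_poly g I x y) < m"
proof -
  have "degree (quot_poly g I x y) \<le> m - 1"
    unfolding quot_poly_def
  proof (rule degree_sum_le[OF I])
    fix L assume L: "L \<in> I"
    have "degree (\<Sum>a<snd L. monom (y ^ (snd L - Suc a)) a) \<le> m - 1"
    proof (rule degree_sum_le)
      fix a assume "a \<in> {..<snd L}"
      then have "a \<le> m - 1" using m(1)[OF L] by simp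
      then show "degree (monom (y ^ (snd L - Suc a)) a) \<le> m - 1"
        using degree_monom_le order_trans by blast
    qed simp
    then show "degree (smult (g L * x ^ fst L) (\<Sum>a<snd L. monom (y ^ (snd L - Suc a)) a)) \<le> m - 1"
      using degree_smult_le order_trans by blast
  qed
  then show ?thesis using m(2) by linarith
qed

lemma divdiff2_quot_poly:
  assumes "\<And>L. L \<in> I \<Longrightarrow> snd L \<le> m"
  shows "divdiff2 g I (x, y) F k l = (\<Sum>a<m. coeff (quot_poly g I x y) a * F k (l + a))"
proof -
  have "(\<Sum>a<m. coeff (quot_poly g I x y) a * F k (l + a))
     = (\<Sum>a<m. \<Sum>L\<in>I. g L * x ^ fst L * ((if a < snd L then y ^ (snd L - Suc a) else 0) * F k (l + a)))"
  proof (intro sum.cong refl)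
    fix a
    have "coeff (\<Sum>a<n. monom (y ^ (n - Suc a)) a) a = (if a < n then y ^ (n - Suc a) else 0)" for n
      unfolding coeff_sum coeff_monom by (subst sum.delta) auto
    then show "coeff (quot_poly g I x y) a * F k (l + a)
      = (\<Sum>L\<in>I. g L * x ^ fst L * ((if a < snd L then y ^ (snd L - Suc a) else 0) * F k (l + a)))"
      unfolding quot_poly_def by (simp only: coeff_sum[of _ I] coeff_smult sum_distrib_right mult.assoc)
  qed
  also have "\<dots> = (\<Sum>L\<in>I. g L * x ^ fst L * (\<Sum>a<m. (if a < snd L then y ^ (snd L - Suc a) else 0) * F k (l + a)))"
    by (subst sum.swap) (simp add: sum_distrib_left)
  also have "\<dots> = divdiff2 g I (x, y) F k l"
    unfolding divdiff2_def fst_conv snd_conv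
  proof (rule sum.cong[OF refl], rule arg_cong[where f = "(*) (g _ * x ^ fst _)"])
    fix L assume L: "L \<in> I"
    have "(\<Sum>a<m. (if a < snd L then y ^ (snd L - Suc a) else 0) * F k (l + a))
        = (\<Sum>a\<in>{..<m}. if a < snd L then y ^ (snd L - Suc a) * F k (l + a) else 0)"
      by (intro sum.cong) auto
    also have "\<dots> = (\<Sum>a\<in>{..<m} \<inter> {a. a < snd L}. y ^ (snd L - Suc a) * F k (l + a))"
      by (simp add: sum.inter_restrict)
    also have "{..<m} \<inter> {a. a < snd L} = {..<snd L}" using assms[OF L] by auto
    finally show "(\<Sum>a<m. (if a < snd L then y ^ (snd L - Suc a) else 0) * F k (l + a))
       = (\<Sum>a<snd L. y ^ (snd L - Suc a) * F k (l + a))" .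
  qed
  finally show ?thesis by simp
qed

text \<open>
  Lagrange interpolation of the constant \<open>1\<close> at the \<open>m\<close> simple roots: both sides have degree below
  \<open>m\<close> and agree at every root.
\<close>

lemma lagrange_quot_poly:
  assumes I: "finite I" and m: "\<And>L. L \<in> I \<Longrightarrow> snd L \<le> m" "m > 0"
    and card: "card {y. bipoly g I x y = 0} = m"
    and simple: "\<And>y. bipoly g I x y = 0 \<Longrightarrow> bipoly_dy g I x y \<noteq> 0"
  shows "(\<Sum>y | bipoly g I x y = 0. smult (1 / bipoly_dy g I x y) (quot_poly g I x y)) = 1"
proof (rule poly_eqI_degree[where A = "{y. bipoly g I x y = 0}"])
  let ?Z = "{y. bipoly g I x y = 0}"
  have fin: "finite ?Z" using card m(2) card_ge_0_finite by metis
  fix z assume z: "z \<in> ?Z"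
  have "poly (\<Sum>y\<in>?Z. smult (1 / bipoly_dy g I x y) (quot_poly g I x y)) z
     = (\<Sum>y\<in>?Z. if y = z then 1 else 0)"
    unfolding poly_sum
  proof (intro sum.cong refl)
    fix y assume y: "y \<in> ?Z"
    show "poly (smult (1 / bipoly_dy g I x y) (quot_poly g I x y)) z = (if y = z then 1 else 0)"
      using poly_quot_poly[of z y g I x] poly_quot_poly_diag[of g I x z] y z simple by auto
  qed
  also have "\<dots> = 1" using z fin by simp
  finally show "poly (\<Sum>y\<in>?Z. smult (1 / bipoly_dy g I x y) (quot_poly g I x y)) z = poly 1 z" by simp
next
  let ?Z = "{y. bipoly g I x y = 0}"
  have "degree (\<Sum>y\<in>?Z. smult (1 / bipoly_dy g I x y) (quot_poly g I x y)) \<le> m - 1"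
  proof (rule degree_sum_le)
    show "finite ?Z" using card m(2) card_ge_0_finite by metis
    show "degree (smult (1 / bipoly_dy g I x y) (quot_poly g I x y)) \<le> m - 1" for y
      using degree_smult_le[of "1 / bipoly_dy g I x y" "quot_poly g I x y"] degree_quot_poly[OF I m, of g x y] by linarith
  qed
  then show "degree (\<Sum>y\<in>?Z. smult (1 / bipoly_dy g I x y) (quot_poly g I x y)) < card ?Z"
    using m(2) card by linarith
qed (use card m in auto)

text \<open>
  The continuation of the Cauchy transform: a sum of residues over the roots of \<open>q(x, \<cdot>)\<close>.
\<close>

definition resolvent :: "real \<Rightarrow> (nat \<times> nat \<Rightarrow> complex) \<Rightarrow> (nat \<times> nat) set \<Rightarrow> double_seq \<Rightarrow> complex \<Rightarrow> complex" where
  "resolvent p g I b x = (\<Sum>y | bipoly g I x y = 0. branch_val p g I b (x, y) / bipoly_dy g I x y)"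

lemma dual_le_e1: "p \<ge> 1 \<Longrightarrow> dual_le p (1, 0) 1"
  by (auto simp: dual_le_def dest: egauge_le_1_coords)

text \<open>
  For \<open>\<bar>x\<bar> > 1\<close> the form \<open>c = (1 / x, 0)\<close> is admissible at every root \<open>y\<close> at once. With this choice only
  the divided difference in the second variable survives, and the sum over the roots is the Lagrange
  interpolation of \<open>1\<close>.
\<close>

lemma resolvent_outside:
  assumes p: "p \<ge> 1" and b: "growth p C b" and C: "C \<ge> 0" and I: "finite I"
    and ann: "\<And>k l. (\<Sum>L\<in>I. g L * b (k + fst L) (l + snd L)) = 0"
    and m: "\<And>L. L \<in> I \<Longrightarrow> snd L \<le> m" "m > 0"
    and card: "card {y. bipoly g I x y = 0} = m"
    and simple: "\<And>y. bipoly g I x y = 0 \<Longrightarrow> bipoly_dy g I x y \<noteq> 0"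
    and N: "\<And>y. bipoly g I x y = 0 \<Longrightarrow> egauge p (x, y) > 1" and x: "cmod x > 1"
  shows "resolvent p g I b x = - (1 / x) * fantappie (1 / x, 0) b 0 0"
proof -
  let ?F = "fantappie (1 / x, 0) b"
  have c: "dual_le p (1 / x, 0) (cmod (1 / x))" using dual_le_scale[OF dual_le_e1[OF p], of "1 / x"] by simp
  have "cmod x > 0" using x by linarith
  then have t: "cmod (1 / x) < 1" using x by (simp add: norm_divide)
  have x0: "x \<noteq> 0" using x by auto
  have "branch_val p g I b (x, y) = - (1 / x) * divdiff2 g I (x, y) ?F 0 0" if y: "bipoly g I x y = 0" for y
  proof -
    have "branch_sol g I (1 / x, 0) (x, y) ?F 0 0 = branch_val p g I b (x, y)"
      by (rule branch_val_eqI[OF p b C I ann _ N[OF y] c t]) (use y x0 in \<open>auto simp: bipoly_def\<close>)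
    then show ?thesis by (simp add: branch_sol_def)
  qed
  then have "resolvent p g I b x = (\<Sum>y | bipoly g I x y = 0. - (1 / x) * (\<Sum>a<m. (1 / bipoly_dy g I x y * coeff (quot_poly g I x y) a) * ?F 0 a))"
    unfolding resolvent_def by (intro sum.cong refl) (simp add: divdiff2_quot_poly[OF m(1)] sum_distrib_left sum_divide_distrib)
  also have "\<dots> = - (1 / x) * (\<Sum>a<m. coeff (\<Sum>y | bipoly g I x y = 0. smult (1 / bipoly_dy g I x y) (quot_poly g I x y)) a * ?F 0 a)"
    unfolding coeff_sum coeff_smult sum_distrib_right sum_distrib_left[of "- (1 / x)"]
    by (subst sum.swap) simp
  also have "\<dots> = - (1 / x) * (\<Sum>a<m. coeff 1 a * ?F 0 a)"
    by (simp only: lagrange_quot_poly[OF I m card simple])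
  also have "(\<Sum>a<m. coeff 1 a * ?F 0 a) = (\<Sum>a<m. if a = 0 then ?F 0 a else 0)"
    by (intro sum.cong) auto
  also have "\<dots> = ?F 0 0" using m(2) by simp
  finally show ?thesis .
qed

text \<open>
  Locally the roots are given by as many disjoint holomorphic branches as there are roots, so the sum
  over the roots is a sum over branches.
\<close>

lemma resolvent_holomorphic:
  assumes p: "p \<ge> 1" and b: "growth p C b" and C: "C \<ge> 0" and I: "finite I"
    and ann: "\<And>k l. (\<Sum>L\<in>I. g L * b (k + fst L) (l + snd L)) = 0"
    and U: "open U"
    and card: "\<And>x. x \<in> U \<Longrightarrow> card {y. bipoly g I x y = 0} = m" and m: "m > 0"
    and simple: "\<And>x y. x \<in> U \<Longrightarrow> bipoly g I x y = 0 \<Longrightarrow> bipoly_dy g I x y \<noteq> 0"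
    and N: "\<And>x y. x \<in> U \<Longrightarrow> bipoly g I x y = 0 \<Longrightarrow> egauge p (x, y) > 1"
  shows "resolvent p g I b holomorphic_on U"
  unfolding holomorphic_on_def
proof
  fix x1 assume x1: "x1 \<in> U"
  let ?Z = "\<lambda>x. {y. bipoly g I x y = 0}"
  have fin: "finite (?Z x)" if "x \<in> U" for x by (rule card_ge_0_finite) (simp add: card[OF that] m)
  define D where "D = Max (insert 0 ((\<lambda>L. fst L + snd L) ` I))"
  have D: "fst L + snd L \<le> D" if "L \<in> I" for L using that I unfolding D_def by (intro Max_ge) auto
  define P where "P y \<delta> s \<longleftrightarrow> \<delta> > 0 \<and> s holomorphic_on ball x1 \<delta> \<and> s x1 = y
      \<and> (\<forall>x\<in>ball x1 \<delta>. bipoly g I x (s x) = 0)" for y \<delta> s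
  have ex: "\<exists>\<delta> s. P y \<delta> s" if y: "y \<in> ?Z x1" for y
  proof -
    define X where "X = max 1 (max (cmod x1) (max (cmod y) (1 / cmod (bipoly_dy g I x1 y))))"
    have X: "X \<ge> 1" "cmod x1 \<le> X" "cmod y \<le> X" "1 / cmod (bipoly_dy g I x1 y) \<le> X" by (auto simp: X_def)
    have "1 / X \<le> cmod (bipoly_dy g I x1 y)"
      using X(1,4) simple[OF x1, of y] y by (simp add: field_simps)
    note simp1 = this
    define \<Lambda> where "\<Lambda> = coeff_size g I * (2 * X) ^ D + 1"
    have \<Lambda>: "\<Lambda> \<ge> 1" "coeff_size g I * (2 * X) ^ D \<le> \<Lambda>"
      using coeff_size_nonneg[of g I] X(1) by (simp_all add: \<Lambda>_def)
    have y0: "bipoly g I x1 y = 0" using y by simp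
    show ?thesis
    proof (rule newton_branch[OF X(1) D \<Lambda> X(2,3) y0 simp1])
      fix s assume s: "s holomorphic_on ball x1 (1 / (8 * \<Lambda>^2 * X^2))" "s x1 = y"
        "\<And>x. x \<in> ball x1 (1 / (8 * \<Lambda>^2 * X^2)) \<Longrightarrow> bipoly g I x (s x) = 0"
      have "1 / (8 * \<Lambda>^2 * X^2) > 0" using \<Lambda>(1) X(1) by simp
      then have "P y (1 / (8 * \<Lambda>^2 * X^2)) s" unfolding P_def using s(1,2) by (intro conjI ballI s(3))
      then show ?thesis by blast
    qed
  qed
  define \<delta> where "\<delta> y = (SOME \<delta>. \<exists>s. P y \<delta> s)" for y
  define s where "s y = (SOME s. P y (\<delta> y) s)" for y
  have "P y (\<delta> y) (s y)" if "y \<in> ?Z x1" for y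
  proof -
    have "\<exists>s. P y (\<delta> y) s"
      unfolding \<delta>_def by (rule someI_ex[where P = "\<lambda>\<delta>. \<exists>s. P y \<delta> s"]) (rule ex[OF that])
    then show ?thesis unfolding s_def by (rule someI_ex[where P = "P y (\<delta> y)"])
  qed
  then have s: "\<And>y. y \<in> ?Z x1 \<Longrightarrow> \<delta> y > 0" "\<And>y. y \<in> ?Z x1 \<Longrightarrow> s y holomorphic_on ball x1 (\<delta> y)"
    "\<And>y. y \<in> ?Z x1 \<Longrightarrow> s y x1 = y" "\<And>y x. y \<in> ?Z x1 \<Longrightarrow> x \<in> ball x1 (\<delta> y) \<Longrightarrow> bipoly g I x (s y x) = 0"
    unfolding P_def by blast+
  have cont: "isCont (s y) x1" if "y \<in> ?Z x1" for y
    using holomorphic_on_imp_continuous_on[OF s(2)[OF that]] s(1)[OF that]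
    by (simp add: continuous_on_eq_continuous_at)
  have ev1: "\<forall>\<^sub>F x in nhds x1. \<forall>y\<in>?Z x1. x \<in> ball x1 (\<delta> y)"
    using s(1) by (intro eventually_ball_finite fin[OF x1] ballI eventually_nhds_in_open) auto
  \<comment> \<open>Branches through different roots stay different near \<open>x1\<close>; by counting they then exhaust the roots.\<close>
  have ev2: "\<forall>\<^sub>F x in nhds x1. \<forall>y\<in>?Z x1. \<forall>y'\<in>?Z x1. y \<noteq> y' \<longrightarrow> s y x \<noteq> s y' x"
  proof (intro eventually_ball_finite fin[OF x1] ballI)
    fix y y' assume yy: "y \<in> ?Z x1" "y' \<in> ?Z x1"
    show "\<forall>\<^sub>F x in nhds x1. y \<noteq> y' \<longrightarrow> s y x \<noteq> s y' x"
    proof (cases "y = y'")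
      case False
      have "((\<lambda>x. s y x - s y' x) \<longlongrightarrow> s y x1 - s y' x1) (nhds x1)"
        using cont[OF yy(1)] cont[OF yy(2)] by (intro tendsto_diff) (auto simp: continuous_at isCont_def tendsto_nhds_iff)
      moreover have "s y x1 - s y' x1 \<noteq> 0" using s(3) yy False by simp
      ultimately have "\<forall>\<^sub>F x in nhds x1. s y x - s y' x \<noteq> 0" by (rule tendsto_imp_eventually_ne)
      then show ?thesis by (rule eventually_mono) auto
    qed auto
  qed
  have ev3: "\<forall>\<^sub>F x in nhds x1. x \<in> U" using U x1 by (rule eventually_nhds_in_open)
  from eventually_conj[OF ev1 eventually_conj[OF ev2 ev3]]
  obtain V where V: "open V" "x1 \<in> V" and Vp: "\<And>x. x \<in> V \<Longrightarrow> (\<forall>y\<in>?Z x1. x \<in> ball x1 (\<delta> y))"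
     "\<And>x. x \<in> V \<Longrightarrow> (\<forall>y\<in>?Z x1. \<forall>y'\<in>?Z x1. y \<noteq> y' \<longrightarrow> s y x \<noteq> s y' x)" "\<And>x. x \<in> V \<Longrightarrow> x \<in> U"
    unfolding eventually_nhds by blast
  have eq: "resolvent p g I b x = (\<Sum>y\<in>?Z x1. branch_val p g I b (x, s y x) / bipoly_dy g I x (s y x))"
    if x: "x \<in> V" for x
  proof -
    have inj: "inj_on (\<lambda>y. s y x) (?Z x1)" using Vp(2)[OF x] by (auto simp: inj_on_def)
    have sub: "(\<lambda>y. s y x) ` ?Z x1 \<subseteq> ?Z x" using s(4) Vp(1)[OF x] by auto
    have "(\<lambda>y. s y x) ` ?Z x1 = ?Z x"
      by (rule card_subset_eq[OF fin[OF Vp(3)[OF x]] sub])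
         (simp add: card_image[OF inj] card[OF Vp(3)[OF x]] card[OF x1])
    then show ?thesis unfolding resolvent_def using sum.reindex[OF inj, of "\<lambda>y. branch_val p g I b (x, y) / bipoly_dy g I x y"] by (simp add: o_def)
  qed
  have "(\<lambda>x. \<Sum>y\<in>?Z x1. branch_val p g I b (x, s y x) / bipoly_dy g I x (s y x)) holomorphic_on V"
  proof (intro holomorphic_on_sum holomorphic_on_divide)
    fix y assume y: "y \<in> ?Z x1"
    have sV: "s y holomorphic_on V" using Vp(1) y by (intro holomorphic_on_subset[OF s(2)[OF y]]) auto
    have root: "bipoly g I x (s y x) = 0" if "x \<in> V" for x using s(4)[OF y] Vp(1)[OF that] y by blast
    show "(\<lambda>x. branch_val p g I b (x, s y x)) holomorphic_on V"
      by (rule branch_val_holomorphic[OF p b C I ann V(1) sV root]) (use N Vp(3) root in auto)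
    show "(\<lambda>x. bipoly_dy g I x (s y x)) holomorphic_on V"
      unfolding bipoly_dy_def by (intro holomorphic_intros sV)
    show "bipoly_dy g I x (s y x) \<noteq> 0" if "x \<in> V" for x by (rule simple[OF Vp(3)[OF that] root[OF that]])
  qed
  then have "resolvent p g I b holomorphic_on V" by (rule holomorphic_transform) (use eq in auto)
  then show "resolvent p g I b field_differentiable (at x1 within U)"
    using V by (meson field_differentiable_at_within holomorphic_on_imp_differentiable_at)
qed

section \<open>Polynomials in a shift\<close>

definition shift_poly :: "nat \<times> nat \<Rightarrow> complex poly \<Rightarrow> double_seq \<Rightarrow> double_seq" where
  "shift_poly u T b i j = (\<Sum>k\<le>degree T. coeff T k * b (i + k * fst u) (j + k * snd u))"

lemma shift_poly_extend: "degree T \<le> n \<Longrightarrow> shift_poly u T b i j = (\<Sum>k\<le>n. coeff T k * b (i + k * fst u) (j + k * snd u))"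
  unfolding shift_poly_def by (rule sum.mono_neutral_left) (auto simp: coeff_eq_0)

lemma shift_poly_pCons: "shift_poly u (pCons a T) b i j = a * b i j + shift_poly u T b (i + fst u) (j + snd u)"
proof -
  have "shift_poly u (pCons a T) b i j = (\<Sum>k\<le>Suc (degree T). coeff (pCons a T) k * b (i + k * fst u) (j + k * snd u))"
    by (rule shift_poly_extend) (simp add: degree_pCons_le)
  also have "\<dots> = a * b i j + (\<Sum>k\<le>degree T. coeff T k * b (i + fst u + k * fst u) (j + snd u + k * snd u))"
    by (subst sum.atMost_Suc_shift) (simp add: add.assoc)
  finally show ?thesis unfolding shift_poly_def[of u T] .
qed

lemma shift_poly_0 [simp]: "shift_poly u 0 b i j = 0"
  by (simp add: shift_poly_def)

lemma shift_poly_linear_factor: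
  "shift_poly u ([:- e, 1:] * T) b = shift_poly u T (\<lambda>i j. b (i + fst u) (j + snd u) - e * b i j)"
proof (intro ext)
  fix i j
  have eq: "[:- e, 1:] * T = smult (- e) T + pCons 0 T" by simp
  have "shift_poly u (smult (- e) T + pCons 0 T) b i j
      = (\<Sum>k\<le>Suc (degree T). coeff (smult (- e) T + pCons 0 T) k * b (i + k * fst u) (j + k * snd u))"
    unfolding eq[symmetric] by (rule shift_poly_extend) (rule order_trans[OF degree_mult_le], simp)
  also have "(\<Sum>k\<le>Suc (degree T). coeff (smult (- e) T + pCons 0 T) k * b (i + k * fst u) (j + k * snd u))
    = - e * (\<Sum>k\<le>Suc (degree T). coeff T k * b (i + k * fst u) (j + k * snd u))
      + (\<Sum>k\<le>Suc (degree T). coeff (pCons 0 T) k * b (i + k * fst u) (j + k * snd u))"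
    unfolding sum_distrib_left sum.distrib[symmetric] by (intro sum.cong refl) (simp add: algebra_simps)
  also have "(\<Sum>k\<le>Suc (degree T). coeff T k * b (i + k * fst u) (j + k * snd u)) = shift_poly u T b i j"
    by (rule shift_poly_extend[symmetric]) simp
  also have "(\<Sum>k\<le>Suc (degree T). coeff (pCons 0 T) k * b (i + k * fst u) (j + k * snd u)) = shift_poly u T b (i + fst u) (j + snd u)"
    by (subst sum.atMost_Suc_shift) (simp add: shift_poly_def add.assoc)
  also have "- e * shift_poly u T b i j + shift_poly u T b (i + fst u) (j + snd u)
      = shift_poly u T (\<lambda>i j. b (i + fst u) (j + snd u) - e * b i j) i j"
    unfolding shift_poly_def sum_distrib_left sum.distrib[symmetric]
    by (intro sum.cong refl) (simp add: algebra_simps)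
  finally show "shift_poly u ([:- e, 1:] * T) b i j = shift_poly u T (\<lambda>i j. b (i + fst u) (j + snd u) - e * b i j) i j"
    unfolding eq .
qed

text \<open>
  The linear factors of \<open>T\<close> are applied to \<open>b\<close> one after another; just before the result vanishes for the
  first time it is an eigensequence.
\<close>

lemma shift_poly_eigensequence:
  assumes "T \<noteq> 0" "V b" "\<And>i j. shift_poly u T b i j = 0" "b \<noteq> (\<lambda>i j. 0)"
    and V: "\<And>b e. V b \<Longrightarrow> V (\<lambda>i j. b (i + fst u) (j + snd u) - e * b i j)"
  shows "\<exists>e b'. V b' \<and> b' \<noteq> (\<lambda>i j. 0) \<and> (\<forall>i j. b' (i + fst u) (j + snd u) = e * b' i j)"
  using assms(1-4)
proof (induction "degree T" arbitrary: T b)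
  case 0
  then obtain c where c: "T = [:c:]" by (metis degree_eq_zeroE)
  then have "c \<noteq> 0" using 0 by auto
  moreover have "shift_poly u T b i j = c * b i j" for i j by (simp add: c shift_poly_def)
  ultimately have "b = (\<lambda>i j. 0)" using 0 by (auto simp: fun_eq_iff)
  then show ?case using 0 by simp
next
  case (Suc n)
  have "\<not> constant (poly T)" using Suc.hyps(2) by (simp add: constant_degree)
  then obtain e where e: "poly T e = 0" using fundamental_theorem_of_algebra by blast
  then obtain r where r: "T = [:-e, 1:] * r" by (metis dvdE poly_eq_0_iff_dvd)
  have r0: "r \<noteq> 0" using Suc.prems r by auto
  have d: "degree r = n" using Suc.hyps(2) r0 unfolding r by (subst (asm) degree_mult_eq) auto
  let ?b = "\<lambda>i j. b (i + fst u) (j + snd u) - e * b i j"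
  show ?case
  proof (cases "?b = (\<lambda>i j. 0)")
    case True
    then have "\<forall>i j. b (i + fst u) (j + snd u) = e * b i j" by (metis eq_iff_diff_eq_0)
    then show ?thesis using Suc.prems by blast
  next
    case False
    have "shift_poly u r ?b i j = 0" for i j using Suc.prems(3) unfolding r shift_poly_linear_factor .
    from Suc.hyps(1)[OF d[symmetric] r0 V[OF Suc.prems(2)] this False] show ?thesis .
  qed
qed

section \<open>The Cauchy transform in the first variable\<close>

lemma growth_shift:
  assumes p: "p \<ge> 1" and b: "growth p C b" and C: "C \<ge> 0"
  shows "growth p (C * real (k + l + 1)) (\<lambda>i j. b (i + k) (j + l))"
  unfolding growth_def
proof (intro allI)
  fix i j
  have "cmod (b (i + k) (j + l)) \<le> C * real (i + k + (j + l) + 2) * monom_sup p (i + k) (j + l)"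
    using b[unfolded growth_def, rule_format, of "i + k" "j + l"] by simp
  also have "\<dots> \<le> C * (real (k + l + 1) * real (i + j + 2)) * (monom_sup p i j * 1)"
  proof (intro mult_mono mult_left_mono)
    show "monom_sup p (i + k) (j + l) \<le> monom_sup p i j * 1"
      by (rule order_trans[OF monom_sup_mult[OF p]])
         (intro mult_left_mono monom_sup_le_1 monom_sup_nonneg p)
    have "i + k + (j + l) + 2 \<le> (k + l + 1) * (i + j + 2)" by (simp add: algebra_simps)
    then show "real (i + k + (j + l) + 2) \<le> real (k + l + 1) * real (i + j + 2)"
      by (metis of_nat_le_iff of_nat_mult)
  qed (use C monom_sup_nonneg[OF p] in auto)
  finally show "cmod (b (i + k) (j + l)) \<le> C * real (k + l + 1) * real (i + j + 2) * monom_sup p i j"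
    by (simp only: mult.assoc mult_1_right)
qed

lemma growth_add_scale:
  assumes "growth p C b" "growth p C' b'"
  shows "growth p (cmod a * C + C') (\<lambda>i j. a * b i j + b' i j)"
  unfolding growth_def
proof (intro allI)
  fix i j
  have "cmod (a * b i j + b' i j) \<le> cmod a * (C * (i + j + 2) * monom_sup p i j) + C' * (i + j + 2) * monom_sup p i j"
    using assms unfolding growth_def
    by (intro order_trans[OF norm_triangle_ineq] add_mono) (auto simp: norm_mult intro: mult_left_mono)
  then show "cmod (a * b i j + b' i j) \<le> (cmod a * C + C') * real (i + j + 2) * monom_sup p i j"
    by (simp add: algebra_simps)
qed

lemma growth_shift_poly:
  assumes p: "p \<ge> 1" and b: "growth p C b" and C: "C \<ge> 0"
  shows "\<exists>C'\<ge>0. growth p C' (shift_poly u T b)"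
proof (induction T)
  case 0
  then show ?case by (intro exI[of _ 0]) (simp add: growth_def)
next
  case (pCons a T)
  then obtain C' where C': "C' \<ge> 0" "growth p C' (shift_poly u T b)" by blast
  have "growth p (cmod a * C + C' * real (fst u + snd u + 1)) (\<lambda>i j. a * b i j + shift_poly u T b (i + fst u) (j + snd u))"
    by (rule growth_add_scale[OF b growth_shift[OF p C'(2,1)]])
  moreover have "shift_poly u (pCons a T) b = (\<lambda>i j. a * b i j + shift_poly u T b (i + fst u) (j + snd u))"
    by (intro ext) (rule shift_poly_pCons)
  ultimately show ?case using C C'(1) by (intro exI[of _ "cmod a * C + C' * real (fst u + snd u + 1)"]) simp
qed

text \<open>
  For the functional \<open>\<phi>(z\<^sup>L) = b\<^sub>L\<close> this is \<open>\<phi>(1 / (z\<^sub>1 - x))\<close>.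
\<close>

definition cauchy_transform :: "double_seq \<Rightarrow> complex \<Rightarrow> complex" where
  "cauchy_transform b x = - (1 / x) * fantappie (1 / x, 0) b 0 0"

lemma lin_pow_e1: "lin_pow (1, 0) n b i j = b (i + n) j"
proof -
  have "lin_pow (1, 0) n b i j = (\<Sum>k\<le>n. if k = n then b (i + n) j else 0)"
    unfolding lin_pow_def by (intro sum.cong refl) auto
  then show ?thesis by simp
qed

lemma inverse_less_1: "1 / t < 1" if "t > 1" for t :: real
proof -
  have "t > 0" using that by linarith
  then show ?thesis using that by simp
qed

context
  fixes p :: real
  assumes p: "p \<ge> 1"
begin

lemma dual_le_inverse: "dual_le p (1 / x, 0) (1 / cmod x)"
  using dual_le_scale[OF dual_le_e1[OF p], of "1 / x"] by (simp add: norm_divide)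

lemma cauchy_transform_bound:
  assumes b: "growth p C b" and C: "C \<ge> 0" and x: "cmod x \<ge> 2"
  shows "cmod (cauchy_transform b x) \<le> 32 * C / cmod x"
proof -
  have t: "1 / cmod x \<le> 1 / 2" "1 / cmod x < 1"
  proof -
    show "1 / cmod x \<le> 1 / 2" using x by (intro divide_left_mono) (auto intro: mult_pos_pos less_le_trans[of 0 2])
    then show "1 / cmod x < 1" by simp
  qed
  from fantappie_growth[OF p dual_le_inverse t(2) b C, unfolded growth_def, rule_format, of 0 0]
  have "cmod (fantappie (1 / x, 0) b 0 0) \<le> 2 * C / (1 - 1 / cmod x) ^ 3 * 2 * monom_sup p 0 0" by simp
  also have "\<dots> \<le> 2 * C / (1 - 1 / cmod x) ^ 3 * 2 * 1"
    using C t by (intro mult_left_mono monom_sup_le_1 p) auto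
  also have "\<dots> \<le> 2 * C / (1 / 2) ^ 3 * 2 * 1"
    using C t by (intro mult_right_mono divide_left_mono power_mono) auto
  finally have "cmod (fantappie (1 / x, 0) b 0 0) \<le> 32 * C" by (simp add: power3_eq_cube)
  then have "(1 / cmod x) * cmod (fantappie (1 / x, 0) b 0 0) \<le> (1 / cmod x) * (32 * C)"
    by (intro mult_left_mono) auto
  then show ?thesis by (simp add: cauchy_transform_def norm_mult norm_divide)
qed

lemma cauchy_transform_shift:
  assumes b: "growth p C b" and C: "C \<ge> 0" and x: "cmod x > 1"
  shows "cauchy_transform (\<lambda>i j. b (Suc i) j) x = x * cauchy_transform b x + b 0 0"
proof -
  let ?F = "fantappie (1 / x, 0) b"
  have "1 / cmod x < 1" by (rule inverse_less_1[OF x])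
  from fantappie_eq[OF p dual_le_inverse this b C, of 0 0]
  have eq: "?F 0 0 = b 0 0 + 1 / x * ?F (Suc 0) 0"
    by (simp only: fst_conv snd_conv mult_zero_left add_0_right)
  have sh: "fantappie (1 / x, 0) (\<lambda>i j. b (Suc i) j) 0 0 = ?F (Suc 0) 0"
    unfolding fantappie_def lin_pow_def add_Suc ..
  have "x \<noteq> 0" using x by (metis norm_zero not_one_less_zero)
  then have xF: "x * (- (1 / x) * ?F 0 0) = - ?F 0 0" by simp
  have "- s * t = - (u + s * t) + u" for s t u :: complex by simp
  then show ?thesis unfolding cauchy_transform_def sh xF unfolding eq .
qed

lemma cauchy_transform_add_scale:
  assumes b: "growth p C b" and C: "C \<ge> 0" and b': "growth p C' b'" and C': "C' \<ge> 0" and x: "cmod x > 1"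
  shows "cauchy_transform (\<lambda>i j. a * b i j + b' i j) x = a * cauchy_transform b x + cauchy_transform b' x"
proof -
  have t: "1 / cmod x < 1" by (rule inverse_less_1[OF x])
  have l: "lin_pow (1 / x, 0) n (\<lambda>i j. a * b i j + b' i j) 0 0
      = a * lin_pow (1 / x, 0) n b 0 0 + lin_pow (1 / x, 0) n b' 0 0" for n
    unfolding lin_pow_def sum_distrib_left sum.distrib[symmetric]
    by (intro sum.cong refl) (simp add: algebra_simps)
  have "fantappie (1 / x, 0) (\<lambda>i j. a * b i j + b' i j) 0 0
     = a * fantappie (1 / x, 0) b 0 0 + fantappie (1 / x, 0) b' 0 0"
    unfolding fantappie_def l
    using lin_pow_summable[OF p dual_le_inverse t b C, of 0 0] lin_pow_summable[OF p dual_le_inverse t b' C', of 0 0]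
    by (simp add: suminf_add[symmetric] suminf_mult summable_mult)
  then show ?thesis by (simp add: cauchy_transform_def algebra_simps)
qed

text \<open>
  Multiplying the Cauchy kernel by \<open>T(z\<^sub>1)\<close> instead of \<open>T(x)\<close> changes it by the polynomial
  \<open>(T(z\<^sub>1) - T(x)) / (z\<^sub>1 - x)\<close>.
\<close>

lemma cauchy_transform_shift_poly:
  assumes b: "growth p C b" and C: "C \<ge> 0"
  shows "\<exists>P. \<forall>x. cmod x > 1 \<longrightarrow> cauchy_transform (shift_poly (1, 0) T b) x = poly T x * cauchy_transform b x + poly P x"
proof (induction T)
  case 0
  have "shift_poly (1, 0) 0 b = (\<lambda>i j. 0)" by (intro ext) simp
  then show ?case by (intro exI[of _ 0]) (simp add: cauchy_transform_def fantappie_def lin_pow_def)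
next
  case (pCons a T)
  then obtain P where P: "\<And>x. cmod x > 1 \<Longrightarrow> cauchy_transform (shift_poly (1, 0) T b) x = poly T x * cauchy_transform b x + poly P x"
    by blast
  obtain C' where C': "C' \<ge> 0" "growth p C' (shift_poly (1, 0) T b)" using growth_shift_poly[OF p b C] by blast
  have sh: "growth p (C' * real (1 + 0 + 1)) (\<lambda>i j. shift_poly (1, 0) T b (i + 1) (j + 0))"
    by (rule growth_shift[OF p C'(2,1)])
  have eq: "shift_poly (1, 0) (pCons a T) b = (\<lambda>i j. a * b i j + shift_poly (1, 0) T b (Suc i) j)"
    by (intro ext) (simp add: shift_poly_pCons)
  have "cauchy_transform (shift_poly (1, 0) (pCons a T) b) x
      = poly (pCons a T) x * cauchy_transform b x + poly (pCons (shift_poly (1, 0) T b 0 0) P) x" if x: "cmod x > 1" for x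
    unfolding eq using cauchy_transform_add_scale[OF b C sh _ x, of a] C'(1)
      cauchy_transform_shift[OF C'(2,1) x] P[OF x] by (simp add: algebra_simps)
  then show ?case by blast
qed

text \<open>
  The expansion at infinity has the entries \<open>b n 0\<close> as its coefficients.
\<close>

lemma cauchy_transform_eq_0:
  assumes b: "growth p C b" and C: "C \<ge> 0" and r: "r > 1"
    and z: "\<And>x. cmod x > r \<Longrightarrow> cauchy_transform b x = 0"
  shows "b n 0 = 0"
proof -
  define c where "c n = (case n of 0 \<Rightarrow> 0 | Suc n \<Rightarrow> b n 0)" for n
  have "c (Suc n) = 0"
  proof (rule powser_zero_near_0[of "1 / r"])
    show "1 / r > 0" using r by simp
    fix \<sigma> :: complex assume \<sigma>: "cmod \<sigma> < 1 / r"
    have "cmod \<sigma> < 1"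
      by (rule less_le_trans[OF \<sigma>]) (use r in simp)
    then have "cmod \<sigma> * 1 < 1" by simp
    from summable_sums[OF lin_pow_summable[OF p dual_le_scale[OF dual_le_e1[OF p]] this b C, of 0 0]]
    have "(\<lambda>n. lin_pow (\<sigma>, 0) n b 0 0) sums fantappie (\<sigma>, 0) b 0 0"
      by (simp add: fantappie_def)
    moreover have "lin_pow (\<sigma>, 0) n b 0 0 = \<sigma> ^ n * b n 0" for n
      using lin_pow_scale[of \<sigma> "(1, 0)" n b 0 0] lin_pow_e1[of n b 0 0] by simp
    ultimately have s: "(\<lambda>n. \<sigma> ^ n * b n 0) sums fantappie (\<sigma>, 0) b 0 0" by simp
    have "\<sigma> * fantappie (\<sigma>, 0) b 0 0 = 0"
    proof (cases "\<sigma> = 0")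
      case False
      then have "cmod (1 / \<sigma>) > r" using \<sigma> r by (simp add: norm_divide field_simps)
      from z[OF this] show ?thesis by (simp add: cauchy_transform_def)
    qed simp
    with sums_mult[OF s, of \<sigma>] have "(\<lambda>n. \<sigma> * (\<sigma> ^ n * b n 0)) sums 0" by simp
    then have "(\<lambda>n. c (Suc n) * \<sigma> ^ Suc n) sums 0" by (simp add: c_def mult_ac)
    then show "(\<lambda>n. c n * \<sigma> ^ n) sums 0" by (subst (asm) sums_Suc_iff) (simp add: c_def)
  qed
  then show ?thesis by (simp add: c_def)
qed

end

text \<open>
  With \<open>T\<close> a high power of \<open>\<Theta>\<close>, the Cauchy transform of \<open>T(S\<^sub>1) b\<close> is \<open>T\<close> times the resolvent plus a
  polynomial. It has removable singularities at the zeros of \<open>\<Theta>\<close>, because the resolvent grows at most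
  polynomially there, and tends to zero at infinity. By Liouville it vanishes, and with it the sequence
  \<open>T(S\<^sub>1) b\<close>. The exponent of \<open>\<Theta>\<close> depends on \<open>q\<close> only, so one \<open>T\<close> serves all \<open>b\<close>.
\<close>

lemma recurrence_in_first_index:
  fixes \<Theta> :: "complex poly"
  assumes p: "p \<ge> 1" and I: "finite I" and m: "\<And>L. L \<in> I \<Longrightarrow> snd L \<le> m" "m > 0"
    and \<Theta>: "\<Theta> \<noteq> 0"
    and card: "\<And>x. poly \<Theta> x \<noteq> 0 \<Longrightarrow> card {y. bipoly g I x y = 0} = m"
    and simple: "\<And>x y. poly \<Theta> x \<noteq> 0 \<Longrightarrow> bipoly g I x y = 0 \<Longrightarrow> bipoly_dy g I x y \<noteq> 0"
    and N: "\<And>x y. poly \<Theta> x \<noteq> 0 \<Longrightarrow> bipoly g I x y = 0 \<Longrightarrow> egauge p (x, y) > 1"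
    and C0: "C0 > 0"
    and est: "\<And>x y X. cmod x \<le> 2 \<Longrightarrow> poly \<Theta> x \<noteq> 0 \<Longrightarrow> bipoly g I x y = 0 \<Longrightarrow> X = C0 / cmod (poly \<Theta> x) ^ k0 \<Longrightarrow>
        1 \<le> X \<and> cmod x \<le> X \<and> cmod y \<le> X \<and> 1 / X \<le> cmod x \<and> 1 / X \<le> cmod y \<and> 1 / X \<le> cmod (bipoly_dy g I x y)
        \<and> (\<forall>x'\<in>ball x (1 / X). poly \<Theta> x' \<noteq> 0)"
  obtains T :: "complex poly" where "T \<noteq> 0"
    "\<And>b C n l. growth p C b \<Longrightarrow> C \<ge> 0 \<Longrightarrow> (\<And>k l. (\<Sum>L\<in>I. g L * b (k + fst L) (l + snd L)) = 0)
       \<Longrightarrow> shift_poly (1, 0) T b n l = 0"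
proof -
  define D where "D = Max (insert 0 ((\<lambda>L. fst L + snd L) ` I))"
  have D: "fst L + snd L \<le> D" if "L \<in> I" for L using that I unfolding D_def by (intro Max_ge) auto
  obtain A k where A: "A \<ge> 0" and bd: "\<forall>X x y b C. tame_point p g I X x y \<longrightarrow> growth p C b \<longrightarrow> C \<ge> 0 \<longrightarrow>
       (\<forall>k l. (\<Sum>L\<in>I. g L * b (k + fst L) (l + snd L)) = 0) \<longrightarrow>
       cmod (branch_val p g I b (x, y)) \<le> A * C * X ^ k"
    using branch_val_poly_bound[OF p I, where D = D and g = g] D by blast
  define n2 where "n2 = k0 * Suc k"
  define T where "T = \<Theta> ^ Suc n2"
  have T0: "T \<noteq> 0" using \<Theta> by (simp add: T_def)
  define U where "U = {x. poly \<Theta> x \<noteq> 0}"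
  have finK: "finite {x. poly \<Theta> x = 0}" by (rule poly_roots_finite[OF \<Theta>])
  have "U = - {x. poly \<Theta> x = 0}" by (auto simp: U_def)
  then have U: "open U" using finK by (simp add: finite_imp_closed open_Compl)
  have main: "shift_poly (1, 0) T b n 0 = 0"
    if b: "growth p C b" and C: "C \<ge> 0" and ann: "\<And>k l. (\<Sum>L\<in>I. g L * b (k + fst L) (l + snd L)) = 0" for b C n
  proof -
    let ?R = "resolvent p g I b"
    have R_hol: "?R holomorphic_on U"
      by (rule resolvent_holomorphic[OF p b C I ann U _ m(2)]) (use card simple N in \<open>auto simp: U_def\<close>)
    have R_out: "?R x = cauchy_transform b x" if "x \<in> U" "cmod x > 1" for x
      unfolding cauchy_transform_def
      by (rule resolvent_outside[OF p b C I ann m]) (use that card simple N in \<open>auto simp: U_def\<close>)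
    have R_in: "cmod (?R x) * cmod (poly \<Theta> x) ^ n2 \<le> real m * (A * C * C0 ^ Suc k)" if x: "x \<in> U" "cmod x \<le> 2" for x
    proof -
      define X where "X = C0 / cmod (poly \<Theta> x) ^ k0"
      have \<Theta>x: "poly \<Theta> x \<noteq> 0" using x by (simp add: U_def)
      have "cmod (?R x) \<le> (\<Sum>y | bipoly g I x y = 0. A * C * X ^ k * X)"
        unfolding resolvent_def
      proof (rule sum_norm_le)
        fix y assume "y \<in> {y. bipoly g I x y = 0}"
        then have y: "bipoly g I x y = 0" by simp
        note e = est[OF x(2) \<Theta>x y X_def]
        have "tame_point p g I X x y"
          unfolding tame_point_def using e y N by blast
        then have v: "cmod (branch_val p g I b (x, y)) \<le> A * C * X ^ k"
          using bd[rule_format, of X x y C b] b C ann by simp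
        have "1 / cmod (bipoly_dy g I x y) \<le> X"
          using e simple[OF \<Theta>x y] by (auto simp: field_simps)
        then have "cmod (branch_val p g I b (x, y)) * (1 / cmod (bipoly_dy g I x y)) \<le> A * C * X ^ k * X"
          using v A C e by (intro mult_mono) auto
        then show "cmod (branch_val p g I b (x, y) / bipoly_dy g I x y) \<le> A * C * X ^ k * X"
          by (simp add: norm_divide)
      qed
      also have "\<dots> = real m * (A * C * X ^ Suc k)" by (simp add: card[OF \<Theta>x])
      finally have "cmod (?R x) * cmod (poly \<Theta> x) ^ n2 \<le> real m * (A * C * X ^ Suc k) * cmod (poly \<Theta> x) ^ n2"
        by (intro mult_right_mono) auto
      also have "X ^ Suc k = C0 ^ Suc k / cmod (poly \<Theta> x) ^ n2"
        unfolding X_def power_divide n2_def power_mult ..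
      also have "real m * (A * C * (C0 ^ Suc k / cmod (poly \<Theta> x) ^ n2)) * cmod (poly \<Theta> x) ^ n2 = real m * (A * C * C0 ^ Suc k)"
        using \<Theta>x by simp
      finally show ?thesis .
    qed
    obtain P where P: "\<And>x. cmod x > 1 \<Longrightarrow> cauchy_transform (shift_poly (1, 0) T b) x = poly T x * cauchy_transform b x + poly P x"
      using cauchy_transform_shift_poly[OF p b C, of T] by blast
    obtain C' where C': "C' \<ge> 0" "growth p C' (shift_poly (1, 0) T b)" using growth_shift_poly[OF p b C] by blast
    define E where "E x = poly T x * ?R x + poly P x" for x
    have E_out: "E x = cauchy_transform (shift_poly (1, 0) T b) x" if "x \<in> U" "cmod x > 1" for x
      using P[OF that(2)] R_out[OF that] by (simp add: E_def)
    \<comment> \<open>Outside the closed unit disc the resolvent is the Cauchy transform, which is continuous, so the polynomial bound is only needed for \<open>\<bar>z\<bar> < 2\<close>.\<close>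
    have TR: "((\<lambda>x. poly T x * ?R x) \<longlongrightarrow> 0) (at z)" if z: "poly \<Theta> z = 0" for z
    proof -
      have evU: "\<forall>\<^sub>F x in at z. x \<in> U"
      proof -
        have "open (- ({x. poly \<Theta> x = 0} - {z}))"
          using finK by (intro open_Compl finite_imp_closed) simp
        then have "\<forall>\<^sub>F x in at z. x \<in> - ({x. poly \<Theta> x = 0} - {z})"
          by (rule eventually_at_in_open') simp
        moreover have "\<forall>\<^sub>F x in at z. x \<noteq> z" by (simp add: eventually_at_filter)
        ultimately show ?thesis by eventually_elim (auto simp: U_def)
      qed
      have polylim: "((\<lambda>x. poly Q x) \<longlongrightarrow> poly Q z) (at z)" for Q :: "complex poly"
        using poly_isCont[of z Q] by (simp add: isCont_def)
      show ?thesis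
      proof (cases "cmod z < 2")
        case True
        have "\<forall>\<^sub>F x in at z. x \<in> ball 0 2" using True by (intro eventually_at_in_open') auto
        with evU have ev: "\<forall>\<^sub>F x in at z. cmod (poly T x * ?R x) \<le> cmod (poly \<Theta> x) * (real m * (A * C * C0 ^ Suc k))"
        proof eventually_elim
          case (elim x)
          then have "cmod (poly \<Theta> x) * (cmod (?R x) * cmod (poly \<Theta> x) ^ n2) \<le> cmod (poly \<Theta> x) * (real m * (A * C * C0 ^ Suc k))"
            by (intro mult_left_mono R_in) auto
          then show ?case by (simp add: T_def norm_mult norm_power mult_ac)
        qed
        have "((\<lambda>x. cmod (poly \<Theta> x) * (real m * (A * C * C0 ^ Suc k))) \<longlongrightarrow> cmod (poly \<Theta> z) * (real m * (A * C * C0 ^ Suc k))) (at z)"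
          by (intro tendsto_intros polylim)
        then have lim0: "((\<lambda>x. cmod (poly \<Theta> x) * (real m * (A * C * C0 ^ Suc k))) \<longlongrightarrow> 0) (at z)"
          using z by simp
        show ?thesis by (rule Lim_null_comparison[OF ev lim0])
      next
        case False
        have "\<forall>\<^sub>F x in at z. x \<in> - cball 0 1" using False by (intro eventually_at_in_open') auto
        with evU have ev: "\<forall>\<^sub>F x in at z. poly T x * ?R x = poly T x * cauchy_transform b x"
          by eventually_elim (auto simp: R_out)
        have "isCont (cauchy_transform b) z"
        proof -
          have z0: "z \<noteq> 0" using False by auto
          have "(\<lambda>\<sigma>. fantappie (\<sigma>, 0) b 0 0) holomorphic_on ball 0 1"
            using fantappie_ray_holomorphic[OF p dual_le_e1[OF p] _ b C, of 0 0] by simp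
          then have "\<forall>\<sigma>\<in>ball 0 1. isCont (\<lambda>\<sigma>. fantappie (\<sigma>, 0) b 0 0) \<sigma>"
            using holomorphic_on_imp_continuous_on continuous_on_eq_continuous_at open_ball by blast
          moreover have "1 / z \<in> ball 0 1"
            using inverse_less_1[of "cmod z"] False by (simp add: norm_divide)
          ultimately have "isCont (\<lambda>\<sigma>. fantappie (\<sigma>, 0) b 0 0) (1 / z)" by blast
          moreover have "isCont (\<lambda>x. 1 / x) z" using z0 by (intro continuous_intros) auto
          ultimately have "isCont (\<lambda>x. fantappie (1 / x, 0) b 0 0) z"
            using isCont_o2[of z "\<lambda>x. 1 / x" "\<lambda>\<sigma>. fantappie (\<sigma>, 0) b 0 0"] by simp
          then show ?thesis
            unfolding cauchy_transform_def using z0 by (intro continuous_intros) auto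
        qed
        then have "((\<lambda>x. poly T x * cauchy_transform b x) \<longlongrightarrow> poly T z * cauchy_transform b z) (at z)"
          by (intro tendsto_mult polylim) (simp add: isCont_def)
        moreover have "poly T z = 0" using z by (simp add: T_def)
        ultimately have "((\<lambda>x. poly T x * cauchy_transform b x) \<longlongrightarrow> 0) (at z)" by simp
        then show ?thesis using tendsto_cong[OF ev] by blast
      qed
    qed
    have "E holomorphic_on UNIV"
    proof (rule no_isolated_singularity'[where K = "{x. poly \<Theta> x = 0}"])
      fix z assume "z \<in> {x. poly \<Theta> x = 0}"
      then have z: "poly \<Theta> z = 0" by simp
      have "((\<lambda>x. poly T x * ?R x + poly P x) \<longlongrightarrow> 0 + poly P z) (at z)"
        using poly_isCont[of z P] by (intro tendsto_add TR[OF z]) (simp add: isCont_def)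
      then show "(E \<longlongrightarrow> E z) (at z within UNIV)" using z by (simp add: E_def[abs_def] T_def)
    next
      show "E holomorphic_on UNIV - {x. poly \<Theta> x = 0}"
        unfolding E_def using R_hol by (intro holomorphic_intros) (auto simp: U_def intro: holomorphic_on_subset)
    qed (use finK in auto)
    moreover have "(E \<longlongrightarrow> 0) at_infinity"
    proof (rule Lim_null_comparison)
      obtain B where B: "\<And>x. poly \<Theta> x = 0 \<Longrightarrow> cmod x \<le> B"
        using finite_imp_bounded[OF finK] by (auto simp: bounded_iff)
      show "\<forall>\<^sub>F x in at_infinity. cmod (E x) \<le> 32 * C' / cmod x"
      proof (subst eventually_at_infinity, intro exI[of _ "max 2 (B + 1)"] allI impI)
        fix x assume x: "max 2 (B + 1) \<le> cmod x"
        have "poly \<Theta> x \<noteq> 0" using B[of x] x by auto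
        then have "E x = cauchy_transform (shift_poly (1, 0) T b) x" using x by (intro E_out) (auto simp: U_def)
        then show "cmod (E x) \<le> 32 * C' / cmod x" using cauchy_transform_bound[OF p C'(2,1)] x by simp
      qed
      show "((\<lambda>x. 32 * C' / cmod x) \<longlongrightarrow> 0) at_infinity"
        by (intro tendsto_divide_0[OF tendsto_const] filterlim_at_top_imp_at_infinity filterlim_norm_at_top)
    qed
    ultimately have E0: "E x = 0" for x by (rule Liouville_weak_0)
    obtain B where B: "\<And>x. poly \<Theta> x = 0 \<Longrightarrow> cmod x \<le> B"
      using finite_imp_bounded[OF finK] by (auto simp: bounded_iff)
    show ?thesis
    proof (rule cauchy_transform_eq_0[OF p C'(2,1), where r = "max 2 B"])
      fix x assume "cmod x > max 2 B"
      then show "cauchy_transform (shift_poly (1, 0) T b) x = 0"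
        using E_out[of x] E0[of x] B[of x] by (auto simp: U_def)
    qed simp
  qed
  \<comment> \<open>The rows \<open>l > 0\<close> are reduced to row \<open>0\<close> by shifting the second index, under which the hypotheses are stable.\<close>
  have "shift_poly (1, 0) T b n l = 0"
    if b: "growth p C b" and C: "C \<ge> 0" and ann: "\<And>k l. (\<Sum>L\<in>I. g L * b (k + fst L) (l + snd L)) = 0" for b C n l
  proof -
    have "growth p (C * real (0 + l + 1)) (\<lambda>i j. b (i + 0) (j + l))" by (rule growth_shift[OF p b C])
    then have g: "growth p (C * real (l + 1)) (\<lambda>i j. b i (j + l))" by simp
    have "shift_poly (1, 0) T (\<lambda>i j. b i (j + l)) n 0 = 0"
    proof (rule main[OF g])
      show "(\<Sum>L\<in>I. g L * b (k + fst L) (l' + snd L + l)) = 0" for k l'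
        using ann[of k "l' + l"] by (simp add: add_ac)
    qed (use C in simp)
    then show ?thesis by (simp add: shift_poly_def)
  qed
  then show ?thesis by (rule that[OF T0])
qed

section \<open>The exceptional first coordinates\<close>

text \<open>
  An element \<open>h\<close> of least degree in the ideal generated by \<open>q\<close> and its derivative divides the
  product of \<open>q\<close> with a nonzero polynomial in the inner variable, by pseudo-division. The prime \<open>q\<close> then
  divides \<open>h\<close>, which is impossible as the degree of \<open>h\<close> is at most that of the derivative, or the
  cofactor, and then \<open>h\<close> has degree zero.
\<close>

lemma eliminate_outer_variable:
  fixes q :: "complex poly poly"
  assumes irr: "irreducible q" and deg: "degree q > 0"
  obtains A B D where "A * q + B * pderiv q = [:D:]" "D \<noteq> 0"
proof -
  define J where "J = {A * q + B * pderiv q | A B. True}"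
  have Jq: "q \<in> J" unfolding J_def by (rule CollectI, rule exI[of _ 1], rule exI[of _ 0]) simp
  have Jp: "pderiv q \<in> J" unfolding J_def by (rule CollectI, rule exI[of _ 0], rule exI[of _ 1]) simp
  have Jsub: "f * u - h * v \<in> J" if "f \<in> J" "h \<in> J" for f h u v
  proof -
    obtain A B A' B' where "f = A * q + B * pderiv q" "h = A' * q + B' * pderiv q"
      using \<open>f \<in> J\<close> \<open>h \<in> J\<close> unfolding J_def by blast
    then have "f * u - h * v = (A * u - A' * v) * q + (B * u - B' * v) * pderiv q"
      by (simp add: algebra_simps)
    then show ?thesis unfolding J_def by blast
  qed
  have q0: "q \<noteq> 0" using deg by auto
  have p0: "pderiv q \<noteq> 0" using deg by (simp add: pderiv_eq_0_iff)
  define n where "n = (LEAST n. \<exists>h. h \<in> J \<and> h \<noteq> 0 \<and> degree h = n)"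
  have "\<exists>h. h \<in> J \<and> h \<noteq> 0 \<and> degree h = n"
    unfolding n_def by (rule LeastI_ex) (use Jq q0 in blast)
  then obtain h where h: "h \<in> J" "h \<noteq> 0" "degree h = n" by blast
  have min: "degree h \<le> degree f" if "f \<in> J" "f \<noteq> 0" for f
    unfolding h(3) n_def by (rule Least_le) (use that in blast)
  have "degree h = 0"
  proof (rule ccontr)
    assume nz: "degree h \<noteq> 0"
    obtain s r where sr: "pseudo_divmod q h = (s, r)" by fastforce
    define e where "e = coeff h (degree h) ^ (Suc (degree q) - degree h)"
    have e0: "e \<noteq> 0" using h(2) by (simp add: e_def)
    have eq: "smult e q = h * s + r" and r: "r = 0 \<or> degree r < degree h"
      using pseudo_divmod[OF h(2) sr] by (auto simp: e_def)
    have r_eq: "r = q * [:e:] - h * s" using eq by (simp add: mult.commute algebra_simps)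
    have "r \<in> J" unfolding r_eq by (rule Jsub[OF Jq h(1)])
    with r min have "r = 0" by fastforce
    then have hs: "smult e q = h * s" using eq by simp
    have "prime_elem q" using irr by (rule irreducible_imp_prime_elem_gcd)
    moreover have "q dvd h * s" unfolding hs[symmetric] by (rule dvd_smult) simp
    ultimately have "q dvd h \<or> q dvd s" by (simp add: prime_elem_dvd_mult_iff)
    then show False
    proof
      assume "q dvd h"
      then have "degree q \<le> degree h" using h(2) by (rule dvd_imp_degree_le)
      also have "\<dots> \<le> degree (pderiv q)" by (rule min[OF Jp p0])
      finally show False using deg by (simp add: degree_pderiv)
    next
      assume "q dvd s"
      then obtain s' where "s = q * s'" by (auto elim: dvdE)
      then have "q * [:e:] = q * (h * s')" using hs by (simp add: mult_ac)
      then have "[:e:] = h * s'" using q0 mult_left_cancel[of q] by blast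
      moreover from this e0 have "s' \<noteq> 0" by auto
      ultimately have "degree [:e:] = degree h + degree s'" using h(2) by (simp add: degree_mult_eq)
      then show False using nz by simp
    qed
  qed
  then obtain D where D: "h = [:D:]" by (metis degree_eq_zeroE)
  obtain A B where "A * q + B * pderiv q = h" using h(1) unfolding J_def by blast
  with D h(2) that show ?thesis by auto
qed

lemma eval2_eq_sum: "eval2 q (x, y) = (\<Sum>j\<le>degree q. poly (coeff q j) x * y ^ j)"
proof -
  have "poly q [:y:] = (\<Sum>j\<le>degree q. coeff q j * [:y:] ^ j)" by (rule poly_altdef)
  moreover have "poly ([:y:] ^ j) x = y ^ j" for j by (simp add: poly_power)
  ultimately show ?thesis by (simp add: eval2_def poly_sum)
qed

lemma eval2_add: "eval2 (q + r) z = eval2 q z + eval2 r z"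
  and eval2_mult: "eval2 (q * r) z = eval2 q z * eval2 r z"
  and eval2_const: "eval2 [:D:] z = poly D (fst z)"
  by (simp_all add: eval2_def)

definition poly_coeffs :: "complex poly poly \<Rightarrow> nat \<times> nat \<Rightarrow> complex" where
  "poly_coeffs q L = coeff (coeff q (snd L)) (fst L)"

text \<open>
  A rectangle of indices containing all nonzero coefficients; the inner variable of
  \<open>complex poly poly\<close> is the first coordinate.
\<close>

definition poly_support :: "complex poly poly \<Rightarrow> (nat \<times> nat) set" where
  "poly_support q = {..Max ((\<lambda>j. degree (coeff q j)) ` {..degree q})} \<times> {..degree q}"

lemma finite_poly_support [simp]: "finite (poly_support q)"
  by (simp add: poly_support_def)

lemma poly_coeffs_outside: "L \<notin> poly_support q \<Longrightarrow> poly_coeffs q L = 0"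
proof -
  assume L: "L \<notin> poly_support q"
  show ?thesis
  proof (cases "snd L \<le> degree q")
    case True
    then have "degree (coeff q (snd L)) \<le> Max ((\<lambda>j. degree (coeff q j)) ` {..degree q})"
      by (intro Max_ge) auto
    moreover have "fst L > Max ((\<lambda>j. degree (coeff q j)) ` {..degree q})"
      using L True by (cases L) (auto simp: poly_support_def not_le)
    ultimately have "fst L > degree (coeff q (snd L))" by linarith
    then show ?thesis by (simp add: poly_coeffs_def coeff_eq_0)
  next
    case False
    then show ?thesis by (simp add: poly_coeffs_def coeff_eq_0)
  qed
qed

lemma sum_poly_support:
  assumes deg: "\<And>j. j \<le> degree q \<Longrightarrow> f j = (\<Sum>i\<le>degree (coeff q j). coeff (coeff q j) i * h i j)"
  shows "(\<Sum>L\<in>poly_support q. poly_coeffs q L * h (fst L) (snd L)) = (\<Sum>j\<le>degree q. f j)"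
proof -
  let ?d = "Max ((\<lambda>j. degree (coeff q j)) ` {..degree q})"
  have "(\<Sum>L\<in>poly_support q. poly_coeffs q L * h (fst L) (snd L))
      = (\<Sum>i\<le>?d. \<Sum>j\<le>degree q. coeff (coeff q j) i * h i j)"
    by (simp add: poly_support_def poly_coeffs_def sum.cartesian_product case_prod_unfold)
  also have "\<dots> = (\<Sum>j\<le>degree q. \<Sum>i\<le>?d. coeff (coeff q j) i * h i j)" by (rule sum.swap)
  also have "\<dots> = (\<Sum>j\<le>degree q. f j)"
  proof (intro sum.cong refl)
    fix j assume j: "j \<in> {..degree q}"
    then have "degree (coeff q j) \<le> ?d" by (intro Max_ge) auto
    then show "(\<Sum>i\<le>?d. coeff (coeff q j) i * h i j) = f j"
      using deg j by (simp, intro sum.mono_neutral_right) (auto simp: coeff_eq_0)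
  qed
  finally show ?thesis .
qed

lemma bipoly_poly_coeffs: "bipoly (poly_coeffs q) (poly_support q) x y = eval2 q (x, y)"
proof -
  have "bipoly (poly_coeffs q) (poly_support q) x y
     = (\<Sum>L\<in>poly_support q. poly_coeffs q L * (x ^ fst L * y ^ snd L))"
    by (simp add: bipoly_def mult.assoc)
  also have "\<dots> = (\<Sum>j\<le>degree q. poly (coeff q j) x * y ^ j)"
    by (rule sum_poly_support[where h = "\<lambda>i j. x ^ i * y ^ j"])
       (simp add: poly_altdef[of "coeff q _"] sum_distrib_right mult.assoc)
  finally show ?thesis by (simp add: eval2_eq_sum)
qed

lemma yslice_poly_coeffs: "yslice (poly_coeffs q) (poly_support q) x = map_poly (\<lambda>c. poly c x) q"
proof (rule poly_eqI)
  fix n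
  have "coeff (yslice (poly_coeffs q) (poly_support q) x) n
      = (\<Sum>L\<in>poly_support q. poly_coeffs q L * (x ^ fst L * (if snd L = n then 1 else 0)))"
    unfolding yslice_def coeff_sum by (intro sum.cong refl) auto
  also have "\<dots> = (\<Sum>j\<le>degree q. poly (coeff q j) x * (if j = n then 1 else 0))"
    by (rule sum_poly_support[where h = "\<lambda>i j. x ^ i * (if j = n then 1 else 0)"])
       (simp add: poly_altdef[of "coeff q _"] sum_distrib_right mult.assoc)
  also have "\<dots> = (\<Sum>j\<le>degree q. if j = n then poly (coeff q n) x else 0)"
    by (intro sum.cong) auto
  also have "\<dots> = poly (coeff q n) x" by (simp add: coeff_eq_0)
  also have "\<dots> = coeff (map_poly (\<lambda>c. poly c x) q) n" by (simp add: coeff_map_poly)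
  finally show "coeff (yslice (poly_coeffs q) (poly_support q) x) n = coeff (map_poly (\<lambda>c. poly c x) q) n" .
qed

lemma bipoly_dy_poly_coeffs: "bipoly_dy (poly_coeffs q) (poly_support q) x y = eval2 (pderiv q) (x, y)"
proof -
  have "((\<lambda>y. bipoly (poly_coeffs q) (poly_support q) x y) has_field_derivative
      bipoly_dy (poly_coeffs q) (poly_support q) x y) (at y)"
    by (rule bipoly_has_derivative)
  then have "((\<lambda>y. poly (map_poly (\<lambda>c. poly c x) q) y) has_field_derivative
      bipoly_dy (poly_coeffs q) (poly_support q) x y) (at y)"
    by (simp only: poly_yslice[symmetric] yslice_poly_coeffs)
  then have "bipoly_dy (poly_coeffs q) (poly_support q) x y = poly (pderiv (map_poly (\<lambda>c. poly c x) q)) y"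
    using poly_DERIV DERIV_unique by blast
  also have "pderiv (map_poly (\<lambda>c. poly c x) q) = map_poly (\<lambda>c. poly c x) (pderiv q)"
    by (rule poly_eqI) (simp add: coeff_pderiv coeff_map_poly poly_mult)
  also have "poly (map_poly (\<lambda>c. poly c x) (pderiv q)) y = eval2 (pderiv q) (x, y)"
    by (simp only: yslice_poly_coeffs[symmetric] poly_yslice bipoly_poly_coeffs)
  finally show ?thesis .
qed

lemma polys_bounded_on_ball:
  fixes F :: "complex poly set"
  assumes "finite F"
  shows "\<exists>M\<ge>2. \<forall>Q\<in>F. \<forall>x. cmod x \<le> 3 \<longrightarrow> cmod (poly Q x) \<le> M"
  using assms
proof (induction F rule: finite_induct)
  case empty
  then show ?case by (intro exI[of _ 2]) simp
next
  case (insert Q F)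
  then obtain M where M: "M \<ge> 2" "\<forall>Q\<in>F. \<forall>x. cmod x \<le> 3 \<longrightarrow> cmod (poly Q x) \<le> M" by blast
  have "compact ((\<lambda>x. poly Q x) ` cball 0 3)"
    by (intro compact_continuous_image continuous_intros) auto
  then obtain B where B: "\<And>x. cmod x \<le> 3 \<Longrightarrow> cmod (poly Q x) \<le> B"
    using compact_imp_bounded by (force simp: bounded_iff)
  show ?case by (rule exI[of _ "max M B"]) (use M B in \<open>fastforce simp: le_max_iff_disj\<close>)
qed

lemma eval2_bound:
  assumes M: "M \<ge> 0" "\<And>j. j \<le> degree B \<Longrightarrow> cmod (poly (coeff B j) x) \<le> M" and Y: "Y \<ge> 1" "cmod y \<le> Y"
  shows "cmod (eval2 B (x, y)) \<le> real (Suc (degree B)) * M * Y ^ degree B"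
proof -
  have "cmod (eval2 B (x, y)) \<le> (\<Sum>j\<le>degree B. M * Y ^ degree B)"
    unfolding eval2_eq_sum
  proof (rule sum_norm_le)
    fix j assume "j \<in> {..degree B}"
    then have j: "j \<le> degree B" by simp
    have "cmod (poly (coeff B j) x * y ^ j) \<le> M * Y ^ j"
      unfolding norm_mult norm_power using M Y j by (intro mult_mono power_mono) auto
    also have "\<dots> \<le> M * Y ^ degree B"
      using M Y j by (intro mult_left_mono power_increasing) auto
    finally show "cmod (poly (coeff B j) x * y ^ j) \<le> M * Y ^ degree B" .
  qed
  then show ?thesis by simp
qed

lemma outer_root_upper_bound:
  assumes M: "M \<ge> 0" "\<And>j. j \<le> degree q \<Longrightarrow> cmod (poly (coeff q j) x) \<le> M"
    and root: "eval2 q (x, y) = 0" and deg: "degree q > 0" and y: "cmod y \<ge> 1"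
  shows "cmod (poly (lead_coeff q) x) * cmod y \<le> real (degree q) * M"
proof -
  let ?m = "degree q"
  have "poly (lead_coeff q) x * y ^ ?m + (\<Sum>j<?m. poly (coeff q j) x * y ^ j) = 0"
    using root unfolding eval2_eq_sum by (simp add: lessThan_Suc_atMost[symmetric] add.commute)
  then have "poly (lead_coeff q) x * y ^ ?m = - (\<Sum>j<?m. poly (coeff q j) x * y ^ j)"
    by (simp add: eq_neg_iff_add_eq_0)
  then have "cmod (poly (lead_coeff q) x) * cmod y ^ ?m = cmod (\<Sum>j<?m. poly (coeff q j) x * y ^ j)"
    by (metis norm_minus_cancel norm_mult norm_power)
  also have "\<dots> \<le> (\<Sum>j<?m. M * cmod y ^ (?m - 1))"
  proof (rule sum_norm_le)
    fix j assume "j \<in> {..<?m}"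
    then show "cmod (poly (coeff q j) x * y ^ j) \<le> M * cmod y ^ (?m - 1)"
      unfolding norm_mult norm_power using M y by (intro mult_mono power_increasing) auto
  qed
  also have "\<dots> = (real ?m * M) * cmod y ^ (?m - 1)" by simp
  finally have "(cmod (poly (lead_coeff q) x) * cmod y) * cmod y ^ (?m - 1) \<le> (real ?m * M) * cmod y ^ (?m - 1)"
    using deg by (cases "?m") (simp_all add: mult_ac)
  moreover have "cmod y ^ (?m - 1) > 0" using y by (intro zero_less_power) linarith
  ultimately show ?thesis by simp
qed

lemma outer_root_lower_bound:
  assumes M: "M \<ge> 0" "\<And>j. j \<le> degree q \<Longrightarrow> cmod (poly (coeff q j) x) \<le> M"
    and root: "eval2 q (x, y) = 0" and Y: "Y \<ge> 1" "cmod y \<le> Y"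
  shows "cmod (poly (coeff q 0) x) \<le> cmod y * (real (degree q) * M * Y ^ degree q)"
proof -
  let ?m = "degree q"
  have "{..?m} = insert 0 {1..?m}" by auto
  then have "poly (coeff q 0) x = - (\<Sum>j\<in>{1..?m}. poly (coeff q j) x * y ^ j)"
    using root unfolding eval2_eq_sum by (simp add: eq_neg_iff_add_eq_0)
  then have "cmod (poly (coeff q 0) x) = cmod (\<Sum>j\<in>{1..?m}. poly (coeff q j) x * y ^ j)" by simp
  also have "\<dots> \<le> (\<Sum>j\<in>{1..?m}. cmod y * (M * Y ^ ?m))"
  proof (rule sum_norm_le)
    fix j assume j: "j \<in> {1..?m}"
    have "cmod (poly (coeff q j) x * y ^ j) = cmod y * (cmod (poly (coeff q j) x) * cmod y ^ (j - 1))"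
      using j by (cases j) (simp_all add: norm_mult norm_power)
    also have "\<dots> \<le> cmod y * (M * Y ^ (j - 1))"
      using M Y j by (intro mult_left_mono mult_mono power_mono) auto
    also have "\<dots> \<le> cmod y * (M * Y ^ ?m)"
      using M Y j by (intro mult_left_mono power_increasing) auto
    finally show "cmod (poly (coeff q j) x * y ^ j) \<le> cmod y * (M * Y ^ ?m)" .
  qed
  finally show ?thesis by (simp add: mult_ac)
qed

lemma egauge_less_iff_ellipsoid: "z \<in> ellipsoid p \<longleftrightarrow> egauge p z < 1"
  by (simp add: ellipsoid_def egauge_def)

text \<open>
  The first coordinates to be avoided are \<open>0\<close>; those where two roots collide, which are zeros of the
  eliminant \<open>D\<close>; those where a root escapes to infinity (leading coefficient) or vanishes (constant
  coefficient); and those of the finitely many zeros on the frontier. \<open>\<Theta>\<close> is the product of the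
  corresponding polynomials. All quantities at other points are bounded polynomially in \<open>1 / \<bar>\<Theta>(x)\<bar>\<close>,
  because each factor of \<open>\<Theta>\<close> is.
\<close>

lemma annihilator_recurrence:
  fixes q :: "complex poly poly"
  assumes p: "p \<ge> 1" and irr: "irreducible q" and deg: "degree q > 0"
    and nv: "\<forall>z\<in>ellipsoid p. eval2 q z \<noteq> 0"
    and fin: "finite {z. egauge p z = 1 \<and> eval2 q z = 0}"
  obtains T :: "complex poly" where "T \<noteq> 0"
    "\<And>b C n l. growth p C b \<Longrightarrow> C \<ge> 0 \<Longrightarrow>
       (\<And>k l. (\<Sum>L\<in>poly_support q. poly_coeffs q L * b (k + fst L) (l + snd L)) = 0)
       \<Longrightarrow> shift_poly (1, 0) T b n l = 0"
proof -
  let ?g = "poly_coeffs q" and ?I = "poly_support q" and ?m = "degree q"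
  obtain A B D where AB: "A * q + B * pderiv q = [:D:]" "D \<noteq> 0"
    by (rule eliminate_outer_variable[OF irr deg])
  have ABxy: "eval2 A (x, y) * eval2 q (x, y) + eval2 B (x, y) * eval2 (pderiv q) (x, y) = poly D x" for x y
    unfolding eval2_mult[symmetric] eval2_add[symmetric] AB(1) eval2_const by simp
  have root_dy: "eval2 B (x, y) * eval2 (pderiv q) (x, y) = poly D x" if "eval2 q (x, y) = 0" for x y
    using ABxy[of x y] that by simp
  have q0: "coeff q 0 \<noteq> 0"
  proof
    assume c0: "coeff q 0 = 0"
    have "poly (coeff q j) 0 * 0 ^ j = 0" for j :: nat using c0 by (cases j) auto
    then have "eval2 q (0, 0) = 0" unfolding eval2_eq_sum by (intro sum.neutral ballI)
    moreover have "(0, 0) \<in> ellipsoid p" by (simp add: egauge_less_iff_ellipsoid)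
    ultimately show False using nv by blast
  qed
  have lq: "lead_coeff q \<noteq> 0" using deg by auto
  define K where "K = fst ` {z. egauge p z = 1 \<and> eval2 q z = 0}"
  have finK: "finite K" using fin by (simp add: K_def)
  define Z where "Z = (\<Prod>e\<in>K. [:-e, 1:])"
  have Z0: "Z \<noteq> 0" using finK by (simp add: Z_def)
  have Zroot: "poly Z x = 0 \<longleftrightarrow> x \<in> K" for x using finK by (simp add: Z_def poly_prod)
  define \<Theta> where "\<Theta> = [:0, 1:] * D * lead_coeff q * coeff q 0 * Z"
  have \<Theta>0: "\<Theta> \<noteq> 0" using AB(2) lq q0 Z0 by (simp add: \<Theta>_def)
  have \<Theta>nz: "x \<noteq> 0" "poly D x \<noteq> 0" "poly (lead_coeff q) x \<noteq> 0" "poly (coeff q 0) x \<noteq> 0" "x \<notin> K"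
    if "poly \<Theta> x \<noteq> 0" for x using that Zroot[of x] by (auto simp: \<Theta>_def)
  have slice_deg: "degree (yslice ?g ?I x) = ?m" if "poly \<Theta> x \<noteq> 0" for x
  proof -
    have "coeff (yslice ?g ?I x) ?m \<noteq> 0"
      using \<Theta>nz(3)[OF that] by (simp add: yslice_poly_coeffs coeff_map_poly)
    then show ?thesis
      unfolding yslice_poly_coeffs
      by (intro antisym le_degree degree_le) (simp_all add: coeff_map_poly coeff_eq_0)
  qed
  have simple: "bipoly_dy ?g ?I x y \<noteq> 0" if "poly \<Theta> x \<noteq> 0" "bipoly ?g ?I x y = 0" for x y
    using root_dy[of x y] \<Theta>nz(2)[OF that(1)] that(2) unfolding bipoly_poly_coeffs bipoly_dy_poly_coeffs by auto
  have card: "card {y. bipoly ?g ?I x y = 0} = ?m" if "poly \<Theta> x \<noteq> 0" for x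
  proof -
    have "card {y. poly (yslice ?g ?I x) y = 0} = degree (yslice ?g ?I x)"
    proof (rule card_simple_roots)
      show "yslice ?g ?I x \<noteq> 0" using slice_deg[OF that] deg by auto
    qed (use simple[OF that] in \<open>auto simp: poly_yslice poly_pderiv_yslice\<close>)
    then show ?thesis by (simp add: poly_yslice slice_deg[OF that])
  qed
  have N: "egauge p (x, y) > 1" if "poly \<Theta> x \<noteq> 0" "bipoly ?g ?I x y = 0" for x y
  proof -
    have r: "eval2 q (x, y) = 0" using that(2) by (simp add: bipoly_poly_coeffs)
    then have "\<not> egauge p (x, y) < 1" using nv egauge_less_iff_ellipsoid by blast
    moreover have "egauge p (x, y) \<noteq> 1" using r \<Theta>nz(5)[OF that(1)] unfolding K_def by force
    ultimately show ?thesis by linarith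
  qed
  \<comment> \<open>The cofactors of the single factors of \<open>\<Theta>\<close> are included, to bound these factors from below.\<close>
  define F where "F = {\<Theta>, pderiv \<Theta>, D * lead_coeff q * coeff q 0 * Z, [:0, 1:] * lead_coeff q * coeff q 0 * Z,
     [:0, 1:] * D * coeff q 0 * Z, [:0, 1:] * D * lead_coeff q * Z} \<union> coeff q ` {..?m} \<union> coeff B ` {..degree B}"
  have "finite F" by (simp add: F_def)
  then obtain M0 where M0: "M0 \<ge> 2" "\<And>Q x. Q \<in> F \<Longrightarrow> cmod x \<le> 3 \<Longrightarrow> cmod (poly Q x) \<le> M0"
    using polys_bounded_on_ball by meson
  \<comment> \<open>One constant that absorbs the numbers of terms in the estimates for the roots.\<close>
  define M where "M = M0 * real (?m + degree B + 1)"
  have MM: "M0 \<le> M" "real ?m * M0 \<le> M" "real (Suc (degree B)) * M0 \<le> M"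
    using M0(1) mult_left_mono[of 1 "real (?m + degree B + 1)" M0] by (auto simp: M_def algebra_simps)
  have M2: "M \<ge> 2" using MM M0 by linarith
  define kk where "kk = ?m + degree B + 2"
  show ?thesis
  proof (rule recurrence_in_first_index[OF p finite_poly_support _ deg \<Theta>0 card simple N,
      where ?C0.0 = "(M^2) ^ kk" and ?k0.0 = kk])
    show "snd L \<le> ?m" if "L \<in> ?I" for L using that by (auto simp: poly_support_def)
    show "(M^2) ^ kk > 0" using M2 by simp
    fix x y X assume x: "cmod x \<le> 2" and nz: "poly \<Theta> x \<noteq> 0" and root: "bipoly ?g ?I x y = 0"
      and X_eq: "X = (M^2) ^ kk / cmod (poly \<Theta> x) ^ kk"
    have r: "eval2 q (x, y) = 0" using root by (simp add: bipoly_poly_coeffs)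
    define t where "t = M / cmod (poly \<Theta> x)"
    have \<theta>: "cmod (poly \<Theta> x) > 0" using nz by simp
    have \<theta>M: "cmod (poly \<Theta> x) \<le> M" using M0(2)[of \<Theta> x] x MM(1) by (simp add: F_def)
    have t1: "t \<ge> 1" using \<theta> \<theta>M by (simp add: t_def)
    have X_Mt: "X = (M * t) ^ kk"
      unfolding X_eq t_def power_divide[symmetric] by (simp add: power2_eq_square)
    have fac: "1 / t \<le> cmod u" if "poly \<Theta> x = u * v" "cmod v \<le> M" for u v
    proof -
      have "cmod (poly \<Theta> x) \<le> cmod u * M" unfolding that(1) norm_mult using that(2) by (intro mult_left_mono) auto
      then show ?thesis using M2 \<theta> by (simp add: t_def field_simps)
    qed
    have F0: "cmod (poly Q x) \<le> M" if "Q \<in> F" for Q using M0(2)[OF that, of x] x MM(1) by linarith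
    have fx: "1 / t \<le> cmod x"
      by (rule fac[where v = "poly (D * lead_coeff q * coeff q 0 * Z) x"])
         (simp add: \<Theta>_def, rule F0, simp add: F_def)
    have fD: "1 / t \<le> cmod (poly D x)"
      by (rule fac[where v = "poly ([:0, 1:] * lead_coeff q * coeff q 0 * Z) x"])
         (simp add: \<Theta>_def, rule F0, simp add: F_def)
    have fl: "1 / t \<le> cmod (poly (lead_coeff q) x)"
      by (rule fac[where v = "poly ([:0, 1:] * D * coeff q 0 * Z) x"])
         (simp add: \<Theta>_def, rule F0, simp add: F_def)
    have fq: "1 / t \<le> cmod (poly (coeff q 0) x)"
      by (rule fac[where v = "poly ([:0, 1:] * D * lead_coeff q * Z) x"])
         (simp add: \<Theta>_def, rule F0, simp add: F_def)
    have qj: "cmod (poly (coeff q j) x) \<le> M0" if "j \<le> ?m" for j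
      using M0(2)[of "coeff q j" x] x that by (simp add: F_def)
    have Bj: "cmod (poly (coeff B j) x) \<le> M0" if "j \<le> degree B" for j
      using M0(2)[of "coeff B j" x] x that by (simp add: F_def)
    define Y where "Y = M * t"
    have Y: "Y \<ge> 1" "t \<le> Y" "M \<le> Y"
      using M2 t1 mult_mono[of 1 M 1 t] mult_right_mono[of 1 M t] mult_left_mono[of 1 t M] by (auto simp: Y_def)
    have yY: "cmod y \<le> Y"
    proof (cases "cmod y \<ge> 1")
      case True
      have "cmod (poly (lead_coeff q) x) * cmod y \<le> M"
        using outer_root_upper_bound[OF _ qj r deg True] M0(1) MM(2) by linarith
      then have "(1 / t) * cmod y \<le> M" using mult_right_mono[OF fl, of "cmod y"] by simp
      then show ?thesis using t1 by (simp add: Y_def field_simps)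
    qed (use Y in simp)
    have YX: "Y ^ n \<le> X" if "n \<le> kk" for n
      unfolding X_Mt Y_def[symmetric] using Y(1) that by (rule power_increasing[rotated])
    have X1: "X \<ge> 1" "Y \<le> X" using YX[of 0] YX[of 1] by (simp_all add: kk_def)
    have inv: "1 / X \<le> u" if "1 / t \<le> u * Z'" "t * Z' \<le> X" "Z' > 0" for u Z'
    proof -
      have "1 / X \<le> 1 / (t * Z')" using that t1 X1 by (intro divide_left_mono mult_pos_pos) auto
      also have "\<dots> \<le> u" using that t1 by (simp add: field_simps)
      finally show ?thesis .
    qed
    have "1 / X \<le> cmod x" by (rule inv[where Z' = 1]) (use fx Y X1 in auto)
    \<comment> \<open>A root near zero would make the constant coefficient small.\<close>
    moreover have "1 / X \<le> cmod y"
    proof (rule inv[where Z' = "M * Y ^ ?m"])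
      have "cmod (poly (coeff q 0) x) \<le> cmod y * (real ?m * M0 * Y ^ ?m)"
        using outer_root_lower_bound[OF _ qj r Y(1) yY] M0(1) by simp
      also have "\<dots> \<le> cmod y * (M * Y ^ ?m)" using Y MM by (intro mult_left_mono mult_right_mono) auto
      finally show "1 / t \<le> cmod y * (M * Y ^ ?m)" using fq by linarith
      have "t * (M * Y ^ ?m) = Y ^ Suc ?m" by (simp add: Y_def)
      also have "\<dots> \<le> X" by (rule YX) (simp add: kk_def)
      finally show "t * (M * Y ^ ?m) \<le> X" .
    qed (use M2 Y in simp)
    \<comment> \<open>At a zero of \<open>q\<close> the identity for \<open>D\<close> reads \<open>D(x) = B(x, y) \<partial>\<^sub>y q(x, y)\<close>.\<close>
    moreover have "1 / X \<le> cmod (bipoly_dy ?g ?I x y)"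
    proof (rule inv[where Z' = "M * Y ^ degree B"])
      have "cmod (poly D x) = cmod (eval2 (pderiv q) (x, y)) * cmod (eval2 B (x, y))"
        unfolding root_dy[OF r, symmetric] by (simp add: norm_mult)
      also have "\<dots> \<le> cmod (eval2 (pderiv q) (x, y)) * (real (Suc (degree B)) * M0 * Y ^ degree B)"
        using M0(1) by (intro mult_left_mono eval2_bound Bj Y(1) yY) auto
      also have "\<dots> \<le> cmod (eval2 (pderiv q) (x, y)) * (M * Y ^ degree B)"
        using Y MM by (intro mult_left_mono mult_right_mono) auto
      finally show "1 / t \<le> cmod (bipoly_dy ?g ?I x y) * (M * Y ^ degree B)"
        using fD by (simp add: bipoly_dy_poly_coeffs)
      have "t * (M * Y ^ degree B) = Y ^ Suc (degree B)" by (simp add: Y_def)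
      also have "\<dots> \<le> X" by (rule YX) (simp add: kk_def)
      finally show "t * (M * Y ^ degree B) \<le> X" .
    qed (use M2 Y in simp)
    \<comment> \<open>By the mean value inequality \<open>\<Theta>\<close> has no zero that close to \<open>x\<close>.\<close>
    moreover have "poly \<Theta> x' \<noteq> 0" if x': "x' \<in> ball x (1 / X)" for x'
    proof
      assume z: "poly \<Theta> x' = 0"
      have d: "cmod (x - x') < 1 / X" using x' by (simp add: dist_norm)
      have "1 / X \<le> 1" using X1 by simp
      then have d1: "cmod (x - x') < 1" using d by linarith
      have x3: "x' \<in> ball 0 3" "x \<in> ball 0 3" using norm_triangle_ineq[of x "x' - x"] x d1 by (auto simp: norm_minus_commute)
      have "cmod (poly \<Theta> x - poly \<Theta> x') \<le> M * cmod (x - x')"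
      proof (rule field_differentiable_bound[OF convex_ball _ _ x3(2,1)])
        show "((\<lambda>x. poly \<Theta> x) has_field_derivative poly (pderiv \<Theta>) w) (at w within ball 0 3)" for w
          by (rule has_field_derivative_at_within[OF poly_DERIV])
        show "cmod (poly (pderiv \<Theta>) w) \<le> M" if "w \<in> ball 0 3" for w
          using M0(2)[of "pderiv \<Theta>" w] that MM(1) by (auto simp: F_def)
      qed
      then have "cmod (poly \<Theta> x) \<le> M * cmod (x - x')" using z by simp
      also have "\<dots> < M * (1 / X)" using d M2 by (intro mult_strict_left_mono) auto
      also have "\<dots> \<le> M * (1 / t)" using Y(2) X1(2) t1 M2 by (intro mult_left_mono divide_left_mono) auto
      also have "\<dots> = cmod (poly \<Theta> x)" using M2 by (simp add: t_def)
      finally show False by simp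
    qed
    moreover have "cmod x \<le> X" using x M2 Y(3) X1(2) by linarith
    moreover have "cmod y \<le> X" using yY X1(2) by linarith
    ultimately show "1 \<le> X \<and> cmod x \<le> X \<and> cmod y \<le> X \<and> 1 / X \<le> cmod x \<and> 1 / X \<le> cmod y
        \<and> 1 / X \<le> cmod (bipoly_dy ?g ?I x y) \<and> (\<forall>x'\<in>ball x (1 / X). poly \<Theta> x' \<noteq> 0)"
      using X1(1) by blast
  next
    fix T :: "complex poly"
    assume "T \<noteq> 0" "\<And>b C n l. growth p C b \<Longrightarrow> 0 \<le> C \<Longrightarrow>
       (\<And>k l. (\<Sum>L\<in>?I. ?g L * b (k + fst L) (l + snd L)) = 0) \<Longrightarrow> shift_poly (1, 0) T b n l = 0"
    then show ?thesis by (rule that)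
  qed
qed

section \<open>Weights and unbounded point evaluations\<close>

definition bweight :: "real \<Rightarrow> nat \<Rightarrow> nat \<Rightarrow> real" where
  "bweight p i j = Beta (real i / p + 1) (real j / p + 1)"

lemma D_weight_bweight:
  "D_weight p \<beta> (i, j) = 2 powr (- \<beta>) * bweight p i j * real (i + j + 2) powr \<beta>"
proof -
  have e: "real (i + j) / p + 2 = (real i / p + 1) + (real j / p + 1)"
    by (simp add: add_divide_distrib)
  show ?thesis by (simp only: D_weight_def bweight_def Beta_def fst_conv snd_conv e)
qed

lemma Beta_pos: "x \<ge> 0 \<Longrightarrow> y \<ge> 0 \<Longrightarrow> Beta (x + 1) (y + 1) > (0::real)"
  by (simp add: Beta_def Gamma_real_pos)

lemma bweight_pos: "p \<ge> 1 \<Longrightarrow> bweight p i j > 0"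
  unfolding bweight_def by (intro Beta_pos) auto

lemma D_weight_pos: "p \<ge> 1 \<Longrightarrow> D_weight p \<beta> L > 0"
  using bweight_pos[of p "fst L" "snd L"] by (cases L) (simp add: D_weight_bweight)

text \<open>
  The integrand of the Beta integral at \<open>t\<close> is the squared modulus of the monomial at the point
  \<open>(t\<^bsup>1/2p\<^esup>, (1 - t)\<^bsup>1/2p\<^esup>)\<close> of the frontier.
\<close>

lemma bweight_le_monom_sup:
  assumes p: "p \<ge> 1" shows "bweight p i j \<le> (monom_sup p i j)^2"
proof -
  have "Beta (real i / p + 1) (real j / p + 1) \<le> (monom_sup p i j)^2"
  proof (rule has_integral_le)
    show "((\<lambda>t. t powr (real i / p) * (1 - t) powr (real j / p)) has_integral Beta (real i / p + 1) (real j / p + 1)) {0<..<1}"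
      using has_integral_Beta_real[of "real i / p + 1" "real j / p + 1"] p
      by (simp add: has_integral_Icc_iff_Ioo add_nonneg_pos)
    show "((\<lambda>t. (monom_sup p i j)^2) has_integral (monom_sup p i j)^2) {0<..<1::real}"
      using has_integral_const_real[of "(monom_sup p i j)^2" 0 1] by (simp add: has_integral_Icc_iff_Ioo)
    fix t :: real assume t: "t \<in> {0<..<1}"
    define z :: "complex \<times> complex" where "z = (of_real (t powr (1 / (2 * p))), of_real ((1 - t) powr (1 / (2 * p))))"
    have "egauge p z = t + (1 - t)" using t p by (simp add: z_def egauge_def powr_powr)
    then have "(cmod (fst z) ^ i * cmod (snd z) ^ j)^2 \<le> (monom_sup p i j)^2"
      by (intro power_mono monom_sup_upper p) auto
    moreover have "((u powr (1 / (2 * p))) ^ n)^2 = u powr (real n / p)" if "u > 0" for u n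
    proof -
      have "((u powr (1 / (2 * p))) ^ n)^2 = (u powr (1 / (2 * p))) powr (real (2 * n))"
        using that by (subst powr_realpow) (auto simp: power_mult mult.commute)
      then show ?thesis using p by (simp add: powr_powr)
    qed
    ultimately show "t powr (real i / p) * (1 - t) powr (real j / p) \<le> (monom_sup p i j)^2"
      using t by (simp add: z_def power_mult_distrib)
  qed
  then show ?thesis by (simp add: bweight_def)
qed

lemma Beta_nat:
  "Beta (real k + 1) (real m + 1) = 1 / (real (k + m + 1) * real ((k + m) choose k))"
proof -
  have g: "Gamma (real n + 1) = fact n" for n using Gamma_fact[of n, where 'a = real] by (simp add: add.commute)
  have "real k + 1 + (real m + 1) = real (k + m + 1) + 1" by simp
  then have "Beta (real k + 1) (real m + 1) = fact k * fact m / fact (k + m + 1)"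
    unfolding Beta_def g by (simp only: g)
  also have "\<dots> = 1 / (real (k + m + 1) * (fact (k + m) / (fact k * fact m)))"
    by simp
  also have "fact (k + m) / (fact k * fact m) = real ((k + m) choose k)"
    by (subst binomial_fact) auto
  finally show ?thesis .
qed

lemma Beta_1_right: "x \<ge> 0 \<Longrightarrow> Beta (x + 1) 1 = 1 / (x + 1 :: real)"
proof -
  assume x: "x \<ge> 0"
  have eq: "Gamma (x + 1 + 1) = (x + 1) * Gamma (x + 1)" using x by (intro Gamma_plus1) auto
  have "Gamma (x + 1) > 0" using x by (intro Gamma_real_pos) auto
  then have ne: "Gamma (x + 1) \<noteq> 0" by linarith
  show ?thesis unfolding Beta_def eq using ne x by (simp del: Gamma_eq_zero_iff)
qed

lemma bweight_0_right: "p \<ge> 1 \<Longrightarrow> bweight p n 0 = p / (real n + p)"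
  using Beta_1_right[of "real n / p"] by (simp add: bweight_def field_simps)

lemma bweight_commute: "bweight p i j = bweight p j i"
  by (simp add: bweight_def Beta_commute)

lemma growth_of_l2:
  assumes p: "p \<ge> 1" and S: "\<And>i j. (cmod (b i j))^2 \<le> S * D_weight p 2 (i, j)"
  shows "growth p (sqrt S / 2) b"
  unfolding growth_def
proof (intro allI)
  fix i j
  have "S * D_weight p 2 (0, 0) \<ge> 0" using S[of 0 0] by (meson order_trans zero_le_power2)
  then have S0: "S \<ge> 0" using D_weight_pos[OF p, of 2 "(0, 0)"] by (simp add: zero_le_mult_iff)
  have "D_weight p 2 (i, j) = bweight p i j * (real (i + j + 2) / 2)^2"
    by (simp add: D_weight_bweight powr_minus power_divide)
  also have "\<dots> \<le> (monom_sup p i j)^2 * (real (i + j + 2) / 2)^2"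
    by (intro mult_right_mono bweight_le_monom_sup p) auto
  finally have "(cmod (b i j))^2 \<le> S * ((monom_sup p i j)^2 * (real (i + j + 2) / 2)^2)"
    using order_trans[OF S mult_left_mono[OF _ S0]] by blast
  also have "\<dots> = (sqrt S / 2 * real (i + j + 2) * monom_sup p i j)^2"
    using S0 by (simp add: power_mult_distrib power_divide)
  finally show "cmod (b i j) \<le> sqrt S / 2 * real (i + j + 2) * monom_sup p i j"
    by (rule power2_le_imp_le) (use S0 monom_sup_nonneg[OF p] in simp)
qed

lemma harmonic_unbounded:
  assumes "c > 0" "\<And>n. c * (\<Sum>s<n. 1 / real (s + k)) \<le> B" "k > 0"
  shows False
proof -
  have "summable (\<lambda>s. 1 / real (s + k))"
  proof (rule bounded_imp_summable)
    show "(\<Sum>s\<le>n. 1 / real (s + k)) \<le> B / c" for n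
      using assms(1) assms(2)[of "Suc n"] by (simp add: field_simps lessThan_Suc_atMost)
  qed simp
  then have "summable (\<lambda>s. inverse (real s))"
    using summable_iff_shift[of "\<lambda>s. inverse (real s)" k] by (simp add: inverse_eq_divide)
  then show False using not_summable_harmonic by blast
qed

text \<open>
  On the axis the weights of exponent \<open>2\<close> grow linearly, so the terms are at least of harmonic size.
\<close>

lemma point_evaluation_axis_unbounded:
  assumes p: "p \<ge> 1" and x: "cmod x \<ge> 1"
    and S: "\<And>n. (\<Sum>s<n. (cmod x ^ s)^2 / D_weight p 2 (s, 0)) \<le> S"
  shows False
proof (rule harmonic_unbounded[of "2 / p" 2 S])
  show "2 / p > 0" using p by simp
  fix n
  have "2 / p * (\<Sum>s<n. 1 / real (s + 2)) = (\<Sum>s<n. 2 / p * (1 / real (s + 2)))" by (rule sum_distrib_left)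
  also have "\<dots> \<le> (\<Sum>s<n. (cmod x ^ s)^2 / D_weight p 2 (s, 0))"
  proof (rule sum_mono)
    fix s
    have "real s + 2 \<le> 2 * (real s + p)" using p of_nat_0_le_iff[of s, where 'a = real] by argo
    then have "(real s + 2) / (2 * (real s + p)) \<le> 1" using p by (simp add: divide_le_eq)
    moreover have "2 / p * (1 / real (s + 2)) * D_weight p 2 (s, 0) = (real s + 2) / (2 * (real s + p))"
    proof -
      have "2 / p * (1 / u) * (1 / 4 * (p / w) * u^2) = u / (2 * w)" if "u > 0" "w > 0" for u w
        using that p by (simp add: field_simps power2_eq_square)
      from this[of "real s + 2" "real s + p"] show ?thesis
        using p by (simp add: D_weight_bweight powr_minus bweight_0_right add.commute)
    qed
    ultimately have "2 / p * (1 / real (s + 2)) * D_weight p 2 (s, 0) \<le> 1" by simp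
    also have "1 \<le> (cmod x ^ s)^2" using x by (simp add: one_le_power)
    finally show "2 / p * (1 / real (s + 2)) \<le> (cmod x ^ s)^2 / D_weight p 2 (s, 0)"
      using D_weight_pos[OF p, of 2 "(s, 0)"] by (simp add: pos_le_divide_eq)
  qed
  also have "\<dots> \<le> S" by (rule S)
  finally show "2 / p * (\<Sum>s<n. 1 / real (s + 2)) \<le> S" .
qed simp

text \<open>
  Restrict the sum to indices \<open>(\<lceil>p k\<rceil>, \<lceil>p m\<rceil>)\<close>, which are distinct as \<open>p \<ge> 1\<close>. There the Beta factor
  is at most its value at integers, a reciprocal binomial coefficient over \<open>k + m + 1\<close>. With
  \<open>a + b = 1\<close>, obtained from \<open>\<bar>x\<bar>\<^bsup>2p\<^esup>\<close> and \<open>\<bar>y\<bar>\<^bsup>2p\<^esup>\<close> by normalisation, the terms with \<open>k + m = s\<close> add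
  up to a constant times \<open>(a + b)\<^sup>s / (s + 1)\<close>.
\<close>

lemma point_evaluation_unbounded_interior:
  assumes p: "p \<ge> 1" and v: "egauge p (x, y) \<ge> 1" "x \<noteq> 0" "y \<noteq> 0"
    and S: "\<And>A. finite A \<Longrightarrow> (\<Sum>L\<in>A. (cmod x ^ fst L * cmod y ^ snd L)^2 / D_weight p 2 L) \<le> S"
  shows False
proof -
  define N where "N = egauge p (x, y)"
  have N: "N \<ge> 1" using v by (simp add: N_def)
  define a b where "a = cmod x powr (2 * p) / N" and "b = cmod y powr (2 * p) / N"
  have ab: "a > 0" "b > 0" "a + b = 1"
  proof -
    show "a > 0" "b > 0" unfolding a_def b_def using v N by auto
    have "a + b = N / N" unfolding a_def b_def N_def egauge_def by (simp only: add_divide_distrib fst_conv snd_conv)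
    then show "a + b = 1" using N by simp
  qed
  then have ab1: "a < 1" "b < 1" by linarith+
  have pw: "(t powr (2 * p) / N) powr (real i / p) \<le> (t ^ i)^2" if "t > 0" for t i
  proof -
    have "(t powr (2 * p) / N) powr (real i / p) \<le> (t powr (2 * p)) powr (real i / p)"
      using N that p by (intro powr_mono2) (auto simp: divide_le_eq mult_le_cancel_left1)
    also have "\<dots> = t powr (real (2 * i))" using p by (simp add: powr_powr)
    also have "\<dots> = (t ^ i)^2" using that by (subst powr_realpow) (auto simp: power_mult mult.commute)
    finally show ?thesis .
  qed
  define c where "c k = nat \<lceil>p * real k\<rceil>" for k
  have c: "p * real k \<le> real (c k)" "real (c k) < p * real k + 1" for k
  proof -
    have "0 \<le> p * real k" using p by simp
    then have "real (c k) = of_int \<lceil>p * real k\<rceil>" by (simp add: c_def)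
    then show "p * real k \<le> real (c k)" "real (c k) < p * real k + 1"
      using ceiling_correct[of "p * real k"] by linarith+
  qed
  have c_mono: "c k < c l" if "k < l" for k l
  proof -
    have "p * real k + 1 \<le> p * real k + p * 1" using p by simp
    also have "\<dots> = p * (real k + 1)" by (simp add: algebra_simps)
    also have "\<dots> \<le> p * real l" using that p by (intro mult_left_mono) auto
    finally have "real (c k) < real (c l)" using c(2)[of k] c(1)[of l] by linarith
    then show ?thesis by simp
  qed
  have c_inj: "inj c" using c_mono by (intro strict_mono_imp_inj_on strict_monoI)
  have ck: "real k \<le> real (c k) / p" "real (c k) / p \<le> real k + 1" for k
    using c[of k] p by (auto simp: field_simps)
  have term_ge: "a * b / (4 * p^2) * (real ((k + m) choose k) * a ^ k * b ^ m / real (k + m + 1))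
      \<le> (cmod x ^ c k * cmod y ^ c m)^2 / D_weight p 2 (c k, c m)" for k m
  proof -
    have "a ^ Suc k * b ^ Suc m = a powr (real k + 1) * b powr (real m + 1)"
      using ab powr_realpow[of a "Suc k"] powr_realpow[of b "Suc m"] by (simp add: add.commute)
    also have "\<dots> \<le> a powr (real (c k) / p) * b powr (real (c m) / p)"
      using ab ab1 ck by (intro mult_mono powr_mono') auto
    also have "\<dots> \<le> (cmod x ^ c k)^2 * (cmod y ^ c m)^2"
      unfolding a_def b_def using v by (intro mult_mono pw) auto
    finally have num: "a ^ Suc k * b ^ Suc m \<le> (cmod x ^ c k * cmod y ^ c m)^2" by (simp add: power_mult_distrib)
    have "bweight p (c k) (c m) \<le> Beta (real k + 1) (real m + 1)"
      unfolding bweight_def using ck by (intro Beta_real_mono) auto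
    then have B: "bweight p (c k) (c m) \<le> 1 / (real (k + m + 1) * real ((k + m) choose k))"
      by (simp only: Beta_nat)
    have "0 \<le> p * real k" "0 \<le> p * real m" using p by auto
    moreover have "real (c k + c m + 2) \<le> 4 * p + (p * real k + p * real m)"
      using c(2)[of k] c(2)[of m] p by simp
    moreover have "4 * p * real (k + m + 1) = 4 * p + 4 * (p * real k) + 4 * (p * real m)"
      by (simp add: algebra_simps)
    ultimately have "real (c k + c m + 2) \<le> 4 * p * real (k + m + 1)" by linarith
    then have "(real (c k + c m + 2))^2 \<le> (4 * p * real (k + m + 1))^2" by (intro power_mono) auto
    then have "D_weight p 2 (c k, c m) \<le> (1 / (real (k + m + 1) * real ((k + m) choose k))) * ((4 * p * real (k + m + 1))^2 / 4)"
    proof -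
      have "D_weight p 2 (c k, c m) = bweight p (c k) (c m) * ((real (c k + c m + 2))^2 / 4)"
        by (simp add: D_weight_bweight powr_minus)
      also have "\<dots> \<le> (1 / (real (k + m + 1) * real ((k + m) choose k))) * ((4 * p * real (k + m + 1))^2 / 4)"
        using \<open>(real (c k + c m + 2))^2 \<le> (4 * p * real (k + m + 1))^2\<close> B
        by (intro mult_mono divide_right_mono) auto
      finally show ?thesis .
    qed
    also have "\<dots> = 4 * p^2 * real (k + m + 1) / real ((k + m) choose k)"
      by (simp add: power2_eq_square)
    finally have den: "D_weight p 2 (c k, c m) \<le> 4 * p^2 * real (k + m + 1) / real ((k + m) choose k)" .
    have "a * b / (4 * p^2) * (real ((k + m) choose k) * a ^ k * b ^ m / real (k + m + 1))
       = (a ^ Suc k * b ^ Suc m) / (4 * p^2 * real (k + m + 1) / real ((k + m) choose k))"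
      by simp
    also have "\<dots> \<le> (cmod x ^ c k * cmod y ^ c m)^2 / D_weight p 2 (c k, c m)"
      using num den D_weight_pos[OF p, of 2 "(c k, c m)"] ab by (intro frac_le) auto
    finally show ?thesis .
  qed
  show False
  proof (rule harmonic_unbounded[of "a * b / (4 * p^2)" 1 S])
    show "a * b / (4 * p^2) > 0" using ab p by simp
    fix n
    define T :: "(nat \<times> nat) set" where "T = (SIGMA s:{..<n}. {..s})"
    define f where "f = (\<lambda>(s, k). (c k, c (s - k)))"
    have inj: "inj_on f T"
    proof (rule inj_onI)
      fix u v assume u: "u \<in> T" and v: "v \<in> T" and eq: "f u = f v"
      have "c (snd u) = c (snd v)" "c (fst u - snd u) = c (fst v - snd v)"
        using eq by (auto simp: f_def case_prod_unfold)
      from injD[OF c_inj this(1)] injD[OF c_inj this(2)]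
      have "snd u = snd v" "fst u - snd u = fst v - snd v" .
      moreover have "snd u \<le> fst u" "snd v \<le> fst v" using u v by (auto simp: T_def)
      ultimately show "u = v" by (simp add: prod_eq_iff)
    qed
    have "a * b / (4 * p^2) * (\<Sum>s<n. 1 / real (s + 1))
       = (\<Sum>s<n. \<Sum>k\<le>s. a * b / (4 * p^2) * (real (s choose k) * a ^ k * b ^ (s - k) / real (s + 1)))"
    proof -
      have bin: "(\<Sum>k\<le>s. real (s choose k) * a ^ k * b ^ (s - k) / real (s + 1)) = 1 / real (s + 1)" for s
        using binomial_ring[of a b s] ab(3) by (simp add: sum_divide_distrib[symmetric])
      show ?thesis by (simp only: sum_distrib_left[symmetric] bin)
    qed
    also have "\<dots> \<le> (\<Sum>s<n. \<Sum>k\<le>s. (cmod x ^ c k * cmod y ^ c (s - k))^2 / D_weight p 2 (c k, c (s - k)))"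
    proof (intro sum_mono)
      fix s k :: nat assume "k \<in> {..s}"
      then show "a * b / (4 * p^2) * (real (s choose k) * a ^ k * b ^ (s - k) / real (s + 1))
         \<le> (cmod x ^ c k * cmod y ^ c (s - k))^2 / D_weight p 2 (c k, c (s - k))"
        using term_ge[of k "s - k"] by simp
    qed
    also have "\<dots> = (\<Sum>L\<in>f ` T. (cmod x ^ fst L * cmod y ^ snd L)^2 / D_weight p 2 L)"
      by (subst sum.reindex[OF inj]) (simp add: T_def sum.Sigma f_def case_prod_unfold)
    also have "\<dots> \<le> S" by (rule S) (simp add: T_def)
    finally show "a * b / (4 * p^2) * (\<Sum>s<n. 1 / real (s + 1)) \<le> S" .
  qed simp
qed

lemma point_evaluation_unbounded:
  assumes p: "p \<ge> 1" and v: "egauge p (x, y) \<ge> 1"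
    and S: "\<And>A. finite A \<Longrightarrow> (\<Sum>L\<in>A. (cmod x ^ fst L * cmod y ^ snd L)^2 / D_weight p 2 L) \<le> S"
  shows False
proof -
  have one: "t \<ge> 1" if "t powr (2 * p) \<ge> 1" "t \<ge> 0" for t :: real
  proof (rule ccontr)
    assume "\<not> t \<ge> 1"
    then have "t powr (2 * p) \<le> t powr 1" using that p by (intro powr_mono') auto
    then show False using that \<open>\<not> t \<ge> 1\<close> by simp
  qed
  consider "x \<noteq> 0" "y \<noteq> 0" | "y = 0" | "x = 0" by blast
  then show False
  proof cases
    case 1
    show ?thesis by (rule point_evaluation_unbounded_interior[OF p v 1 S])
  next
    case 2
    have "cmod x \<ge> 1" by (rule one) (use v p 2 in \<open>auto simp: egauge_def\<close>)
    then show ?thesis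
    proof (rule point_evaluation_axis_unbounded[OF p])
      fix n
      have "(\<Sum>s<n. (cmod x ^ s)^2 / D_weight p 2 (s, 0))
         = (\<Sum>L\<in>(\<lambda>s. (s, 0)) ` {..<n}. (cmod x ^ fst L * cmod y ^ snd L)^2 / D_weight p 2 L)"
        by (subst sum.reindex) (auto simp: inj_on_def)
      also have "\<dots> \<le> S" by (rule S) simp
      finally show "(\<Sum>s<n. (cmod x ^ s)^2 / D_weight p 2 (s, 0)) \<le> S" .
    qed
  next
    case 3
    have "cmod y \<ge> 1" by (rule one) (use v p 3 in \<open>auto simp: egauge_def\<close>)
    then show ?thesis
    proof (rule point_evaluation_axis_unbounded[OF p])
      fix n
      have sym: "D_weight p 2 (s, 0) = D_weight p 2 (0, s)" for s
        by (simp add: D_weight_bweight bweight_commute[of p s 0])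
      have "(\<Sum>s<n. (cmod y ^ s)^2 / D_weight p 2 (s, 0)) = (\<Sum>s<n. (cmod y ^ s)^2 / D_weight p 2 (0, s))"
        by (intro sum.cong refl arg_cong2[where f = "(/)"] sym)
      also have "\<dots> = (\<Sum>L\<in>(\<lambda>s. (0, s)) ` {..<n}. (cmod x ^ fst L * cmod y ^ snd L)^2 / D_weight p 2 L)"
        by (subst sum.reindex) (auto simp: inj_on_def)
      also have "\<dots> \<le> S" by (rule S) simp
      finally show "(\<Sum>s<n. (cmod y ^ s)^2 / D_weight p 2 (s, 0)) \<le> S" .
    qed
  qed
qed

section \<open>Bounded point evaluations above the critical exponent\<close>

lemma card_floor_fiber:
  assumes p: "p \<ge> 1"
  shows "finite {i. nat \<lfloor>real i / p\<rfloor> = k}" "real (card {i. nat \<lfloor>real i / p\<rfloor> = k}) \<le> p + 1"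
proof -
  let ?A = "{i. nat \<lfloor>real i / p\<rfloor> = k}"
  have sub: "?A \<subseteq> {nat \<lceil>p * k\<rceil>..<nat \<lceil>p * k + p\<rceil>}"
  proof
    fix i assume "i \<in> ?A"
    then have "real k \<le> real i / p" "real i / p < real k + 1"
      using p floor_correct[of "real i / p"] by auto
    then have "p * k \<le> real i" "real i < p * k + p" using p by (auto simp: field_simps)
    then show "i \<in> {nat \<lceil>p * k\<rceil>..<nat \<lceil>p * k + p\<rceil>}"
      by (simp add: nat_le_iff ceiling_le_iff zless_nat_eq_int_zless less_ceiling_iff)
  qed
  then show "finite ?A" by (rule finite_subset) simp
  have nn: "0 \<le> p * real k" using p by simp
  have "real (card ?A) \<le> real (nat \<lceil>p * k + p\<rceil> - nat \<lceil>p * k\<rceil>)"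
    using card_mono[OF _ sub] by simp
  also have "\<dots> = of_int \<lceil>p * k + p\<rceil> - of_int \<lceil>p * k\<rceil>"
  proof -
    have "\<lceil>p * k\<rceil> \<le> \<lceil>p * k + p\<rceil>" using p by (intro ceiling_mono) simp
    moreover have "0 \<le> \<lceil>p * k\<rceil>" using nn by simp
    moreover have "real (nat u - nat w) = of_int u - of_int w" if "w \<le> u" "0 \<le> w" for u w :: int
      using that by (simp add: nat_diff_distrib[symmetric])
    ultimately show ?thesis by blast
  qed
  also have "\<dots> \<le> p + 1" using ceiling_correct[of "p * k + p"] ceiling_correct[of "p * k"] by linarith
  finally show "real (card ?A) \<le> p + 1" .
qed

lemma summable_weight_tail:
  assumes "\<beta> > 2"
  shows "summable (\<lambda>s. real (s + 3) * real (s + 2) powr (- \<beta>))"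
proof (rule summable_comparison_test')
  show "summable (\<lambda>s. 2 * real (s + 2) powr (1 - \<beta>))"
    using assms summable_iff_shift[of "\<lambda>n. real n powr (1 - \<beta>)" 2] summable_real_powr_iff[of "1 - \<beta>"]
    by (intro summable_mult) simp
  fix s :: nat
  have "real (s + 3) * real (s + 2) powr (- \<beta>) \<le> (2 * real (s + 2)) * real (s + 2) powr (- \<beta>)"
    by (intro mult_right_mono) auto
  also have "\<dots> = 2 * (real (s + 2) powr 1 * real (s + 2) powr (- \<beta>))" by simp
  also have "\<dots> = 2 * real (s + 2) powr (1 - \<beta>)" by (simp only: powr_add[symmetric] diff_conv_add_uminus)
  finally show "norm (real (s + 3) * real (s + 2) powr (- \<beta>)) \<le> 2 * real (s + 2) powr (1 - \<beta>)" by simp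
qed

text \<open>
  Here every index is compared with \<open>(\<lfloor>i / p\<rfloor>, \<lfloor>j / p\<rfloor>)\<close>, and boundedly many indices share the same
  pair. Rounding down decreases the exponents of the numbers \<open>a, b < 1\<close>, and rounding up in the Beta
  factor decreases the weight; the terms with \<open>k + m = s\<close> then add up to at most a constant times
  \<open>(s + 3) (s + 2)\<^bsup>- \<beta>\<^esup>\<close>.
\<close>

lemma point_evaluation_bounded_interior:
  assumes p: "p \<ge> 1" and \<beta>: "\<beta> > 2" and v: "egauge p (x, y) = 1" "x \<noteq> 0" "y \<noteq> 0"
  shows "\<exists>S. \<forall>A. finite A \<longrightarrow> (\<Sum>L\<in>A. (cmod x ^ fst L * cmod y ^ snd L)^2 / D_weight p \<beta> L) \<le> S"
proof -
  define a b where "a = cmod x powr (2 * p)" and "b = cmod y powr (2 * p)"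
  have ab: "a > 0" "b > 0" "a + b = 1" using v by (auto simp: a_def b_def egauge_def)
  then have ab1: "a < 1" "b < 1" by linarith+
  have pw: "(t ^ i)^2 = (t powr (2 * p)) powr (real i / p)" if "t > 0" for t i
  proof -
    have "(t ^ i)^2 = t powr (real (2 * i))" using that by (subst powr_realpow) (auto simp: power_mult mult.commute)
    then show ?thesis using p by (simp add: powr_powr)
  qed
  define G where "G L = (nat \<lfloor>real (fst L) / p\<rfloor>, nat \<lfloor>real (snd L) / p\<rfloor>)" for L
  define c where "c = 2 powr \<beta> / (a * b)"
  define w where "w s = real (s + 3) * real (s + 2) powr (- \<beta>)" for s
  \<comment> \<open>The factor \<open>a * b\<close> in \<open>c\<close> is compensated by the exponents \<open>Suc\<close>, which make these terms of the expansion of \<open>(a + b)\<^bsup>k + m + 2\<^esup>\<close>.\<close>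
  define h where "h K = c * w (fst K + snd K) * (real ((fst K + snd K + 2) choose (Suc (fst K))) * a ^ Suc (fst K) * b ^ Suc (snd K))" for K
  have c0: "c \<ge> 0" and w0: "w s \<ge> 0" for s using ab by (auto simp: c_def w_def)
  have h0: "h K \<ge> 0" for K using c0 w0 ab by (simp add: h_def)
  have bound: "(cmod x ^ fst L * cmod y ^ snd L)^2 / D_weight p \<beta> L \<le> h (G L)" for L
  proof -
    obtain i j where L: "L = (i, j)" by (cases L)
    define k m where "k = nat \<lfloor>real i / p\<rfloor>" and "m = nat \<lfloor>real j / p\<rfloor>"
    have fl: "real k \<le> real i / p" "real i / p \<le> real (k + 1)" "real m \<le> real j / p" "real j / p \<le> real (m + 1)"
    proof -
      have "real (nat \<lfloor>t\<rfloor>) \<le> t" "t \<le> real (nat \<lfloor>t\<rfloor> + 1)" if "t \<ge> 0" for t :: real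
      proof -
        have "real (nat \<lfloor>t\<rfloor>) = of_int \<lfloor>t\<rfloor>" using that by simp
        then show "real (nat \<lfloor>t\<rfloor>) \<le> t" "t \<le> real (nat \<lfloor>t\<rfloor> + 1)"
          using floor_correct[of t] by linarith+
      qed
      then show "real k \<le> real i / p" "real i / p \<le> real (k + 1)" "real m \<le> real j / p" "real j / p \<le> real (m + 1)"
        using p unfolding k_def m_def by simp_all
    qed
    have num: "(cmod x ^ i * cmod y ^ j)^2 \<le> a ^ k * b ^ m"
    proof -
      have "(cmod x ^ i * cmod y ^ j)^2 = a powr (real i / p) * b powr (real j / p)"
        using v pw[of "cmod x" i] pw[of "cmod y" j] by (simp add: power_mult_distrib a_def b_def)
      also have "\<dots> \<le> a powr (real k) * b powr (real m)"
        using ab ab1 fl by (intro mult_mono powr_mono') auto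
      finally show ?thesis using ab by (simp add: powr_realpow)
    qed
    have "Beta (real (k + 1) + 1) (real (m + 1) + 1) \<le> bweight p i j"
      unfolding bweight_def using fl p by (intro Beta_real_mono) (auto intro: add_nonneg_pos)
    then have B: "1 / (real (k + m + 3) * real ((k + m + 2) choose (k + 1))) \<le> bweight p i j"
      unfolding Beta_nat by (simp add: numeral_3_eq_3 numeral_2_eq_2)
    have ij: "real (k + m + 2) \<le> real (i + j + 2)"
    proof -
      have "real i / p \<le> real i" "real j / p \<le> real j" using p by (auto simp: divide_le_eq mult_le_cancel_left1)
      then show ?thesis using fl by simp
    qed
    have ch: "real ((k + m + 2) choose (k + 1)) > 0"
      unfolding of_nat_0_less_iff by (rule zero_less_binomial) simp
    have den: "2 powr (- \<beta>) * (1 / (real (k + m + 3) * real ((k + m + 2) choose (k + 1)))) * real (k + m + 2) powr \<beta>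
       \<le> D_weight p \<beta> (i, j)"
      unfolding D_weight_bweight
    proof (rule mult_mono)
      show "real (k + m + 2) powr \<beta> \<le> real (i + j + 2) powr \<beta>"
        using ij \<beta> by (intro powr_mono2) auto
      show "2 powr (- \<beta>) * (1 / (real (k + m + 3) * real ((k + m + 2) choose (k + 1)))) \<le> 2 powr (- \<beta>) * bweight p i j"
        by (rule mult_left_mono[OF B]) simp
    qed (use bweight_pos[OF p, of i j] in simp_all)
    have "(cmod x ^ i * cmod y ^ j)^2 / D_weight p \<beta> (i, j)
       \<le> (a ^ k * b ^ m) / (2 powr (- \<beta>) * (1 / (real (k + m + 3) * real ((k + m + 2) choose (k + 1)))) * real (k + m + 2) powr \<beta>)"
      using num den ab ch by (intro frac_le mult_pos_pos) auto
    also have "\<dots> = h (k, m)"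
    proof -
      have "u / (P * (1 / Q) * R) = (1 / P) * u * Q * (1 / R)" for u P Q R :: real by simp
      then have "(a ^ k * b ^ m) / (2 powr (- \<beta>) * (1 / (real (k + m + 3) * real ((k + m + 2) choose (k + 1)))) * real (k + m + 2) powr \<beta>)
          = 2 powr \<beta> * (a ^ k * b ^ m) * (real (k + m + 3) * real ((k + m + 2) choose (k + 1))) * real (k + m + 2) powr (- \<beta>)"
        by (simp only: powr_minus_divide) simp
      also have "\<dots> = (a * b) / (a * b) * \<dots>" using ab by simp
      also have "\<dots> = h (k, m)" by (simp only: h_def c_def w_def fst_conv snd_conv power_Suc Suc_eq_plus1[symmetric] times_divide_eq_left times_divide_eq_right mult_ac)
      finally show ?thesis .
    qed
    also have "(k, m) = G L" by (simp add: G_def L k_def m_def)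
    finally show ?thesis by (simp add: L)
  qed
  have fib: "real (card {L \<in> A. G L = K}) \<le> (p + 1)^2" if "finite A" for A K
  proof -
    let ?F = "\<lambda>k. {i. nat \<lfloor>real i / p\<rfloor> = k}"
    have "{L \<in> A. G L = K} \<subseteq> ?F (fst K) \<times> ?F (snd K)" by (auto simp: G_def)
    then have "card {L \<in> A. G L = K} \<le> card (?F (fst K) \<times> ?F (snd K))"
      by (intro card_mono finite_cartesian_product card_floor_fiber(1) p)
    then have "real (card {L \<in> A. G L = K}) \<le> real (card (?F (fst K))) * real (card (?F (snd K)))"
      by (simp add: card_cartesian_product flip: of_nat_mult)
    also have "\<dots> \<le> (p + 1) * (p + 1)"
      using p by (intro mult_mono card_floor_fiber(2)) auto
    finally show ?thesis by (simp add: power2_eq_square)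
  qed
  have hsum: "(\<Sum>K\<in>B. h K) \<le> c * (\<Sum>s. w s)" if B: "finite B" for B
  proof -
    define n where "n = Suc (Max (insert 0 ((\<lambda>K. fst K + snd K) ` B)))"
    have n: "fst K + snd K < n" if "K \<in> B" for K
      using B that unfolding n_def less_Suc_eq_le by (intro Max_ge) auto
    define f :: "nat \<times> nat \<Rightarrow> nat \<times> nat" where "f = (\<lambda>(s, k). (k, s - k))"
    define T :: "(nat \<times> nat) set" where "T = (SIGMA s:{..<n}. {..s})"
    have inj: "inj_on f T" by (auto simp: inj_on_def f_def T_def)
    have "B \<subseteq> f ` T"
    proof
      fix K assume K: "K \<in> B"
      have "K = f (fst K + snd K, fst K)" by (simp add: f_def)
      moreover have "(fst K + snd K, fst K) \<in> T" using n[OF K] by (simp add: T_def)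
      ultimately show "K \<in> f ` T" by blast
    qed
    then have "(\<Sum>K\<in>B. h K) \<le> (\<Sum>K\<in>f ` T. h K)"
      by (rule sum_mono2[rotated]) (use h0 in \<open>auto simp: T_def\<close>)
    also have "\<dots> = (\<Sum>s<n. \<Sum>k\<le>s. h (k, s - k))"
      by (subst sum.reindex[OF inj]) (simp add: T_def sum.Sigma f_def case_prod_unfold)
    also have "\<dots> \<le> (\<Sum>s<n. c * w s)"
    proof (rule sum_mono)
      fix s
      have "(\<Sum>k\<le>s. h (k, s - k)) = c * w s * (\<Sum>k\<le>s. real ((s + 2) choose Suc k) * a ^ Suc k * b ^ (s + 2 - Suc k))"
        unfolding sum_distrib_left by (intro sum.cong refl) (auto simp: h_def Suc_diff_le)
      also have "(\<Sum>k\<le>s. real ((s + 2) choose Suc k) * a ^ Suc k * b ^ (s + 2 - Suc k))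
          = (\<Sum>k\<in>Suc ` {..s}. real ((s + 2) choose k) * a ^ k * b ^ (s + 2 - k))"
        by (subst sum.reindex) auto
      also have "\<dots> \<le> (\<Sum>k\<le>s + 2. real ((s + 2) choose k) * a ^ k * b ^ (s + 2 - k))"
        using ab by (intro sum_mono2) auto
      also have "\<dots> = 1" using binomial_ring[of a b "s + 2"] ab(3) by simp
      finally show "(\<Sum>k\<le>s. h (k, s - k)) \<le> c * w s"
        using c0 w0[of s] by (simp add: mult_left_mono)
    qed
    also have "\<dots> = c * (\<Sum>s<n. w s)" by (rule sum_distrib_left[symmetric])
    also have "\<dots> \<le> c * (\<Sum>s. w s)"
      using c0 w0 summable_weight_tail[OF \<beta>] by (intro mult_left_mono sum_le_suminf) (auto simp: w_def[abs_def])
    finally show ?thesis .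
  qed
  have "(\<Sum>L\<in>A. (cmod x ^ fst L * cmod y ^ snd L)^2 / D_weight p \<beta> L) \<le> (p + 1)^2 * (c * (\<Sum>s. w s))"
    if A: "finite A" for A
  proof -
    have "(\<Sum>L\<in>A. (cmod x ^ fst L * cmod y ^ snd L)^2 / D_weight p \<beta> L) \<le> (\<Sum>L\<in>A. h (G L))"
      by (intro sum_mono bound)
    also have "\<dots> = (\<Sum>K\<in>G ` A. \<Sum>L\<in>{L \<in> A. G L = K}. h (G L))" by (rule sum.image_gen[OF A])
    also have "\<dots> = (\<Sum>K\<in>G ` A. real (card {L \<in> A. G L = K}) * h K)"
      by (intro sum.cong refl) simp
    also have "\<dots> \<le> (\<Sum>K\<in>G ` A. (p + 1)^2 * h K)"
      by (intro sum_mono mult_right_mono fib A h0)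
    also have "\<dots> = (p + 1)^2 * (\<Sum>K\<in>G ` A. h K)" by (rule sum_distrib_left[symmetric])
    also have "\<dots> \<le> (p + 1)^2 * (c * (\<Sum>s. w s))" using A by (intro mult_left_mono hsum) auto
    finally show ?thesis .
  qed
  then show ?thesis by blast
qed

lemma point_evaluation_bounded_axis:
  assumes p: "p \<ge> 1" and \<beta>: "\<beta> > 2" and x: "cmod x = 1"
  shows "\<exists>S. \<forall>A. finite A \<longrightarrow> (\<Sum>s\<in>A. (cmod x ^ s)^2 / D_weight p \<beta> (s, 0)) \<le> S"
proof -
  define w where "w s = real (s + 3) * real (s + 2) powr (- \<beta>)" for s
  have w0: "w s \<ge> 0" for s by (simp add: w_def)
  have "(\<Sum>s\<in>A. (cmod x ^ s)^2 / D_weight p \<beta> (s, 0)) \<le> 2 powr \<beta> * (\<Sum>s. w s)" if A: "finite A" for A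
  proof -
    have "(\<Sum>s\<in>A. (cmod x ^ s)^2 / D_weight p \<beta> (s, 0)) \<le> (\<Sum>s\<in>A. 2 powr \<beta> * w s)"
    proof (rule sum_mono)
      fix s
      have "real s + p \<le> p * (real s + 3)" using p mult_right_mono[of 1 p "real s"] by (simp add: algebra_simps)
      then have "(real s + p) / p \<le> real s + 3" using p by (simp add: divide_le_eq mult.commute)
      then have "(2 powr \<beta> * real (s + 2) powr (- \<beta>)) * ((real s + p) / p) \<le> (2 powr \<beta> * real (s + 2) powr (- \<beta>)) * (real s + 3)"
        by (intro mult_left_mono) auto
      moreover have "(cmod x ^ s)^2 / D_weight p \<beta> (s, 0) = (2 powr \<beta> * real (s + 2) powr (- \<beta>)) * ((real s + p) / p)"
        using p x by (simp add: D_weight_bweight bweight_0_right powr_minus_divide)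
      ultimately show "(cmod x ^ s)^2 / D_weight p \<beta> (s, 0) \<le> 2 powr \<beta> * w s"
        by (simp add: w_def mult_ac)
    qed
    also have "\<dots> = 2 powr \<beta> * (\<Sum>s\<in>A. w s)" by (rule sum_distrib_left[symmetric])
    also have "\<dots> \<le> 2 powr \<beta> * (\<Sum>s. w s)"
      using summable_weight_tail[OF \<beta>] w0 A by (intro mult_left_mono sum_le_suminf) (auto simp: w_def[abs_def])
    finally show ?thesis .
  qed
  then show ?thesis by blast
qed

section \<open>A functional orthogonal to the multiples of a polynomial\<close>

lemma poly_coeffs_add: "poly_coeffs (f + h) L = poly_coeffs f L + poly_coeffs h L"
  and poly_coeffs_diff: "poly_coeffs (f - h) L = poly_coeffs f L - poly_coeffs h L"
  and poly_coeffs_scale: "poly_coeffs (smult [:c:] f) L = c * poly_coeffs f L"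
  and poly_coeffs_0: "poly_coeffs 0 L = 0"
  by (simp_all add: poly_coeffs_def)

lemma cmod_diff_square_le: "(cmod (x - y))^2 \<le> 2 * (cmod x)^2 + 2 * (cmod y)^2"
proof -
  have "(cmod (x - y))^2 \<le> (cmod x + cmod y)^2" by (intro power_mono norm_triangle_ineq4) simp
  moreover have "0 \<le> (cmod x - cmod y)^2" by simp
  ultimately show ?thesis by (simp add: power2_eq_square algebra_simps)
qed

definition weighted_inner :: "(nat \<times> nat \<Rightarrow> real) \<Rightarrow> complex poly poly \<Rightarrow> complex poly poly \<Rightarrow> complex" where
  "weighted_inner w f h = (\<Sum>L\<in>poly_support f. poly_coeffs f L * cnj (poly_coeffs h L) * of_real (w L))"

definition weighted_norm_sq :: "(nat \<times> nat \<Rightarrow> real) \<Rightarrow> complex poly poly \<Rightarrow> real" where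
  "weighted_norm_sq w f = (\<Sum>L\<in>poly_support f. (cmod (poly_coeffs f L))^2 * w L)"

lemma weighted_inner_extend:
  assumes "finite S" "poly_support f \<subseteq> S"
  shows "weighted_inner w f h = (\<Sum>L\<in>S. poly_coeffs f L * cnj (poly_coeffs h L) * of_real (w L))"
  unfolding weighted_inner_def by (rule sum.mono_neutral_left) (use assms in \<open>auto simp: poly_coeffs_outside\<close>)

lemma weighted_norm_sq_extend:
  assumes "finite S" "poly_support f \<subseteq> S"
  shows "weighted_norm_sq w f = (\<Sum>L\<in>S. (cmod (poly_coeffs f L))^2 * w L)"
  unfolding weighted_norm_sq_def by (rule sum.mono_neutral_left) (use assms in \<open>auto simp: poly_coeffs_outside\<close>)

lemma weighted_inner_diff_left: "weighted_inner w (f - h) u = weighted_inner w f u - weighted_inner w h u"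
proof -
  let ?S = "poly_support (f - h) \<union> poly_support f \<union> poly_support h"
  show ?thesis
  proof -
    have "weighted_inner w g u = (\<Sum>L\<in>?S. poly_coeffs g L * cnj (poly_coeffs u L) * of_real (w L))"
      if "poly_support g \<subseteq> ?S" for g
      using that by (intro weighted_inner_extend) auto
    from this[of "f - h"] this[of f] this[of h] show ?thesis
      by (simp add: poly_coeffs_diff left_diff_distrib sum_subtractf sup.coboundedI1)
  qed
qed

lemma weighted_inner_diff_right: "weighted_inner w u (f - h) = weighted_inner w u f - weighted_inner w u h"
  unfolding weighted_inner_def sum_subtractf[symmetric]
  by (intro sum.cong refl) (simp add: poly_coeffs_diff algebra_simps)

lemma weighted_inner_self: "weighted_inner w f f = of_real (weighted_norm_sq w f)"
  unfolding weighted_inner_def weighted_norm_sq_def of_real_sum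
  by (intro sum.cong refl) (simp add: complex_norm_square[symmetric])

context
  fixes w :: "nat \<times> nat \<Rightarrow> real"
  assumes w: "\<And>L. w L > 0"
begin

lemma weighted_norm_sq_nonneg: "weighted_norm_sq w f \<ge> 0"
  unfolding weighted_norm_sq_def using w by (intro sum_nonneg) (auto simp: less_imp_le)

lemma weighted_norm_sq_coeff: "(cmod (poly_coeffs f L))^2 * w L \<le> weighted_norm_sq w f"
proof -
  have "(cmod (poly_coeffs f L))^2 * w L \<le> (\<Sum>L\<in>insert L (poly_support f). (cmod (poly_coeffs f L))^2 * w L)"
    by (rule member_le_sum) (use w in \<open>auto simp: less_imp_le\<close>)
  also have "\<dots> = weighted_norm_sq w f" by (rule weighted_norm_sq_extend[symmetric]) auto
  finally show ?thesis .
qed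

lemma weighted_norm_sq_diff_scale:
  "weighted_norm_sq w (u - smult [:c:] G) = weighted_norm_sq w u - 2 * Re (c * weighted_inner w G u) + (cmod c)^2 * weighted_norm_sq w G"
proof -
  let ?S = "poly_support (u - smult [:c:] G) \<union> (poly_support u \<union> poly_support G)"
  have "weighted_norm_sq w (u - smult [:c:] G) = (\<Sum>L\<in>?S. (cmod (poly_coeffs u L - c * poly_coeffs G L))^2 * w L)"
    by (subst weighted_norm_sq_extend[of ?S]) (auto simp: poly_coeffs_diff poly_coeffs_scale)
  also have "\<dots> = (\<Sum>L\<in>?S. (cmod (poly_coeffs u L))^2 * w L
      - 2 * Re (c * (poly_coeffs G L * cnj (poly_coeffs u L) * of_real (w L)))
      + (cmod c)^2 * ((cmod (poly_coeffs G L))^2 * w L))"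
  proof (intro sum.cong refl)
    fix L
    have "(cmod (x - c * y))^2 = (cmod x)^2 - 2 * Re (c * (y * cnj x)) + (cmod c)^2 * (cmod y)^2" for x y
      unfolding cmod_power2 by (simp add: power2_eq_square algebra_simps)
    moreover have "Re (c * (y * cnj x * of_real t)) = Re (c * (y * cnj x)) * t" for x y t
      proof -
      have "c * (y * cnj x * of_real t) = of_real t * (c * (y * cnj x))" by simp
      moreover have "Re (of_real t * z) = Re z * t" for z :: complex by simp
      ultimately show ?thesis by metis
    qed
    ultimately show "(cmod (poly_coeffs u L - c * poly_coeffs G L))^2 * w L = (cmod (poly_coeffs u L))^2 * w L
      - 2 * Re (c * (poly_coeffs G L * cnj (poly_coeffs u L) * of_real (w L)))
      + (cmod c)^2 * ((cmod (poly_coeffs G L))^2 * w L)"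
      by (simp only: left_diff_distrib distrib_right mult.assoc)
  qed
  also have "\<dots> = weighted_norm_sq w u - 2 * Re (c * weighted_inner w G u) + (cmod c)^2 * weighted_norm_sq w G"
  proof -
    have e: "weighted_norm_sq w u = (\<Sum>L\<in>?S. (cmod (poly_coeffs u L))^2 * w L)"
      "weighted_norm_sq w G = (\<Sum>L\<in>?S. (cmod (poly_coeffs G L))^2 * w L)"
      "weighted_inner w G u = (\<Sum>L\<in>?S. poly_coeffs G L * cnj (poly_coeffs u L) * of_real (w L))"
      by (rule weighted_norm_sq_extend weighted_inner_extend; auto)+
    show ?thesis by (simp only: e sum.distrib sum_subtractf sum_distrib_left Re_sum)
  qed
  finally show ?thesis .
qed

text \<open>
  If no multiple of \<open>G\<close> brings \<open>u\<close> closer to zero than \<open>d\<close>, then \<open>u\<close> is almost orthogonal to \<open>G\<close>. Insert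
  the optimal multiple.
\<close>

lemma weighted_inner_le_of_minimal:
  assumes min: "\<And>c. d \<le> weighted_norm_sq w (u - smult [:c:] G)"
  shows "cmod (weighted_inner w G u) \<le> sqrt (weighted_norm_sq w G) * sqrt (weighted_norm_sq w u - d)"
proof (cases "weighted_norm_sq w G = 0")
  case True
  have "(cmod (poly_coeffs G L))^2 * w L = 0" for L
    using weighted_norm_sq_coeff[of G L] w[of L] unfolding True by (intro order_antisym mult_nonneg_nonneg) (auto simp: less_imp_le)
  then have "poly_coeffs G L = 0" for L using w[of L] by (metis less_irrefl mult_eq_0_iff norm_eq_zero power_eq_0_iff)
  then have "weighted_inner w G u = 0" by (simp add: weighted_inner_def)
  then show ?thesis by (simp add: True)
next
  case False
  then have G: "weighted_norm_sq w G > 0" using weighted_norm_sq_nonneg[of G] by simp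
  define r where "r = weighted_inner w G u"
  \<comment> \<open>The minimiser of the quadratic polynomial \<open>c \<mapsto> \<parallel>u - c G\<parallel>\<^sup>2\<close>.\<close>
  define c where "c = cnj r / of_real (weighted_norm_sq w G)"
  have "Re (c * r) = (cmod r)^2 / weighted_norm_sq w G"
  proof -
    have "c * r = of_real ((cmod r)^2 / weighted_norm_sq w G)"
      unfolding of_real_divide complex_norm_square by (simp add: c_def mult.commute)
    then show ?thesis by simp
  qed
  moreover have "(cmod c)^2 * weighted_norm_sq w G = (cmod r)^2 / weighted_norm_sq w G"
    using G by (simp add: c_def norm_divide power_divide power2_eq_square)
  ultimately have "d \<le> weighted_norm_sq w u - (cmod r)^2 / weighted_norm_sq w G"
    using min[of c] unfolding weighted_norm_sq_diff_scale r_def[symmetric] by linarith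
  then have "(cmod r)^2 / weighted_norm_sq w G \<le> weighted_norm_sq w u - d" by linarith
  then have "(cmod r)^2 \<le> weighted_norm_sq w G * (weighted_norm_sq w u - d)" using G by (simp add: divide_le_eq mult.commute)
  then have "sqrt ((cmod r)^2) \<le> sqrt (weighted_norm_sq w G * (weighted_norm_sq w u - d))" by (rule real_sqrt_le_mono)
  then show ?thesis by (simp add: real_sqrt_mult r_def)
qed

text \<open>
  The projection argument. The differences \<open>u n = f - h n * q\<close> of a minimising sequence are almost
  orthogonal to all multiples of \<open>q\<close> and hence Cauchy, coefficient by coefficient. The limit \<open>U\<close> is
  orthogonal to the multiples of \<open>q\<close>, and \<open>b\<close> is the pairing with \<open>U\<close> in coordinates; were it zero, the
  distance from \<open>f\<close> would be zero.
\<close>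

lemma orthogonal_functional:
  fixes f q :: "complex poly poly"
  assumes \<epsilon>: "\<epsilon> > 0" and far: "\<And>h. weighted_norm_sq w (f - h * q) \<ge> \<epsilon>"
  shows "\<exists>b S. b \<noteq> (\<lambda>L. 0) \<and> (\<forall>A. finite A \<longrightarrow> (\<Sum>L\<in>A. (cmod (b L))^2 / w L) \<le> S)
     \<and> (\<forall>h. (\<Sum>L\<in>poly_support (h * q). poly_coeffs (h * q) L * b L) = 0)"
proof -
  define D where "D = range (\<lambda>h. weighted_norm_sq w (f - h * q))"
  define d where "d = Inf D"
  have bdd: "bdd_below D" unfolding bdd_below_def D_def using far by blast
  have d: "d \<ge> \<epsilon>" unfolding d_def D_def by (rule cINF_greatest) (use far in auto)
  have d_le: "d \<le> weighted_norm_sq w (f - h * q)" for h unfolding d_def using bdd by (intro cInf_lower) (auto simp: D_def)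
  have "\<exists>h. weighted_norm_sq w (f - h * q) < d + 1 / real (Suc n)" for n
  proof -
    have "Inf D < d + 1 / real (Suc n)" by (simp add: d_def)
    then show ?thesis using cInf_less_iff[of D] bdd by (auto simp: D_def)
  qed
  then obtain h where h: "\<And>n. weighted_norm_sq w (f - h n * q) < d + 1 / real (Suc n)" by metis
  define u where "u n = f - h n * q" for n
  define e where "e n = sqrt (weighted_norm_sq w (u n) - d)" for n
  have e_nn: "e n \<ge> 0" and e_le: "e n \<le> sqrt (1 / real (Suc n))" for n
    using h[of n] d_le[of "h n"] by (auto simp: e_def u_def intro!: real_sqrt_le_mono)
  have "(\<lambda>n. sqrt (1 / real (Suc n))) \<longlonglongrightarrow> sqrt 0"
    using LIMSEQ_inverse_real_of_nat by (intro tendsto_real_sqrt) (simp add: inverse_eq_divide)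
  then have lim0: "(\<lambda>n. sqrt (1 / real (Suc n))) \<longlonglongrightarrow> 0" by simp
  have e_lim: "e \<longlonglongrightarrow> 0"
    by (rule tendsto_sandwich[OF always_eventually always_eventually tendsto_const lim0]) (use e_nn e_le in blast)+
  have A: "cmod (weighted_inner w (g * q) (u n)) \<le> sqrt (weighted_norm_sq w (g * q)) * e n" for g n
    unfolding e_def
  proof (rule weighted_inner_le_of_minimal)
    fix c
    have "u n - smult [:c:] (g * q) = f - (h n + smult [:c:] g) * q" by (simp add: u_def algebra_simps)
    then show "d \<le> weighted_norm_sq w (u n - smult [:c:] (g * q))" using d_le by simp
  qed
  have B: "sqrt (weighted_norm_sq w (u n - u m)) \<le> e n + e m" for n m
  proof -
    define G where "G = (h m - h n) * q"
    have G: "u n - u m = G" by (simp add: u_def G_def algebra_simps)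
    have "of_real (weighted_norm_sq w G) = weighted_inner w G (u n) - weighted_inner w G (u m)"
      unfolding weighted_inner_self[symmetric] weighted_inner_diff_right[symmetric] G ..
    then have "weighted_norm_sq w G = cmod (weighted_inner w G (u n) - weighted_inner w G (u m))"
      using weighted_norm_sq_nonneg[of G] by (metis abs_of_nonneg norm_of_real)
    also have "\<dots> \<le> cmod (weighted_inner w G (u n)) + cmod (weighted_inner w G (u m))" by (rule norm_triangle_ineq4)
    also have "\<dots> \<le> sqrt (weighted_norm_sq w G) * e n + sqrt (weighted_norm_sq w G) * e m"
      unfolding G_def by (intro add_mono A)
    finally have "sqrt (weighted_norm_sq w G) * sqrt (weighted_norm_sq w G) \<le> sqrt (weighted_norm_sq w G) * (e n + e m)"
      using weighted_norm_sq_nonneg[of G] by (simp add: algebra_simps)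
    note le = this
    show ?thesis
    proof (cases "weighted_norm_sq w G = 0")
      case True
      then show ?thesis unfolding G using e_nn[of n] e_nn[of m] by simp
    next
      case False
      then have "sqrt (weighted_norm_sq w G) > 0" using weighted_norm_sq_nonneg[of G] by simp
      with le show ?thesis unfolding G by (rule mult_left_le_imp_le)
    qed
  qed
  have C: "cmod (poly_coeffs (u n) L - poly_coeffs (u m) L) * sqrt (w L) \<le> e n + e m" for n m L
  proof -
    have "sqrt ((cmod (poly_coeffs (u n - u m) L))^2 * w L) \<le> sqrt (weighted_norm_sq w (u n - u m))"
      by (intro real_sqrt_le_mono weighted_norm_sq_coeff)
    then show ?thesis using B[of n m] by (simp add: poly_coeffs_diff real_sqrt_mult)
  qed
  have "Cauchy (\<lambda>n. poly_coeffs (u n) L)" for L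
  proof (rule CauchyI)
    fix r :: real assume r: "r > 0"
    have sw: "sqrt (w L) > 0" using w[of L] by simp
    have "\<forall>\<^sub>F n in sequentially. e n < r * sqrt (w L) / 2"
      by (rule order_tendstoD(2)[OF e_lim]) (use r sw in simp)
    then obtain N where N: "\<And>n. n \<ge> N \<Longrightarrow> e n < r * sqrt (w L) / 2" by (auto simp: eventually_sequentially)
    have "cmod (poly_coeffs (u m) L - poly_coeffs (u n) L) < r" if "m \<ge> N" "n \<ge> N" for m n
    proof -
      have "cmod (poly_coeffs (u m) L - poly_coeffs (u n) L) * sqrt (w L) < r * sqrt (w L)"
        using C[of m L n] N[OF that(1)] N[OF that(2)] by linarith
      then show ?thesis using sw by simp
    qed
    then show "\<exists>N. \<forall>m\<ge>N. \<forall>n\<ge>N. norm (poly_coeffs (u m) L - poly_coeffs (u n) L) < r" by blast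
  qed
  then have "\<exists>U. (\<lambda>n. poly_coeffs (u n) L) \<longlonglongrightarrow> U" for L
    using Cauchy_convergent unfolding convergent_def by blast
  then obtain U where U: "\<And>L. (\<lambda>n. poly_coeffs (u n) L) \<longlonglongrightarrow> U L" by metis
  define b where "b L = cnj (U L) * of_real (w L)" for L
  have u_bd: "weighted_norm_sq w (u n) \<le> d + 1" for n
  proof -
    have "1 / real (Suc n) \<le> 1" by simp
    then show ?thesis using h[of n] unfolding u_def by linarith
  qed
  have bS: "(\<Sum>L\<in>A. (cmod (b L))^2 / w L) \<le> d + 1" if A: "finite A" for A
  proof -
    have "(\<lambda>n. \<Sum>L\<in>A. (cmod (poly_coeffs (u n) L))^2 * w L) \<longlonglongrightarrow> (\<Sum>L\<in>A. (cmod (U L))^2 * w L)"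
      by (intro tendsto_intros U)
    moreover have "(\<Sum>L\<in>A. (cmod (poly_coeffs (u n) L))^2 * w L) \<le> d + 1" for n
    proof -
      have "(\<Sum>L\<in>A. (cmod (poly_coeffs (u n) L))^2 * w L) \<le> (\<Sum>L\<in>A \<union> poly_support (u n). (cmod (poly_coeffs (u n) L))^2 * w L)"
        using A w by (intro sum_mono2) (auto simp: less_imp_le)
      also have "\<dots> = weighted_norm_sq w (u n)" using A by (intro weighted_norm_sq_extend[symmetric]) auto
      also have "\<dots> \<le> d + 1" by (rule u_bd)
      finally show ?thesis .
    qed
    ultimately have "(\<Sum>L\<in>A. (cmod (U L))^2 * w L) \<le> d + 1" by (intro LIMSEQ_le_const2) auto
    moreover have "(cmod (b L))^2 / w L = (cmod (U L))^2 * w L" for L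
      using w[of L] by (simp add: b_def norm_mult power_mult_distrib power2_eq_square)
    ultimately show ?thesis by simp
  qed
  have wlim: "(\<lambda>n. weighted_inner w F (u n)) \<longlonglongrightarrow> (\<Sum>L\<in>poly_support F. poly_coeffs F L * b L)" for F
    unfolding weighted_inner_def b_def mult.assoc by (intro tendsto_intros U)
  have b_ann: "(\<Sum>L\<in>poly_support (g * q). poly_coeffs (g * q) L * b L) = 0" for g
  proof -
    have "(\<lambda>n. sqrt (weighted_norm_sq w (g * q)) * e n) \<longlonglongrightarrow> sqrt (weighted_norm_sq w (g * q)) * 0" by (intro tendsto_intros e_lim)
    then have "(\<lambda>n. weighted_inner w (g * q) (u n)) \<longlonglongrightarrow> 0"
      using A[of g] by (intro Lim_null_comparison[of "\<lambda>n. weighted_inner w (g * q) (u n)" "\<lambda>n. sqrt (weighted_norm_sq w (g * q)) * e n"]) auto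
    then show ?thesis using wlim LIMSEQ_unique by blast
  qed
  have "b \<noteq> (\<lambda>L. 0)"
  proof
    assume b0: "b = (\<lambda>L. 0)"
    define K where "K = sqrt (2 * weighted_norm_sq w f + 2 * (d + 1))"
    have "weighted_norm_sq w (u n) \<le> cmod (weighted_inner w f (u n)) + K * e n" for n
    proof -
      have hq: "weighted_norm_sq w (h n * q) \<le> 2 * weighted_norm_sq w f + 2 * (d + 1)"
      proof -
        let ?S = "poly_support (h n * q) \<union> (poly_support f \<union> poly_support (u n))"
        have "h n * q = f - u n" by (simp add: u_def)
        then have "weighted_norm_sq w (h n * q) = (\<Sum>L\<in>?S. (cmod (poly_coeffs f L - poly_coeffs (u n) L))^2 * w L)"
          by (subst weighted_norm_sq_extend[of ?S]) (auto simp: poly_coeffs_diff)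
        also have "\<dots> \<le> (\<Sum>L\<in>?S. 2 * ((cmod (poly_coeffs f L))^2 * w L) + 2 * ((cmod (poly_coeffs (u n) L))^2 * w L))"
        proof (rule sum_mono)
          fix L
          from mult_right_mono[OF cmod_diff_square_le, of "w L"] w[of L]
          show "(cmod (poly_coeffs f L - poly_coeffs (u n) L))^2 * w L
             \<le> 2 * ((cmod (poly_coeffs f L))^2 * w L) + 2 * ((cmod (poly_coeffs (u n) L))^2 * w L)"
            by (simp add: algebra_simps)
        qed
        also have "\<dots> = 2 * weighted_norm_sq w f + 2 * weighted_norm_sq w (u n)"
        proof -
          have e: "weighted_norm_sq w f = (\<Sum>L\<in>?S. (cmod (poly_coeffs f L))^2 * w L)"
            "weighted_norm_sq w (u n) = (\<Sum>L\<in>?S. (cmod (poly_coeffs (u n) L))^2 * w L)"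
            by (rule weighted_norm_sq_extend; auto)+
          show ?thesis by (simp only: e sum.distrib sum_distrib_left)
        qed
        also have "\<dots> \<le> 2 * weighted_norm_sq w f + 2 * (d + 1)"
          by (intro add_left_mono mult_left_mono u_bd) simp
        finally show ?thesis .
      qed
      have "of_real (weighted_norm_sq w (u n)) = weighted_inner w f (u n) - weighted_inner w (h n * q) (u n)"
        unfolding weighted_inner_self[symmetric] weighted_inner_diff_left[symmetric] by (simp add: u_def)
      then have "weighted_norm_sq w (u n) = cmod (weighted_inner w f (u n) - weighted_inner w (h n * q) (u n))"
        using weighted_norm_sq_nonneg[of "u n"] by (metis abs_of_nonneg norm_of_real)
      also have "\<dots> \<le> cmod (weighted_inner w f (u n)) + cmod (weighted_inner w (h n * q) (u n))" by (rule norm_triangle_ineq4)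
      also have "cmod (weighted_inner w (h n * q) (u n)) \<le> sqrt (weighted_norm_sq w (h n * q)) * e n" by (rule A)
      also have "\<dots> \<le> K * e n" unfolding K_def using hq e_nn by (intro mult_right_mono real_sqrt_le_mono) auto
      finally show ?thesis by simp
    qed
    then have le: "d \<le> cmod (weighted_inner w f (u n)) + K * e n" for n using d_le[of "h n"] order_trans unfolding u_def by blast
    have "(\<lambda>n. cmod (weighted_inner w f (u n)) + K * e n) \<longlonglongrightarrow> cmod (\<Sum>L\<in>poly_support f. poly_coeffs f L * b L) + K * 0"
      by (intro tendsto_intros wlim e_lim)
    then have "(\<lambda>n. cmod (weighted_inner w f (u n)) + K * e n) \<longlonglongrightarrow> 0" by (simp add: b0)
    then have "d \<le> 0" using le by (intro LIMSEQ_le_const) auto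
    then show False using d \<epsilon> by linarith
  qed
  then show ?thesis using bS b_ann by (intro exI[of _ b] exI[of _ "d + 1"]) simp
qed

end

definition monom2 :: "nat \<times> nat \<Rightarrow> complex poly poly" where
  "monom2 K = monom (monom 1 (fst K)) (snd K)"

lemma poly_coeffs_monom2_mult:
  "poly_coeffs (monom2 K * q) (fst K + i, snd K + j) = poly_coeffs q (i, j)"
  "fst L < fst K \<or> snd L < snd K \<Longrightarrow> poly_coeffs (monom2 K * q) L = 0"
  by (auto simp: poly_coeffs_def monom2_def coeff_monom_mult)

text \<open>
  Orthogonality to the monomial multiples of \<open>q\<close> is annihilation by \<open>q\<close> in the index shifts.
\<close>

lemma sum_monom2_mult:
  "(\<Sum>L\<in>poly_support (monom2 K * q). poly_coeffs (monom2 K * q) L * b L)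
     = (\<Sum>L\<in>poly_support q. poly_coeffs q L * b (fst K + fst L, snd K + snd L))"
proof -
  let ?f = "\<lambda>L. (fst K + fst L, snd K + snd L)"
  let ?S = "poly_support (monom2 K * q) \<union> ?f ` poly_support q"
  have "(\<Sum>L\<in>poly_support (monom2 K * q). poly_coeffs (monom2 K * q) L * b L)
      = (\<Sum>L\<in>?S. poly_coeffs (monom2 K * q) L * b L)"
    by (rule sum.mono_neutral_left) (auto simp: poly_coeffs_outside)
  also have "\<dots> = (\<Sum>L\<in>?f ` poly_support q. poly_coeffs (monom2 K * q) L * b L)"
  proof (rule sum.mono_neutral_right)
    show "\<forall>L\<in>?S - ?f ` poly_support q. poly_coeffs (monom2 K * q) L * b L = 0"
    proof
      fix L assume L: "L \<in> ?S - ?f ` poly_support q"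
      show "poly_coeffs (monom2 K * q) L * b L = 0"
      proof (cases "fst L < fst K \<or> snd L < snd K")
        case False
        then have eq: "L = ?f (fst L - fst K, snd L - snd K)" by (simp add: prod_eq_iff)
        then have "(fst L - fst K, snd L - snd K) \<notin> poly_support q" using L by blast
        then have "poly_coeffs q (fst L - fst K, snd L - snd K) = 0" by (rule poly_coeffs_outside)
        then show ?thesis
          using poly_coeffs_monom2_mult(1)[of K q "fst L - fst K" "snd L - snd K"] eq by simp
      qed (simp add: poly_coeffs_monom2_mult(2))
    qed
  qed auto
  also have "\<dots> = (\<Sum>L\<in>poly_support q. poly_coeffs q L * b (?f L))"
    by (subst sum.reindex) (auto simp: inj_on_def poly_coeffs_monom2_mult(1) prod_eq_iff)
  finally show ?thesis .
qed

section \<open>Sequences annihilated by an irreducible polynomial\<close>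

text \<open>
  The annihilator of the multiples of \<open>q\<close> in the dual of the space with exponent \<open>2\<close>; boundedness of
  the finite partial sums states square summability.
\<close>

definition dual_space :: "real \<Rightarrow> complex poly poly \<Rightarrow> double_seq \<Rightarrow> bool" where
  "dual_space p q b \<longleftrightarrow>
     (\<exists>S. \<forall>A. finite A \<longrightarrow> (\<Sum>L\<in>A. (cmod (b (fst L) (snd L)))^2 / D_weight p 2 L) \<le> S)
     \<and> (\<forall>k l. (\<Sum>L\<in>poly_support q. poly_coeffs q L * b (k + fst L) (l + snd L)) = 0)"

lemma D_weight_shift:
  assumes p: "p \<ge> 1" and u: "u \<in> {(1, 0), (0, 1)}"
  shows "D_weight p 2 (i + fst u, j + snd u) \<le> 4 * D_weight p 2 (i, j)"
proof -
  have B: "bweight p (i + fst u) (j + snd u) \<le> bweight p i j"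
    unfolding bweight_def using p by (intro Beta_real_mono add_right_mono divide_right_mono) (auto intro: add_nonneg_pos)
  have n: "real (i + fst u + (j + snd u) + 2) \<le> 2 * real (i + j + 2)" using u by auto
  have "D_weight p 2 (i + fst u, j + snd u) = bweight p (i + fst u) (j + snd u) * ((real (i + fst u + (j + snd u) + 2))^2 / 4)"
    by (simp add: D_weight_bweight powr_minus)
  also have "\<dots> \<le> bweight p i j * ((2 * real (i + j + 2))^2 / 4)"
    using B n bweight_pos[OF p, of i j] by (intro mult_mono divide_right_mono power_mono) auto
  also have "\<dots> = 4 * D_weight p 2 (i, j)"
    unfolding power_mult_distrib by (simp add: D_weight_bweight powr_minus)
  finally show ?thesis .
qed

text \<open>
  Closure under \<open>S - e\<close> for both shifts, because a shift changes the weights by a bounded factor. This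
  is what keeps the eigensequences found below in the space.
\<close>

lemma dual_space_shift_diff:
  assumes p: "p \<ge> 1" and b: "dual_space p q b" and u: "u \<in> {(1, 0), (0, 1)}"
  shows "dual_space p q (\<lambda>i j. b (i + fst u) (j + snd u) - e * b i j)"
proof -
  obtain S where S: "\<And>A. finite A \<Longrightarrow> (\<Sum>L\<in>A. (cmod (b (fst L) (snd L)))^2 / D_weight p 2 L) \<le> S"
    using b unfolding dual_space_def by blast
  let ?b = "\<lambda>i j. b (i + fst u) (j + snd u) - e * b i j"
  let ?s = "\<lambda>L :: nat \<times> nat. (fst L + fst u, snd L + snd u)"
  let ?t = "\<lambda>L. (cmod (b (fst L) (snd L)))^2 / D_weight p 2 L"
  have each: "(cmod (?b (fst L) (snd L)))^2 / D_weight p 2 L \<le> 8 * ?t (?s L) + 2 * (cmod e)^2 * ?t L" for L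
  proof -
    have W: "D_weight p 2 L > 0" "D_weight p 2 (?s L) > 0" "D_weight p 2 (?s L) \<le> 4 * D_weight p 2 L"
      using D_weight_pos[OF p] D_weight_shift[OF p u, of "fst L" "snd L"] by auto
    from cmod_diff_square_le[of "b (fst L + fst u) (snd L + snd u)" "e * b (fst L) (snd L)"]
    have "(cmod (?b (fst L) (snd L)))^2 / D_weight p 2 L
        \<le> (2 * (cmod (b (fst L + fst u) (snd L + snd u)))^2 + 2 * (cmod e)^2 * (cmod (b (fst L) (snd L)))^2) / D_weight p 2 L"
      using W by (intro divide_right_mono) (auto simp: norm_mult power_mult_distrib)
    also have "\<dots> = 8 * ((cmod (b (fst L + fst u) (snd L + snd u)))^2 / (4 * D_weight p 2 L)) + 2 * (cmod e)^2 * ?t L"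
      by (simp add: add_divide_distrib)
    also have "(cmod (b (fst L + fst u) (snd L + snd u)))^2 / (4 * D_weight p 2 L) \<le> ?t (?s L)"
      using W by (simp add: frac_le)
    finally show ?thesis by simp
  qed
  have "(\<Sum>L\<in>A. (cmod (?b (fst L) (snd L)))^2 / D_weight p 2 L) \<le> 8 * S + 2 * (cmod e)^2 * S" if A: "finite A" for A
  proof -
    have "(\<Sum>L\<in>A. (cmod (?b (fst L) (snd L)))^2 / D_weight p 2 L) \<le> (\<Sum>L\<in>A. 8 * ?t (?s L) + 2 * (cmod e)^2 * ?t L)"
      by (intro sum_mono each)
    also have "\<dots> = 8 * (\<Sum>L\<in>A. ?t (?s L)) + 2 * (cmod e)^2 * (\<Sum>L\<in>A. ?t L)"
      by (simp only: sum.distrib sum_distrib_left)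
    also have "(\<Sum>L\<in>A. ?t (?s L)) = (\<Sum>L\<in>?s ` A. ?t L)"
      by (subst sum.reindex) (auto simp: inj_on_def prod_eq_iff)
    also have "8 * (\<Sum>L\<in>?s ` A. ?t L) + 2 * (cmod e)^2 * (\<Sum>L\<in>A. ?t L) \<le> 8 * S + 2 * (cmod e)^2 * S"
      using A by (intro add_mono mult_left_mono S) auto
    finally show ?thesis .
  qed
  moreover have "(\<Sum>L\<in>poly_support q. poly_coeffs q L * ?b (k + fst L) (l + snd L)) = 0" for k l
  proof -
    have ann: "(\<Sum>L\<in>poly_support q. poly_coeffs q L * b (k + fst L) (l + snd L)) = 0" for k l
      using b unfolding dual_space_def by blast
    have "(\<Sum>L\<in>poly_support q. poly_coeffs q L * ?b (k + fst L) (l + snd L))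
       = (\<Sum>L\<in>poly_support q. poly_coeffs q L * b ((k + fst u) + fst L) ((l + snd u) + snd L))
         - e * (\<Sum>L\<in>poly_support q. poly_coeffs q L * b (k + fst L) (l + snd L))"
      unfolding sum_distrib_left sum_subtractf[symmetric]
      by (intro sum.cong refl) (simp add: algebra_simps)
    then show ?thesis unfolding ann by simp
  qed
  ultimately show ?thesis unfolding dual_space_def by blast
qed

lemma dual_spaceD:
  "dual_space p q b \<Longrightarrow> (\<Sum>L\<in>poly_support q. poly_coeffs q L * b (k + fst L) (l + snd L)) = 0"
  unfolding dual_space_def by blast

lemma dual_space_growth:
  assumes p: "p \<ge> 1" and b: "dual_space p q b"
  shows "\<exists>C\<ge>0. growth p C b"
proof -
  obtain S where S: "\<And>A. finite A \<Longrightarrow> (\<Sum>L\<in>A. (cmod (b (fst L) (snd L)))^2 / D_weight p 2 L) \<le> S"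
    using b unfolding dual_space_def by blast
  have "S \<ge> 0" using S[of "{}"] by simp
  moreover have "(cmod (b i j))^2 \<le> S * D_weight p 2 (i, j)" for i j
    using S[of "{(i, j)}"] D_weight_pos[OF p, of 2 "(i, j)"] by (simp add: divide_le_eq)
  from growth_of_l2[OF p this] have "growth p (sqrt S / 2) b" .
  ultimately show ?thesis by (intro exI[of _ "sqrt S / 2"]) simp
qed

text \<open>
  Otherwise \<open>z\<^sub>1 - e\<close> would be a proper factor of \<open>q\<close>.
\<close>

lemma yslice_nonzero:
  assumes irr: "irreducible q" and deg: "degree q > 0"
  shows "yslice (poly_coeffs q) (poly_support q) e \<noteq> 0"
proof
  assume z: "yslice (poly_coeffs q) (poly_support q) e = 0"
  have "poly (coeff q n) e = 0" for n
    using arg_cong[OF z, of "\<lambda>f. coeff f n"] by (simp add: yslice_poly_coeffs coeff_map_poly)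
  then have "[:- e, 1:] dvd coeff q n" for n by (simp add: poly_eq_0_iff_dvd)
  then have "[:[:- e, 1:]:] dvd q" by (simp add: const_poly_dvd_iff)
  then obtain r where r: "q = [:[:- e, 1:]:] * r" by (elim dvdE)
  then have "is_unit [:[:- e, 1:]:] \<or> is_unit r" using irr by (rule irreducibleD[rotated])
  moreover have "\<not> is_unit [:[:- e, 1:] :: complex poly:]"
    unfolding is_unit_const_poly_iff by (subst is_unit_iff_degree) simp_all
  moreover have "\<not> is_unit r"
  proof
    assume "is_unit r"
    then obtain s where s: "1 = r * s" by (rule dvdE)
    then have "r \<noteq> 0" "s \<noteq> 0" by auto
    then have "degree r + degree s = degree (1 :: complex poly poly)"
      unfolding s by (simp add: degree_mult_eq)
    then have "degree r = 0" by simp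
    then show False using deg unfolding r by simp
  qed
  ultimately show False by blast
qed

text \<open>
  On eigensequences of the first shift for \<open>e\<close> the operator \<open>q(S\<^sub>1, S\<^sub>2)\<close> acts as \<open>q(e, S\<^sub>2)\<close>.
\<close>

lemma shift_poly_yslice:
  assumes e: "\<And>i j. b (Suc i) j = e * b i j"
  shows "shift_poly (0, 1) (yslice g I e) b k l = (\<Sum>L\<in>I. g L * b (k + fst L) (l + snd L))"
proof (cases "finite I")
  case True
  have be: "b (k + i) j = e ^ i * b k j" for i j
    by (induction i) (simp_all add: e)
  define n where "n = degree (yslice g I e) + Max (insert 0 (snd ` I))"
  have n: "snd L \<le> n" if "L \<in> I" for L
  proof -
    have "snd L \<le> Max (insert 0 (snd ` I))" using True that by (intro Max_ge) auto
    then show ?thesis by (simp add: n_def)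
  qed
  have "shift_poly (0, 1) (yslice g I e) b k l = (\<Sum>m\<le>n. coeff (yslice g I e) m * b (k + m * fst (0::nat, 1::nat)) (l + m * snd (0::nat, 1::nat)))"
    by (rule shift_poly_extend) (simp add: n_def)
  also have "\<dots> = (\<Sum>m\<le>n. \<Sum>L\<in>I. (if snd L = m then g L * e ^ fst L else 0) * b k (l + m))"
    by (simp add: yslice_def coeff_sum sum_distrib_right)
  also have "\<dots> = (\<Sum>L\<in>I. \<Sum>m\<le>n. (if snd L = m then g L * e ^ fst L * b k (l + m) else 0))"
    by (subst sum.swap) (intro sum.cong refl, auto)
  also have "\<dots> = (\<Sum>L\<in>I. g L * b (k + fst L) (l + snd L))"
    using n by (intro sum.cong refl) (simp add: be)
  finally show ?thesis .
qed (simp add: yslice_def)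

text \<open>
  A joint eigensequence is a multiple of \<open>x\<^sup>i y\<^sup>j\<close> with \<open>q(x, y) = 0\<close>, so its summability says that
  evaluation at a point outside the open ellipsoid is bounded.
\<close>

lemma joint_eigensequence_contradiction:
  assumes p: "p \<ge> 1" and b: "dual_space p q b" and nz: "b \<noteq> (\<lambda>i j. 0)"
    and nv: "\<forall>z\<in>ellipsoid p. eval2 q z \<noteq> 0"
    and e1: "\<And>i j. b (Suc i) j = x * b i j" and e2: "\<And>i j. b i (Suc j) = y * b i j"
  shows False
proof -
  have b_eq: "b i j = x ^ i * y ^ j * b 0 0" for i j
  proof -
    have "b i j = x ^ i * b 0 j" by (induction i) (simp_all add: e1)
    moreover have "b 0 j = y ^ j * b 0 0" by (induction j) (simp_all add: e2)
    ultimately show ?thesis by simp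
  qed
  have b00: "b 0 0 \<noteq> 0"
  proof
    assume z: "b 0 0 = 0"
    have "b i j = 0" for i j using b_eq[of i j] z by simp
    then show False using nz by (auto simp: fun_eq_iff)
  qed
  have "(\<Sum>L\<in>poly_support q. poly_coeffs q L * b (0 + fst L) (0 + snd L)) = 0"
    using b unfolding dual_space_def by blast
  moreover have "(\<Sum>L\<in>poly_support q. poly_coeffs q L * b (0 + fst L) (0 + snd L)) = bipoly (poly_coeffs q) (poly_support q) x y * b 0 0"
    unfolding bipoly_def sum_distrib_right by (intro sum.cong refl) (simp add: b_eq[of "fst _"] mult.assoc)
  ultimately have "eval2 q (x, y) = 0" using b00 by (simp add: bipoly_poly_coeffs)
  then have N: "egauge p (x, y) \<ge> 1" using nv egauge_less_iff_ellipsoid by (meson not_less)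
  obtain S where S: "\<And>A. finite A \<Longrightarrow> (\<Sum>L\<in>A. (cmod (b (fst L) (snd L)))^2 / D_weight p 2 L) \<le> S"
    using b unfolding dual_space_def by blast
  show False
  proof (rule point_evaluation_unbounded[OF p N, where S = "S / (cmod (b 0 0))^2"])
    fix A :: "(nat \<times> nat) set" assume A: "finite A"
    have "(\<Sum>L\<in>A. (cmod x ^ fst L * cmod y ^ snd L)^2 / D_weight p 2 L) * (cmod (b 0 0))^2
        = (\<Sum>L\<in>A. (cmod (b (fst L) (snd L)))^2 / D_weight p 2 L)"
      unfolding sum_distrib_right
      by (intro sum.cong refl) (simp add: b_eq[of "fst _"] norm_mult norm_power power_mult_distrib)
    also have "\<dots> \<le> S" by (rule S[OF A])
    finally show "(\<Sum>L\<in>A. (cmod x ^ fst L * cmod y ^ snd L)^2 / D_weight p 2 L) \<le> S / (cmod (b 0 0))^2"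
      using b00 by (simp add: pos_le_divide_eq)
  qed
qed

text \<open>
  For \<open>q\<close> depending on the first variable only, where an eigenvalue of the second shift is not at hand.
  A single row of the sequence is a multiple of \<open>x\<^sup>i\<close>, and evaluation on the axis is unbounded.
\<close>

lemma axis_eigensequence_contradiction:
  assumes p: "p \<ge> 1" and b: "dual_space p q b" and nz: "b \<noteq> (\<lambda>i j. 0)"
    and e1: "\<And>i j. b (Suc i) j = x * b i j" and x: "cmod x \<ge> 1"
  shows False
proof -
  obtain i l where "b i l \<noteq> 0" using nz by (auto simp: fun_eq_iff)
  have bl: "b n l = x ^ n * b 0 l" for n by (induction n) (simp_all add: e1)
  have b0: "b 0 l \<noteq> 0" using \<open>b i l \<noteq> 0\<close> bl[of i] by auto
  have "dual_space p q (\<lambda>i j. b i (j + l))"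
  proof (induction l)
    case (Suc l)
    from dual_space_shift_diff[OF p Suc, of "(0, 1)" 0] show ?case by simp
  qed (use b in simp)
  then obtain S where S: "\<And>A. finite A \<Longrightarrow> (\<Sum>L\<in>A. (cmod (b (fst L) (snd L + l)))^2 / D_weight p 2 L) \<le> S"
    unfolding dual_space_def by blast
  show False
  proof (rule point_evaluation_axis_unbounded[OF p x, where S = "S / (cmod (b 0 l))^2"])
    fix n
    have "(\<Sum>s<n. (cmod x ^ s)^2 / D_weight p 2 (s, 0)) * (cmod (b 0 l))^2
        = (\<Sum>L\<in>(\<lambda>s. (s, 0)) ` {..<n}. (cmod (b (fst L) (snd L + l)))^2 / D_weight p 2 L)"
    proof -
      have "(\<Sum>L\<in>(\<lambda>s. (s, 0)) ` {..<n}. (cmod (b (fst L) (snd L + l)))^2 / D_weight p 2 L)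
          = (\<Sum>s<n. (cmod (b s l))^2 / D_weight p 2 (s, 0))"
        by (subst sum.reindex) (auto simp: inj_on_def)
      also have "\<dots> = (\<Sum>s<n. (cmod x ^ s)^2 / D_weight p 2 (s, 0) * (cmod (b 0 l))^2)"
      proof (intro sum.cong refl)
        fix s
        have "(cmod (b s l))^2 = (cmod x ^ s)^2 * (cmod (b 0 l))^2"
          by (subst bl) (simp add: norm_mult norm_power power_mult_distrib)
        then show "(cmod (b s l))^2 / D_weight p 2 (s, 0) = (cmod x ^ s)^2 / D_weight p 2 (s, 0) * (cmod (b 0 l))^2"
          by simp
      qed
      finally show ?thesis by (simp add: sum_distrib_right)
    qed
    also have "\<dots> \<le> S" by (rule S) simp
    finally show "(\<Sum>s<n. (cmod x ^ s)^2 / D_weight p 2 (s, 0)) \<le> S / (cmod (b 0 l))^2"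
      using b0 by (simp add: pos_le_divide_eq)
  qed
qed

lemma dual_space_trivial:
  assumes p: "p \<ge> 1" and irr: "irreducible q"
    and nv: "\<forall>z\<in>ellipsoid p. eval2 q z \<noteq> 0"
    and fin: "finite {z. egauge p z = 1 \<and> eval2 q z = 0}"
    and b: "dual_space p q b"
  shows "b = (\<lambda>i j. 0)"
proof (rule ccontr)
  assume nz: "b \<noteq> (\<lambda>i j. 0)"
  have closed1: "dual_space p q (\<lambda>i j. b (i + fst (1::nat, 0::nat)) (j + snd (1::nat, 0::nat)) - e * b i j)"
    if "dual_space p q b" for b e
    by (rule dual_space_shift_diff[OF p that]) simp
  have closed2: "dual_space p q (\<lambda>i j. b (i + fst (0::nat, 1::nat)) (j + snd (0::nat, 1::nat)) - e * b i j)"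
    if "dual_space p q b" for b e
    by (rule dual_space_shift_diff[OF p that]) simp
  show False
  proof (cases "degree q = 0")
    case True
    then obtain c where c: "q = [:c:]" by (metis degree_eq_zeroE)
    have c0: "c \<noteq> 0" using irr c by auto
    have supp: "poly_support q = {..degree c} \<times> {0}" by (auto simp: poly_support_def c)
    have ann: "shift_poly (1, 0) c b k l = (\<Sum>L\<in>poly_support q. poly_coeffs q L * b (k + fst L) (l + snd L))" for b k l
    proof -
      have "{..degree c} \<times> {0} = (\<lambda>i. (i, 0 :: nat)) ` {..degree c}" by auto
      then show ?thesis
        unfolding supp by (simp add: sum.reindex inj_on_def poly_coeffs_def c shift_poly_def)
    qed
    have pz: "shift_poly (1, 0) c b k l = 0" for k l unfolding ann by (rule dual_spaceD[OF b])
    have ex: "\<exists>e b'. dual_space p q b' \<and> b' \<noteq> (\<lambda>i j. 0)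
      \<and> (\<forall>i j. b' (i + fst (1::nat, 0::nat)) (j + snd (1::nat, 0::nat)) = e * b' i j)"
      by (rule shift_poly_eigensequence[where V = "dual_space p q", OF c0 b pz nz]) (rule closed1)
    obtain e b' where b'12: "dual_space p q b'" "b' \<noteq> (\<lambda>i j. 0)"
      and b'3: "\<forall>i j. b' (i + fst (1::nat, 0::nat)) (j + snd (1::nat, 0::nat)) = e * b' i j"
      using ex by (elim exE conjE) (rule that)
    have b': "dual_space p q b'" "b' \<noteq> (\<lambda>i j. 0)" "\<And>i j. b' (Suc i) j = e * b' i j"
      using b'12 b'3 by simp_all
    obtain i j where ij: "b' i j \<noteq> 0" using b'(2) by (auto simp: fun_eq_iff)
    have "shift_poly (1, 0) c b' i j = poly c e * b' i j"
    proof -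
      have "b' (i + k) j = e ^ k * b' i j" for k by (induction k) (simp_all add: b'(3))
      then show ?thesis by (simp add: shift_poly_def poly_altdef sum_distrib_right mult.assoc)
    qed
    moreover have "shift_poly (1, 0) c b' i j = 0" unfolding ann by (rule dual_spaceD[OF b'(1)])
    ultimately have "eval2 q (e, 0) = 0" using ij by (simp add: c eval2_const)
    then have "egauge p (e, 0) \<ge> 1" using nv egauge_less_iff_ellipsoid by (meson not_less)
    then have "cmod e powr (2 * p) \<ge> 1" by (simp add: egauge_def)
    then have "cmod e \<ge> 1"
    proof (rule contrapos_pp)
      assume "\<not> cmod e \<ge> 1"
      then have "cmod e powr (2 * p) \<le> cmod e powr 1" using p by (intro powr_mono') auto
      then show "\<not> 1 \<le> cmod e powr (2 * p)" using \<open>\<not> cmod e \<ge> 1\<close> by simp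
    qed
    with axis_eigensequence_contradiction[OF p b'] show False by blast
  next
    case False
    then have deg: "degree q > 0" by simp
    obtain T where T: "T \<noteq> 0" and ann: "\<And>b C n l. growth p C b \<Longrightarrow> C \<ge> 0 \<Longrightarrow>
       (\<And>k l. (\<Sum>L\<in>poly_support q. poly_coeffs q L * b (k + fst L) (l + snd L)) = 0)
       \<Longrightarrow> shift_poly (1, 0) T b n l = 0"
    proof (rule annihilator_recurrence[OF p irr deg nv fin])
      fix T :: "complex poly"
      assume T: "T \<noteq> 0" and ann: "\<And>b C n l. growth p C b \<Longrightarrow> 0 \<le> C \<Longrightarrow>
        (\<And>k l. (\<Sum>L\<in>poly_support q. poly_coeffs q L * b (k + fst L) (l + snd L)) = 0) \<Longrightarrow> shift_poly (1, 0) T b n l = 0"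
      show thesis by (rule that[OF T ann])
    qed
    obtain C where C: "C \<ge> 0" "growth p C b" using dual_space_growth[OF p b] by blast
    have pz: "shift_poly (1, 0) T b n l = 0" for n l by (rule ann[OF C(2,1) dual_spaceD[OF b]])
    have ex: "\<exists>e b'. dual_space p q b' \<and> b' \<noteq> (\<lambda>i j. 0)
      \<and> (\<forall>i j. b' (i + fst (1::nat, 0::nat)) (j + snd (1::nat, 0::nat)) = e * b' i j)"
      by (rule shift_poly_eigensequence[where V = "dual_space p q", OF T b pz nz]) (rule closed1)
    obtain e b1 where b112: "dual_space p q b1" "b1 \<noteq> (\<lambda>i j. 0)"
      and b13: "\<forall>i j. b1 (i + fst (1::nat, 0::nat)) (j + snd (1::nat, 0::nat)) = e * b1 i j"
      using ex by (elim exE conjE) (rule that)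
    have b1: "dual_space p q b1" "b1 \<noteq> (\<lambda>i j. 0)" "\<And>i j. b1 (Suc i) j = e * b1 i j"
      using b112 b13 by simp_all
    \<comment> \<open>The eigensequences of the first shift for \<open>e\<close>; the second shift acts on this subspace.\<close>
    define V where "V b \<longleftrightarrow> dual_space p q b \<and> (\<forall>i j. b (Suc i) j = e * b i j)" for b
    have pz2: "shift_poly (0, 1) (yslice (poly_coeffs q) (poly_support q) e) b1 k l = 0" for k l
      unfolding shift_poly_yslice[where b = b1 and e = e, OF b1(3)] by (rule dual_spaceD[OF b1(1)])
    have Vb1: "V b1" using b1 by (simp add: V_def)
    have Vc: "V (\<lambda>i j. b (i + fst (0::nat, 1::nat)) (j + snd (0::nat, 1::nat)) - c * b i j)" if "V b" for b c
    proof -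
      have "dual_space p q b" "\<And>i j. b (Suc i) j = e * b i j" using that by (auto simp: V_def)
      then show ?thesis using closed2[of b c] by (simp add: V_def algebra_simps)
    qed
    have ex2: "\<exists>s b'. V b' \<and> b' \<noteq> (\<lambda>i j. 0)
      \<and> (\<forall>i j. b' (i + fst (0::nat, 1::nat)) (j + snd (0::nat, 1::nat)) = s * b' i j)"
      by (rule shift_poly_eigensequence[where V = V, OF yslice_nonzero[OF irr deg] Vb1 pz2 b1(2)]) (rule Vc)
    obtain s b2 where b212: "V b2" "b2 \<noteq> (\<lambda>i j. 0)"
      and b23: "\<forall>i j. b2 (i + fst (0::nat, 1::nat)) (j + snd (0::nat, 1::nat)) = s * b2 i j"
      using ex2 by (elim exE conjE) (rule that)
    show False
    proof (rule joint_eigensequence_contradiction[OF p _ b212(2) nv])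
      show "dual_space p q b2" "b2 (Suc i) j = e * b2 i j" for i j using b212(1) by (simp_all add: V_def)
      show "b2 i (Suc j) = s * b2 i j" for i j using b23 by simp
    qed
  qed
qed

text \<open>
  Duality: the functional that would separate a polynomial from the multiples of \<open>q\<close> is an element of
  \<open>dual_space\<close>, hence zero.
\<close>

lemma polynomial_approximation:
  assumes p: "p \<ge> 1" and irr: "irreducible q"
    and nv: "\<forall>z\<in>ellipsoid p. eval2 q z \<noteq> 0"
    and fin: "finite {z. egauge p z = 1 \<and> eval2 q z = 0}" and \<epsilon>: "\<epsilon> > 0"
  shows "\<exists>h. weighted_norm_sq (D_weight p 2) (f - h * q) < \<epsilon>"
proof (rule ccontr)
  assume "\<not> ?thesis"
  then have far: "weighted_norm_sq (D_weight p 2) (f - h * q) \<ge> \<epsilon>" for h by (meson not_less)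
  obtain b S where b: "b \<noteq> (\<lambda>L. 0)" "\<forall>A. finite A \<longrightarrow> (\<Sum>L\<in>A. (cmod (b L))^2 / D_weight p 2 L) \<le> S"
    "\<forall>h. (\<Sum>L\<in>poly_support (h * q). poly_coeffs (h * q) L * b L) = 0"
    using orthogonal_functional[of "D_weight p 2", OF D_weight_pos[OF p] \<epsilon> far]
    by (elim exE conjE) (rule that)
  have "dual_space p q (\<lambda>i j. b (i, j))"
    unfolding dual_space_def
  proof (intro conjI allI)
    show "\<exists>S. \<forall>A. finite A \<longrightarrow> (\<Sum>L\<in>A. (cmod (b (fst L, snd L)))^2 / D_weight p 2 L) \<le> S"
      using b(2) by (intro exI[of _ S]) simp
    show "(\<Sum>L\<in>poly_support q. poly_coeffs q L * b (k + fst L, l + snd L)) = 0" for k l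
      using spec[OF b(3), of "monom2 (k, l)"] by (simp add: sum_monom2_mult)
  qed
  then have "(\<lambda>i j. b (i, j)) = (\<lambda>i j. 0)" by (rule dual_space_trivial[OF p irr nv fin])
  then have "b = (\<lambda>L. 0)" by (auto simp: fun_eq_iff)
  then show False using b(1) by simp
qed

section \<open>The frontier, and the coefficient description of the norm\<close>

lemma egauge_continuous: "p \<ge> 1 \<Longrightarrow> continuous_on UNIV (egauge p)"
  unfolding egauge_def[abs_def] by (intro continuous_intros continuous_on_powr') auto

lemma egauge_scale:
  assumes "t \<ge> 0" shows "egauge p (of_real t * x, of_real t * y) = t powr (2 * p) * egauge p (x, y)"
  using assms by (simp add: egauge_def norm_mult powr_mult algebra_simps)

text \<open>
  A point with \<open>egauge p z = 1\<close> is the limit of its multiples by factors below \<open>1\<close>, which are inside.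
\<close>

lemma frontier_ellipsoid:
  assumes p: "p \<ge> 1" shows "frontier (ellipsoid p) = {z. egauge p z = 1}"
proof -
  have E: "ellipsoid p = {z. egauge p z < 1}" using egauge_less_iff_ellipsoid by auto
  have "open (ellipsoid p)"
    unfolding E using egauge_continuous[OF p] by (intro open_Collect_less continuous_on_const)
  then have int: "interior (ellipsoid p) = ellipsoid p" by (rule interior_open)
  have "closed {z. egauge p z \<le> 1}"
    using egauge_continuous[OF p] by (intro closed_Collect_le continuous_on_const)
  then have cl: "closure (ellipsoid p) \<subseteq> {z. egauge p z \<le> 1}"
    by (rule closure_minimal[rotated]) (auto simp: E)
  have "z \<in> closure (ellipsoid p)" if z: "egauge p z = 1" for z
  proof -
    obtain x y where xy: "z = (x, y)" by (cases z)
    define t where "t n = 1 - 1 / real (n + 2)" for n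
    have t: "0 \<le> t n" "t n < 1" for n by (auto simp: t_def)
    have "(\<lambda>n. 1 / real (n + 2)) \<longlonglongrightarrow> 0"
      using LIMSEQ_ignore_initial_segment[OF lim_1_over_n, of 2] by simp
    then have "t \<longlonglongrightarrow> 1 - 0" unfolding t_def by (intro tendsto_intros)
    then have "(\<lambda>n. (of_real (t n) * x, of_real (t n) * y)) \<longlonglongrightarrow> (of_real (1 - 0) * x, of_real (1 - 0) * y)"
      by (intro tendsto_intros)
    moreover have "(of_real (t n) * x, of_real (t n) * y) \<in> ellipsoid p" for n
    proof -
      have "t n powr (2 * p) \<le> t n powr 1" using t[of n] p by (intro powr_mono') auto
      then have "t n powr (2 * p) < 1" using t[of n] by simp
      then show ?thesis unfolding egauge_less_iff_ellipsoid egauge_scale[OF t(1)] using z xy by simp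
    qed
    ultimately show ?thesis unfolding closure_sequential xy
      by (intro exI[of _ "\<lambda>n. (of_real (t n) * x, of_real (t n) * y)"]) simp
  qed
  then show ?thesis unfolding frontier_def int using cl by (auto simp: E)
qed

lemma has_sum_finite_support:
  assumes "finite S" "\<And>L. L \<notin> S \<Longrightarrow> f L = 0"
  shows "(f has_sum (\<Sum>L\<in>S. f L)) UNIV"
  using has_sum_finite[OF assms(1), of f] by (subst has_sum_cong_neutral[of S _ f f]) (use assms(2) in auto)

lemma expands_on_eval2: "expands_on E (eval2 f) (poly_coeffs f)"
  unfolding expands_on_def
proof
  fix z assume "z \<in> E"
  have "eval2 f z = (\<Sum>L\<in>poly_support f. poly_coeffs f L * fst z ^ fst L * snd z ^ snd L)"
    using bipoly_poly_coeffs[of f "fst z" "snd z"] by (simp add: bipoly_def)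
  then show "((\<lambda>L. poly_coeffs f L * fst z ^ fst L * snd z ^ snd L) has_sum eval2 f z) UNIV"
    using has_sum_finite_support[of "poly_support f" "\<lambda>L. poly_coeffs f L * fst z ^ fst L * snd z ^ snd L"]
    by (simp add: poly_coeffs_outside)
qed

lemma has_sum_weighted_norm_sq: "((\<lambda>L. (cmod (poly_coeffs f L))\<^sup>2 * w L) has_sum weighted_norm_sq w f) UNIV"
  unfolding weighted_norm_sq_def by (rule has_sum_finite_support) (simp_all add: poly_coeffs_outside)

lemma eval2_holomorphic: "holomorphic2_on (eval2 f) E"
  unfolding holomorphic2_on_def
proof
  fix z :: "complex \<times> complex" assume "z \<in> E"
  have eq: "eval2 f = (\<lambda>z. \<Sum>L\<in>poly_support f. poly_coeffs f L * (fst z ^ fst L * snd z ^ snd L))"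
  proof
    fix z show "eval2 f z = (\<Sum>L\<in>poly_support f. poly_coeffs f L * (fst z ^ fst L * snd z ^ snd L))"
      using bipoly_poly_coeffs[of f "fst z" "snd z"] by (simp add: bipoly_def mult.assoc)
  qed
  have "(eval2 f has_derivative (\<lambda>h. \<Sum>L\<in>poly_support f. poly_coeffs f L *
      (fst z ^ fst L * (of_nat (snd L) * snd h * snd z ^ (snd L - 1)) + (of_nat (fst L) * fst h * fst z ^ (fst L - 1)) * snd z ^ snd L))) (at z)"
    unfolding eq by (intro has_derivative_sum has_derivative_mult_right has_derivative_mult has_derivative_power
        has_derivative_fst has_derivative_snd has_derivative_ident)
  moreover have "(\<lambda>h. \<Sum>L\<in>poly_support f. poly_coeffs f L *
      (fst z ^ fst L * (of_nat (snd L) * snd h * snd z ^ (snd L - 1)) + (of_nat (fst L) * fst h * fst z ^ (fst L - 1)) * snd z ^ snd L))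
    = (\<lambda>h. (\<Sum>L\<in>poly_support f. poly_coeffs f L * (of_nat (fst L) * fst z ^ (fst L - 1) * snd z ^ snd L)) * fst h
        + (\<Sum>L\<in>poly_support f. poly_coeffs f L * (fst z ^ fst L * of_nat (snd L) * snd z ^ (snd L - 1))) * snd h)"
    unfolding sum_distrib_right sum.distrib[symmetric]
    by (intro ext sum.cong refl) (simp add: algebra_simps)
  ultimately show "\<exists>a b. (eval2 f has_derivative (\<lambda>h. a * fst h + b * snd h)) (at z)" by metis
qed

lemma eval2_in_D_space: "eval2 f \<in> D_space p \<beta>"
  unfolding D_space_def
  using eval2_holomorphic expands_on_eval2 has_sum_imp_summable[OF has_sum_weighted_norm_sq] by blast

lemma expands_on_diff:
  assumes "expands_on E f a" "expands_on E g b"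
  shows "expands_on E (\<lambda>z. f z - g z) (\<lambda>L. a L - b L)"
  unfolding expands_on_def
proof
  fix z assume "z \<in> E"
  then have "((\<lambda>L. a L * fst z ^ fst L * snd z ^ snd L + - (b L * fst z ^ fst L * snd z ^ snd L)) has_sum (f z + - g z)) UNIV"
    using assms unfolding expands_on_def by (intro has_sum_add has_sum_uminusI) auto
  then show "((\<lambda>L. (a L - b L) * fst z ^ fst L * snd z ^ snd L) has_sum (f z - g z)) UNIV"
    by (simp add: algebra_simps)
qed

lemma eval2_mult_fun: "(\<lambda>z. eval2 h z * eval2 q z) = eval2 (h * q)"
  by (intro ext) (simp add: eval2_mult)

text \<open>
  Uniqueness of the coefficients on the ellipsoid turns the norm of a difference into a sum over
  coefficient differences.
\<close>

lemma D_norm_diff_eval2: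
  assumes p: "p \<ge> 1" and a: "expands_on (ellipsoid p) f a"
  shows "D_norm p \<beta> (\<lambda>z. f z - eval2 g z) = sqrt (\<Sum>\<^sub>\<infinity>L. (cmod (a L - poly_coeffs g L))\<^sup>2 * D_weight p \<beta> L)"
  unfolding D_norm_def power_coeffs_eqI[OF p expands_on_diff[OF a expands_on_eval2]] ..

section \<open>Cyclicity\<close>

text \<open>
  Together with the factor \<open>2\<^bsup>- \<beta>\<^esup>\<close> the dependence on \<open>\<beta>\<close> is \<open>((i + j + 2) / 2)\<^sup>\<beta>\<close>, whose base is at
  least \<open>1\<close>.
\<close>

lemma D_weight_le_2:
  assumes p: "p \<ge> 1" and \<beta>: "\<beta> \<le> 2"
  shows "D_weight p \<beta> L \<le> D_weight p 2 L"
proof -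
  obtain i j where L: "L = (i, j)" by (cases L)
  have eq: "D_weight p \<gamma> (i, j) = bweight p i j * (real (i + j + 2) / 2) powr \<gamma>" for \<gamma>
    by (simp add: D_weight_bweight powr_divide powr_minus_divide)
  show ?thesis unfolding L eq
    using bweight_pos[OF p, of i j] \<beta> by (intro mult_left_mono powr_mono) auto
qed

lemma sum_poly_coeffs_truncation:
  fixes a :: "nat \<times> nat \<Rightarrow> complex"
  assumes A: "finite A"
  shows "\<exists>f. \<forall>L. poly_coeffs f L = (if L \<in> A then a L else 0)"
  using A
proof (induction A rule: finite_induct)
  case empty
  then show ?case by (intro exI[of _ 0]) (simp add: poly_coeffs_0)
next
  case (insert K A)
  then obtain f where f: "\<And>L. poly_coeffs f L = (if L \<in> A then a L else 0)" by blast
  have "poly_coeffs (monom (monom (a K) (fst K)) (snd K)) L = (if L = K then a K else 0)" for L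
    by (auto simp: poly_coeffs_def prod_eq_iff)
  then show ?case using f insert(2)
    by (intro exI[of _ "f + monom (monom (a K) (fst K)) (snd K)"]) (auto simp: poly_coeffs_add)
qed

text \<open>
  Truncating the power series of \<open>f\<close> gives a polynomial near \<open>f\<close>, and multiples of \<open>q\<close> are near that
  polynomial in the norm for \<open>\<beta> = 2\<close>, which dominates the one for \<open>\<beta>\<close>.
\<close>

lemma cyclic_if_le_2:
  assumes p: "p \<ge> 1" and irr: "irreducible q"
    and nv: "\<forall>z\<in>ellipsoid p. eval2 q z \<noteq> 0"
    and fin: "finite {z. egauge p z = 1 \<and> eval2 q z = 0}" and \<beta>: "\<beta> \<le> 2"
  shows "cyclic p \<beta> (eval2 q)"
proof -
  have "f \<in> D_closure p \<beta> (range (\<lambda>h z. eval2 h z * eval2 q z))" if f: "f \<in> D_space p \<beta>" for f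
  proof -
    obtain a where a: "expands_on (ellipsoid p) f a"
      and sm: "(\<lambda>L. (cmod (a L))\<^sup>2 * D_weight p \<beta> L) summable_on UNIV"
      using f unfolding D_space_def by blast
    have W: "D_weight p \<beta> L > 0" for L by (rule D_weight_pos[OF p])
    have "\<exists>h. D_norm p \<beta> (\<lambda>z. f z - eval2 (h * q) z) < \<epsilon>" if \<epsilon>: "\<epsilon> > 0" for \<epsilon>
    proof -
      \<comment> \<open>Two errors, each below \<open>\<epsilon>\<^sup>2 / 8\<close> after squaring, are combined by \<open>\<bar>x - y\<bar>\<^sup>2 \<le> 2 \<bar>x\<bar>\<^sup>2 + 2 \<bar>y\<bar>\<^sup>2\<close>.\<close>
      have e2: "\<epsilon>\<^sup>2 / 8 > 0" using \<epsilon> by simp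
      obtain A where A: "finite A" "(\<Sum>\<^sub>\<infinity>L\<in>-A. (cmod (a L))\<^sup>2 * D_weight p \<beta> L) < \<epsilon>\<^sup>2 / 8"
      proof -
        let ?t = "\<lambda>L. (cmod (a L))\<^sup>2 * D_weight p \<beta> L"
        have "(sum ?t \<longlongrightarrow> infsum ?t UNIV) (finite_subsets_at_top UNIV)"
          using sm by (simp add: summable_iff_has_sum_infsum has_sum_def)
        then have "\<forall>\<^sub>F A in finite_subsets_at_top UNIV. sum ?t A > infsum ?t UNIV - \<epsilon>\<^sup>2 / 8"
          by (rule order_tendstoD(1)) (use e2 in simp)
        then obtain A where A: "finite A" "sum ?t A > infsum ?t UNIV - \<epsilon>\<^sup>2 / 8"
          unfolding eventually_finite_subsets_at_top by blast
        have "infsum ?t UNIV = infsum ?t (A \<union> - A)" by simp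
        also have "\<dots> = infsum ?t A + infsum ?t (- A)"
          by (intro infsum_Un_disjoint summable_on_subset_banach[OF sm]) (use sm in auto)
        also have "infsum ?t A = sum ?t A" using A by simp
        finally have "infsum ?t (- A) < \<epsilon>\<^sup>2 / 8" using A(2) by linarith
        then show ?thesis using A(1) that by blast
      qed
      obtain f0 where f0: "\<And>L. poly_coeffs f0 L = (if L \<in> A then a L else 0)"
        using sum_poly_coeffs_truncation[OF A(1)] by metis
      obtain h where h: "weighted_norm_sq (D_weight p 2) (f0 - h * q) < \<epsilon>\<^sup>2 / 8"
        using polynomial_approximation[OF p irr nv fin e2] by blast
      let ?g = "f0 - h * q"
      have tail: "(\<lambda>L. (cmod (a L - poly_coeffs f0 L))\<^sup>2 * D_weight p \<beta> L) summable_on UNIV"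
        "(\<Sum>\<^sub>\<infinity>L. (cmod (a L - poly_coeffs f0 L))\<^sup>2 * D_weight p \<beta> L) < \<epsilon>\<^sup>2 / 8"
      proof -
        have "(\<lambda>L. (cmod (a L))\<^sup>2 * D_weight p \<beta> L) summable_on (- A)"
          by (rule summable_on_subset_banach[OF sm]) simp
        moreover have "(\<lambda>L. (cmod (a L - poly_coeffs f0 L))\<^sup>2 * D_weight p \<beta> L) summable_on UNIV
            \<longleftrightarrow> (\<lambda>L. (cmod (a L))\<^sup>2 * D_weight p \<beta> L) summable_on (- A)"
          by (rule summable_on_cong_neutral) (auto simp: f0)
        ultimately show "(\<lambda>L. (cmod (a L - poly_coeffs f0 L))\<^sup>2 * D_weight p \<beta> L) summable_on UNIV"
          by blast
        have "(\<Sum>\<^sub>\<infinity>L. (cmod (a L - poly_coeffs f0 L))\<^sup>2 * D_weight p \<beta> L) = (\<Sum>\<^sub>\<infinity>L\<in>-A. (cmod (a L))\<^sup>2 * D_weight p \<beta> L)"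
          by (rule infsum_cong_neutral) (auto simp: f0)
        then show "(\<Sum>\<^sub>\<infinity>L. (cmod (a L - poly_coeffs f0 L))\<^sup>2 * D_weight p \<beta> L) < \<epsilon>\<^sup>2 / 8" using A(2) by simp
      qed
      have g_le: "weighted_norm_sq (D_weight p \<beta>) ?g \<le> weighted_norm_sq (D_weight p 2) ?g"
        unfolding weighted_norm_sq_def by (intro sum_mono mult_left_mono D_weight_le_2 p \<beta>) auto
      have sm2: "(\<lambda>L. 2 * ((cmod (a L - poly_coeffs f0 L))\<^sup>2 * D_weight p \<beta> L)) summable_on UNIV"
        "(\<lambda>L. 2 * ((cmod (poly_coeffs ?g L))\<^sup>2 * D_weight p \<beta> L)) summable_on UNIV"
        by (intro summable_on_cmult_right tail(1) has_sum_imp_summable[OF has_sum_weighted_norm_sq])+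
      have le: "(cmod (a L - poly_coeffs (h * q) L))\<^sup>2 * D_weight p \<beta> L
         \<le> 2 * ((cmod (a L - poly_coeffs f0 L))\<^sup>2 * D_weight p \<beta> L) + 2 * ((cmod (poly_coeffs ?g L))\<^sup>2 * D_weight p \<beta> L)" for L
      proof -
        have "a L - poly_coeffs (h * q) L = (a L - poly_coeffs f0 L) - (- poly_coeffs ?g L)"
          by (simp add: poly_coeffs_diff)
        then have "(cmod (a L - poly_coeffs (h * q) L))\<^sup>2 \<le> 2 * (cmod (a L - poly_coeffs f0 L))\<^sup>2 + 2 * (cmod (poly_coeffs ?g L))\<^sup>2"
          using cmod_diff_square_le[of "a L - poly_coeffs f0 L" "- poly_coeffs ?g L"]
          by (simp only: norm_minus_cancel)
        from mult_right_mono[OF this, of "D_weight p \<beta> L"] W[of L] show ?thesis by (simp add: algebra_simps)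
      qed
      have "(\<Sum>\<^sub>\<infinity>L. (cmod (a L - poly_coeffs (h * q) L))\<^sup>2 * D_weight p \<beta> L)
         \<le> (\<Sum>\<^sub>\<infinity>L. 2 * ((cmod (a L - poly_coeffs f0 L))\<^sup>2 * D_weight p \<beta> L) + 2 * ((cmod (poly_coeffs ?g L))\<^sup>2 * D_weight p \<beta> L))"
      proof (rule infsum_mono)
        show "(\<lambda>L. (cmod (a L - poly_coeffs (h * q) L))\<^sup>2 * D_weight p \<beta> L) summable_on UNIV"
          using W by (intro summable_on_comparison_test[OF summable_on_add[OF sm2]] le) (auto simp: less_imp_le)
      qed (use summable_on_add[OF sm2] le in auto)
      also have "\<dots> = 2 * (\<Sum>\<^sub>\<infinity>L. (cmod (a L - poly_coeffs f0 L))\<^sup>2 * D_weight p \<beta> L) + 2 * weighted_norm_sq (D_weight p \<beta>) ?g"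
        using infsum_add[OF sm2] infsumI[OF has_sum_weighted_norm_sq[of ?g "D_weight p \<beta>"]]
        by (simp add: infsum_cmult_right')
      also have "\<dots> < 2 * (\<epsilon>\<^sup>2 / 8) + 2 * (\<epsilon>\<^sup>2 / 8)" using tail(2) g_le h by linarith
      also have "\<dots> < \<epsilon>\<^sup>2" using e2 by simp
      finally have "sqrt (\<Sum>\<^sub>\<infinity>L. (cmod (a L - poly_coeffs (h * q) L))\<^sup>2 * D_weight p \<beta> L) < sqrt (\<epsilon>\<^sup>2)"
        by (rule real_sqrt_less_mono)
      then show ?thesis using \<epsilon> D_norm_diff_eval2[OF p a] by (intro exI[of _ h]) simp
    qed
    then show ?thesis
      unfolding D_closure_def using f eval2_in_D_space by (force simp: eval2_mult_fun)
  qed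
  then show ?thesis
    unfolding cyclic_def using eval2_in_D_space by (auto simp: D_closure_def)
qed

text \<open>
  Cauchy--Schwarz against the convergent series of the squares of the monomials over the weights. On the
  axes only the pure powers of one variable contribute.
\<close>

lemma boundary_point_evaluation_bounded:
  assumes p: "p \<ge> 1" and \<beta>: "\<beta> > 2" and v: "egauge p (x, y) = 1"
  shows "\<exists>S. \<forall>f. (cmod (eval2 f (x, y)))\<^sup>2 \<le> S * weighted_norm_sq (D_weight p \<beta>) f"
proof -
  have one: "t = 1" if "t powr (2 * p) = 1" "t \<ge> 0" for t :: real
  proof -
    have t: "t > 0" using that p by (cases "t = 0") auto
    then have "2 * p * ln t = 0" using ln_powr[of t "2 * p"] that by simp
    then show ?thesis using p t by simp
  qed
  have "\<exists>S. \<forall>A. finite A \<longrightarrow> (\<Sum>L\<in>A. (cmod x ^ fst L * cmod y ^ snd L)^2 / D_weight p \<beta> L) \<le> S"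
  proof -
    consider "x \<noteq> 0" "y \<noteq> 0" | "y = 0" | "x = 0" by blast
    then show ?thesis
    proof cases
      case 1
      then show ?thesis by (rule point_evaluation_bounded_interior[OF p \<beta> v])
    next
      case 2
      have "cmod x = 1" by (rule one) (use v p 2 in \<open>auto simp: egauge_def\<close>)
      from point_evaluation_bounded_axis[OF p \<beta> this]
      obtain S where S: "\<And>A. finite A \<Longrightarrow> (\<Sum>s\<in>A. (cmod x ^ s)^2 / D_weight p \<beta> (s, 0)) \<le> S" by blast
      have "(\<Sum>L\<in>A. (cmod x ^ fst L * cmod y ^ snd L)^2 / D_weight p \<beta> L) \<le> S" if A: "finite A" for A
      proof -
        let ?B = "{s. (s, 0) \<in> A}"
        have B: "finite ?B" using finite_vimageI[OF A, of "\<lambda>s. (s, 0::nat)"] by (simp add: inj_on_def vimage_def)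
        have "(\<Sum>L\<in>A. (cmod x ^ fst L * cmod y ^ snd L)^2 / D_weight p \<beta> L)
           = (\<Sum>L\<in>(\<lambda>s. (s, 0)) ` ?B. (cmod x ^ fst L * cmod y ^ snd L)^2 / D_weight p \<beta> L)"
          by (rule sum.mono_neutral_right) (use A 2 in \<open>auto simp: power_0_left image_iff\<close>)
        also have "\<dots> = (\<Sum>s\<in>?B. (cmod x ^ s)^2 / D_weight p \<beta> (s, 0))"
          by (subst sum.reindex) (auto simp: inj_on_def)
        also have "\<dots> \<le> S" by (rule S[OF B])
        finally show ?thesis .
      qed
      then show ?thesis by blast
    next
      case 3
      have "cmod y = 1" by (rule one) (use v p 3 in \<open>auto simp: egauge_def\<close>)
      from point_evaluation_bounded_axis[OF p \<beta> this]
      obtain S where S: "\<And>A. finite A \<Longrightarrow> (\<Sum>s\<in>A. (cmod y ^ s)^2 / D_weight p \<beta> (s, 0)) \<le> S" by blast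
      have sym: "D_weight p \<beta> (0, s) = D_weight p \<beta> (s, 0)" for s
        by (simp add: D_weight_bweight bweight_commute[of p 0 s])
      have "(\<Sum>L\<in>A. (cmod x ^ fst L * cmod y ^ snd L)^2 / D_weight p \<beta> L) \<le> S" if A: "finite A" for A
      proof -
        let ?B = "{s. (0, s) \<in> A}"
        have B: "finite ?B" using finite_vimageI[OF A, of "\<lambda>s. (0::nat, s)"] by (simp add: inj_on_def vimage_def)
        have "(\<Sum>L\<in>A. (cmod x ^ fst L * cmod y ^ snd L)^2 / D_weight p \<beta> L)
           = (\<Sum>L\<in>(\<lambda>s. (0, s)) ` ?B. (cmod x ^ fst L * cmod y ^ snd L)^2 / D_weight p \<beta> L)"
          by (rule sum.mono_neutral_right) (use A 3 in \<open>auto simp: power_0_left image_iff\<close>)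
        also have "\<dots> = (\<Sum>s\<in>?B. (cmod y ^ s)^2 / D_weight p \<beta> (0, s))"
          by (subst sum.reindex) (auto simp: inj_on_def)
        also have "\<dots> = (\<Sum>s\<in>?B. (cmod y ^ s)^2 / D_weight p \<beta> (s, 0))"
          by (intro sum.cong refl arg_cong2[where f = "(/)"] sym)
        also have "\<dots> \<le> S" by (rule S[OF B])
        finally show ?thesis .
      qed
      then show ?thesis by blast
    qed
  qed
  then obtain S where S: "\<And>A. finite A \<Longrightarrow> (\<Sum>L\<in>A. (cmod x ^ fst L * cmod y ^ snd L)^2 / D_weight p \<beta> L) \<le> S"
    by blast
  have "(cmod (eval2 f (x, y)))\<^sup>2 \<le> S * weighted_norm_sq (D_weight p \<beta>) f" for f
  proof -
    let ?w = "D_weight p \<beta>" and ?A = "poly_support f"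
    have W: "?w L > 0" for L by (rule D_weight_pos[OF p])
    have "cmod (eval2 f (x, y)) \<le> (\<Sum>L\<in>?A. cmod (poly_coeffs f L * x ^ fst L * y ^ snd L))"
      unfolding bipoly_poly_coeffs[symmetric] bipoly_def by (rule norm_sum)
    also have "\<dots> = (\<Sum>L\<in>?A. (cmod (poly_coeffs f L) * sqrt (?w L)) * ((cmod x ^ fst L * cmod y ^ snd L) / sqrt (?w L)))"
      by (intro sum.cong refl) (use W in \<open>simp add: norm_mult norm_power less_imp_neq[symmetric]\<close>)
    finally have "(cmod (eval2 f (x, y)))\<^sup>2
      \<le> (\<Sum>L\<in>?A. (cmod (poly_coeffs f L) * sqrt (?w L)) * ((cmod x ^ fst L * cmod y ^ snd L) / sqrt (?w L)))\<^sup>2"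
      by (rule power_mono) simp
    also have "\<dots> \<le> (\<Sum>L\<in>?A. (cmod (poly_coeffs f L) * sqrt (?w L))\<^sup>2) * (\<Sum>L\<in>?A. ((cmod x ^ fst L * cmod y ^ snd L) / sqrt (?w L))\<^sup>2)"
      by (rule Cauchy_Schwarz_ineq_sum)
    also have "(\<Sum>L\<in>?A. (cmod (poly_coeffs f L) * sqrt (?w L))\<^sup>2) = weighted_norm_sq ?w f"
      unfolding weighted_norm_sq_def using W by (intro sum.cong refl) (simp add: power_mult_distrib less_imp_le)
    also have "(\<Sum>L\<in>?A. ((cmod x ^ fst L * cmod y ^ snd L) / sqrt (?w L))\<^sup>2)
        = (\<Sum>L\<in>?A. (cmod x ^ fst L * cmod y ^ snd L)\<^sup>2 / ?w L)"
      using W by (intro sum.cong refl) (simp add: power_divide less_imp_le)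
    also have "weighted_norm_sq ?w f * \<dots> \<le> weighted_norm_sq ?w f * S"
      by (intro mult_left_mono S weighted_norm_sq_nonneg W) simp
    finally show ?thesis by (simp add: mult.commute)
  qed
  then show ?thesis by blast
qed

lemma not_cyclic_if_gt_2:
  assumes p: "p \<ge> 1" and \<beta>: "\<beta> > 2" and v: "egauge p (x, y) = 1" and zero: "eval2 q (x, y) = 0"
  shows "\<not> cyclic p \<beta> (eval2 q)"
proof
  assume cyc: "cyclic p \<beta> (eval2 q)"
  obtain S where S: "\<And>f. (cmod (eval2 f (x, y)))\<^sup>2 \<le> S * weighted_norm_sq (D_weight p \<beta>) f"
    using boundary_point_evaluation_bounded[OF p \<beta> v] by blast
  \<comment> \<open>So small that a multiple of \<open>q\<close> at this distance from \<open>1\<close> would differ from \<open>1\<close> by less than \<open>1\<close> at \<open>(x, y)\<close>.\<close>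
  define \<epsilon> where "\<epsilon> = 1 / sqrt (\<bar>S\<bar> + 1)"
  have \<epsilon>: "\<epsilon> > 0" by (simp add: \<epsilon>_def)
  have "eval2 1 \<in> D_closure p \<beta> (range (\<lambda>h z. eval2 h z * eval2 q z))"
    using cyc eval2_in_D_space unfolding cyclic_def by blast
  then obtain s where s: "s \<in> range (\<lambda>h z. eval2 h z * eval2 q z)" "D_norm p \<beta> (\<lambda>z. eval2 1 z - s z) < \<epsilon>"
    unfolding D_closure_def using \<epsilon> by blast
  then obtain h where "s = eval2 (h * q)" by (auto simp: eval2_mult_fun)
  then have "D_norm p \<beta> (\<lambda>z. eval2 1 z - eval2 (h * q) z) < \<epsilon>" using s(2) by simp
  then have "sqrt (\<Sum>\<^sub>\<infinity>L. (cmod (poly_coeffs 1 L - poly_coeffs (h * q) L))\<^sup>2 * D_weight p \<beta> L) < \<epsilon>"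
    unfolding D_norm_diff_eval2[OF p expands_on_eval2] .
  then have "sqrt (weighted_norm_sq (D_weight p \<beta>) (1 - h * q)) < \<epsilon>"
    unfolding poly_coeffs_diff[symmetric] infsumI[OF has_sum_weighted_norm_sq] .
  then have "(sqrt (weighted_norm_sq (D_weight p \<beta>) (1 - h * q)))\<^sup>2 < \<epsilon>\<^sup>2"
    by (intro power_strict_mono) (auto intro: weighted_norm_sq_nonneg[OF D_weight_pos[OF p]])
  then have n: "weighted_norm_sq (D_weight p \<beta>) (1 - h * q) < 1 / (\<bar>S\<bar> + 1)"
    by (simp add: \<epsilon>_def power_divide weighted_norm_sq_nonneg[OF D_weight_pos[OF p]])
  have "eval2 (1 - h * q) (x, y) = 1" using zero by (simp add: eval2_def)
  then have "1 \<le> S * weighted_norm_sq (D_weight p \<beta>) (1 - h * q)" using S[of "1 - h * q"] by simp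
  also have "\<dots> \<le> \<bar>S\<bar> * weighted_norm_sq (D_weight p \<beta>) (1 - h * q)"
    by (intro mult_right_mono weighted_norm_sq_nonneg[OF D_weight_pos[OF p]]) simp
  also have "\<dots> \<le> \<bar>S\<bar> * (1 / (\<bar>S\<bar> + 1))" using n by (intro mult_left_mono) auto
  also have "\<dots> < 1" by simp
  finally show False by simp
qed

theorem corollary30:
  fixes p \<beta> :: real and q :: "complex poly poly"
  assumes "p \<ge> 1"
    and "irreducible q"
    and "\<forall>z \<in> ellipsoid p. eval2 q z \<noteq> 0"
    and "finite {z \<in> frontier (ellipsoid p). eval2 q z = 0}"
    and "{z \<in> frontier (ellipsoid p). eval2 q z = 0} \<noteq> {}"
  shows "cyclic p \<beta> (eval2 q) \<longleftrightarrow> \<beta> \<le> 2"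
proof
  have fr: "{z \<in> frontier (ellipsoid p). eval2 q z = 0} = {z. egauge p z = 1 \<and> eval2 q z = 0}"
    by (simp add: frontier_ellipsoid[OF assms(1)])
  show "cyclic p \<beta> (eval2 q)" if "\<beta> \<le> 2"
    by (rule cyclic_if_le_2[OF assms(1-3) assms(4)[unfolded fr] that])
  obtain x y where "egauge p (x, y) = 1" "eval2 q (x, y) = 0" using assms(5) unfolding fr by auto
  then show "\<beta> \<le> 2" if "cyclic p \<beta> (eval2 q)"
    using that not_cyclic_if_gt_2[OF assms(1)] by force
qed

end
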